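(* For any positive integer $d\ge 14$, there exists a finite poset $P$ with $|P|=d$ whose order polytope $\mathcal{O}_P$ (of dimension $d$) is not Ehrhart positive. Moreover, every order polytope of dimension $d\le 11$ (i.e., $\mathcal{O}_P$ for any poset $P$ with at most $11$ elements) is Ehrhart positive.
   Context: For a finite poset $(P,\le_P)$, the order polytope $\mathcal{O}_P\subset\mathbb{R}^P$ is the set of functions $f:P\to\mathbb{R}$ with $0\le f(i)\le 1$ for all $i\in P$ and $f(i)\le f(j)$ whenever $i\le_P j$; it has dimension $|P|$. For an integral polytope $\mathcal{P}$, the Ehrhart polynomial $i(\mathcal{P},t)$ is the polynomial in $t$ with $i(\mathcal{P},t)=|t\mathcal{P}\cap\mathbb{Z}^e|$ for all positive integers $t$. An integral polytope is Ehrhart positive if all coefficients of its Ehrhart polynomial are positive. *)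

theory Defs
  imports Complex_Main "HOL-Computational_Algebra.Polynomial"
begin

text \<open>
  For a finite index set P, the space of functions from P to the reals is represented by the
  functions on the ambient type that vanish outside P.  With this convention dilation is
  pointwise multiplication and the lattice points are the integer-valued functions.
\<close>

definition order_polytope :: "'a set \<Rightarrow> ('a \<times> 'a) set \<Rightarrow> ('a \<Rightarrow> real) set" where
  "order_polytope P r =
     {f. (\<forall>i. i \<notin> P \<longrightarrow> f i = 0) \<and>
         (\<forall>i\<in>P. 0 \<le> f i \<and> f i \<le> 1) \<and>
         (\<forall>i\<in>P. \<forall>j\<in>P. (i, j) \<in> r \<longrightarrow> f i \<le> f j)}"

definition dilate :: "real \<Rightarrow> ('a \<Rightarrow> real) set \<Rightarrow> ('a \<Rightarrow> real) set" where
  "dilate c S = (\<lambda>f i. c * f i) ` S"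

definition lattice_points :: "('a \<Rightarrow> real) set" where
  "lattice_points = {f. \<forall>i. f i \<in> \<int>}"

definition is_ehrhart_poly :: "('a \<Rightarrow> real) set \<Rightarrow> real poly \<Rightarrow> bool" where
  "is_ehrhart_poly S p \<longleftrightarrow>
     (\<forall>t::nat. t > 0 \<longrightarrow> poly p (real t) = real (card (dilate (real t) S \<inter> lattice_points)))"

text \<open>
  The description below is satisfied by at most one polynomial (shown by the following lemma);
  for integral polytopes, which include the order polytopes of finite posets, one exists by
  Ehrhart's theorem.
\<close>

definition ehrhart_poly :: "('a \<Rightarrow> real) set \<Rightarrow> real poly" where
  "ehrhart_poly S = (THE p. is_ehrhart_poly S p)"

lemma is_ehrhart_poly_unique:
  assumes "is_ehrhart_poly S p" "is_ehrhart_poly S q"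
  shows "p = q"
proof (rule ccontr)
  assume "p \<noteq> q"
  then have "finite {x. poly (p - q) x = 0}"
    by (intro poly_roots_finite) simp
  moreover have "real ` {0<..} \<subseteq> {x. poly (p - q) x = 0}"
    using assms by (auto simp: is_ehrhart_poly_def)
  ultimately have "finite (real ` {0<..})"
    by (rule finite_subset[rotated])
  then have "finite {0::nat<..}"
    by (rule finite_imageD) simp
  then show False
    using infinite_Ioi by blast
qed

lemma ehrhart_poly_eqI:
  assumes "is_ehrhart_poly S p"
  shows "ehrhart_poly S = p"
  unfolding ehrhart_poly_def
  using assms is_ehrhart_poly_unique by blast

text \<open>
  The coefficients of the Ehrhart polynomial are those up to its degree (which is the dimension
  of the polytope).
\<close>

definition ehrhart_positive :: "('a \<Rightarrow> real) set \<Rightarrow> bool" where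
  "ehrhart_positive S \<longleftrightarrow>
     (\<forall>k \<le> degree (ehrhart_poly S). coeff (ehrhart_poly S) k > 0)"

end

theory Submission
  imports Defs "HOL-Library.FuncSet"
begin

text \<open>
  The lattice points of the dilate by \<open>t\<close> are the monotone maps into \<open>{0..t}\<close>.

  Positivity. Put every element of a poset \<open>Q\<close> independently with probability \<open>x\<close> into a random
  set \<open>S\<close> and call \<open>S\<close> good if it contains at least half of every filter. The probability \<open>V Q\<close> that
  \<open>S\<close> is good is a polynomial in \<open>x\<close> going from 0 to 1. Russo's formula expresses its derivative by
  the pivotal pairs, and cutting \<open>Q\<close> at the least filter of maximal weight factors these, so that
  \<open>(V Q)' = (\<Sum>B. V (Q - B) * G B)\<close> over the filters \<open>B\<close> of \<open>Q\<close>. The point of the threshold one half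
  is that \<open>G B\<close> is a nonnegative multiple of \<open>x\<^sup>k * (1 - x)\<^sup>k\<close> if \<open>B\<close> has \<open>2 * k + 1\<close> elements,
  with a similar formula for even cardinality. Hence \<open>\<Sum>B. mono_count (Q - B) j * V B\<close>, which
  interpolates between \<open>mono_count Q j\<close> at \<open>x = 0\<close> and \<open>mono_count Q (j + 1)\<close> at \<open>x = 1\<close>, solves a
  linear differential equation, and the Ehrhart polynomial becomes a nonnegative combination of
  polynomials that depend only on a word, namely on the sequence of the block types \<open>B\<close>. For words
  of size at most 11 all coefficients of these polynomials are nonnegative, with one exception: the
  linear coefficient for the block sizes 1, 1, 1, 1, 3, 1, 1, 1, 1. It is compensated by the words
  in which the block of size 3 is split into blocks of sizes 1 and 2.

  Counterexamples. For each \<open>d\<close> from 14 to 21 there is an antichain of \<open>a\<close> elements below an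
  antichain of \<open>b\<close> elements, \<open>a + b = d\<close>, for which the linear coefficient is negative. In dimension
  21 one can take \<open>b = 1\<close>, where the Ehrhart polynomial is the sum of \<open>(s + 1)\<^sup>a\<close> over \<open>s \<le> t\<close>; its
  derivative is, up to a constant, \<open>a\<close> times the polynomial for \<open>a - 1\<close>, and so a negative coefficient
  persists in all larger dimensions.
\<close>

section \<open>Monotone maps and filters\<close>

definition filters :: "('a \<times> 'a) set \<Rightarrow> 'a set \<Rightarrow> 'a set set" where
  "filters r Q = {U. U \<subseteq> Q \<and> (\<forall>x\<in>U. \<forall>y\<in>Q. (x, y) \<in> r \<longrightarrow> y \<in> U)}"

lemma filters_subset: "U \<in> filters r Q \<Longrightarrow> U \<subseteq> Q"
  by (auto simp: filters_def)

lemma finite_filters [simp]: "finite Q \<Longrightarrow> finite (filters r Q)"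
  by (rule finite_subset[of _ "Pow Q"]) (auto simp: filters_def)

lemma empty_in_filters [simp]: "{} \<in> filters r Q"
  by (auto simp: filters_def)

lemma self_in_filters [simp]: "Q \<in> filters r Q"
  by (auto simp: filters_def)

lemma filters_empty [simp]: "filters r {} = {{}}"
  by (auto simp: filters_def)

lemma filters_trans: "B \<in> filters r Q \<Longrightarrow> U \<in> filters r B \<Longrightarrow> U \<in> filters r Q"
  by (auto simp: filters_def)

lemma filters_Int: "U \<in> filters r Q \<Longrightarrow> B \<subseteq> Q \<Longrightarrow> U \<inter> B \<in> filters r B"
  by (auto simp: filters_def)

lemma filters_Un: "B \<in> filters r Q \<Longrightarrow> U \<in> filters r (Q - B) \<Longrightarrow> U \<union> B \<in> filters r Q"
  by (auto simp: filters_def)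

lemma filters_Un2: "U \<in> filters r Q \<Longrightarrow> U' \<in> filters r Q \<Longrightarrow> U \<union> U' \<in> filters r Q"
  by (auto simp: filters_def)

lemma filters_Int2: "U \<in> filters r Q \<Longrightarrow> U' \<in> filters r Q \<Longrightarrow> U \<inter> U' \<in> filters r Q"
  by (auto simp: filters_def)

text \<open>A filter \<open>C\<close> inside a filter \<open>B\<close> of \<open>Q\<close> is the
  same as a filter \<open>C\<close> of \<open>Q\<close> together with the filter
  \<open>D = B - C\<close> of \<open>Q - C\<close>. This merges two successive cuts into one, or
  separates them again.\<close>

lemma sum_filters_swap:
  fixes f :: "'a set \<Rightarrow> 'a set \<Rightarrow> 'b::comm_monoid_add"
  assumes "finite Q"
  shows "(\<Sum>B\<in>filters r Q. \<Sum>C\<in>filters r B. f (B - C) C) =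
         (\<Sum>C\<in>filters r Q. \<Sum>D\<in>filters r (Q - C). f D C)"
proof -
  have fin: "finite (filters r B)" if "B \<subseteq> Q" for B
    using finite_subset[OF that assms] by simp
  have "(\<Sum>B\<in>filters r Q. \<Sum>C\<in>filters r B. f (B - C) C) =
        (\<Sum>(B, C)\<in>(SIGMA B:filters r Q. filters r B). f (B - C) C)"
    by (rule sum.Sigma) (use assms fin filters_subset[of _ r Q] in auto)
  also have "\<dots> = (\<Sum>(C, D)\<in>(SIGMA C:filters r Q. filters r (Q - C)). f D C)"
    by (rule sum.reindex_bij_witness[where i = "\<lambda>(C, D). (C \<union> D, C)" and j = "\<lambda>(B, C). (C, B - C)"])
       (auto simp: filters_def)
  also have "\<dots> = (\<Sum>C\<in>filters r Q. \<Sum>D\<in>filters r (Q - C). f D C)"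
    by (rule sum.Sigma[symmetric]) (use assms fin in auto)
  finally show ?thesis .
qed

definition mono_count :: "('a \<times> 'a) set \<Rightarrow> 'a set \<Rightarrow> nat \<Rightarrow> nat" where
  "mono_count r Q s = card {f \<in> Q \<rightarrow>\<^sub>E {..<s}. \<forall>i\<in>Q. \<forall>j\<in>Q. (i, j) \<in> r \<longrightarrow> f i \<le> f j}"

lemma mono_count_empty [simp]: "mono_count r {} s = 1"
  by (simp add: mono_count_def)

lemma mono_count_0: "Q \<noteq> {} \<Longrightarrow> mono_count r Q 0 = 0"
proof -
  assume "Q \<noteq> {}"
  then have "{f \<in> Q \<rightarrow>\<^sub>E {..<0::nat}. \<forall>i\<in>Q. \<forall>j\<in>Q. (i, j) \<in> r \<longrightarrow> f i \<le> f j} = {}"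
    by (auto simp: PiE_def Pi_def)
  then show ?thesis
    by (simp only: mono_count_def card.empty)
qed

text \<open>The points sent to the top value \<open>s\<close> form a filter \<open>B\<close>, and
  the rest is a monotone map on \<open>Q - B\<close> into the smaller values; any such pair can be
  glued back together.\<close>

lemma mono_count_Suc:
  assumes "finite Q"
  shows "mono_count r Q (Suc s) = (\<Sum>B\<in>filters r Q. mono_count r (Q - B) s)"
proof -
  let ?M = "\<lambda>Q s. {f \<in> Q \<rightarrow>\<^sub>E {..<s::nat}. \<forall>i\<in>Q. \<forall>j\<in>Q. (i, j) \<in> r \<longrightarrow> f i \<le> f j}"
  have fin: "finite (?M Q' s)" if "finite Q'" for Q' s
    by (rule finite_subset[OF _ finite_PiE[of Q' "\<lambda>_. {..<s}"]]) (use that in auto)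
  have "card (?M Q (Suc s)) = card (SIGMA B:filters r Q. ?M (Q - B) s)"
  proof (rule bij_betw_same_card[of "\<lambda>f. ({x\<in>Q. f x = s}, restrict f (Q - {x\<in>Q. f x = s}))"],
      rule bij_betw_byWitness[where f' = "\<lambda>(B, g) x. if x \<in> B then s else g x"])
    show "\<forall>f\<in>?M Q (Suc s). (\<lambda>(B, g) x. if x \<in> B then s else g x)
        ({x\<in>Q. f x = s}, restrict f (Q - {x\<in>Q. f x = s})) = f"
      by (auto simp: fun_eq_iff PiE_def extensional_def)
    show "\<forall>p\<in>(SIGMA B:filters r Q. ?M (Q - B) s).
        (\<lambda>f. ({x\<in>Q. f x = s}, restrict f (Q - {x\<in>Q. f x = s}))) ((\<lambda>(B, g) x. if x \<in> B then s else g x) p) = p"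
    proof
      fix p assume "p \<in> (SIGMA B:filters r Q. ?M (Q - B) s)"
      then obtain B g where p: "p = (B, g)" and B: "B \<in> filters r Q" and g: "g \<in> ?M (Q - B) s"
        by auto
      have *: "{x\<in>Q. (if x \<in> B then s else g x) = s} = B"
        using B g by (auto simp: filters_def PiE_def Pi_def)
      have "restrict (\<lambda>x. if x \<in> B then s else g x) (Q - B) = g"
        using g by (auto simp: fun_eq_iff PiE_def extensional_def)
      then show "(\<lambda>f. ({x\<in>Q. f x = s}, restrict f (Q - {x\<in>Q. f x = s}))) ((\<lambda>(B, g) x. if x \<in> B then s else g x) p) = p"
        using * by (simp add: p)
    qed
    show "(\<lambda>f. ({x\<in>Q. f x = s}, restrict f (Q - {x\<in>Q. f x = s}))) ` ?M Q (Suc s) \<subseteq> (SIGMA B:filters r Q. ?M (Q - B) s)"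
    proof (rule image_subsetI)
      fix f assume f': "f \<in> ?M Q (Suc s)"
      then have f: "f \<in> Q \<rightarrow>\<^sub>E {..<Suc s}" and mono: "\<forall>i\<in>Q. \<forall>j\<in>Q. (i, j) \<in> r \<longrightarrow> f i \<le> f j"
        by auto
      let ?B = "{x\<in>Q. f x = s}"
      have 1: "?B \<in> filters r Q"
        using f mono unfolding filters_def PiE_def Pi_def
        by (auto simp: less_Suc_eq_le intro: antisym)
      have 2: "restrict f (Q - ?B) \<in> (Q - ?B) \<rightarrow>\<^sub>E {..<s}"
        using f by (auto simp: PiE_def Pi_def less_Suc_eq)
      have 3: "\<forall>i\<in>Q - ?B. \<forall>j\<in>Q - ?B. (i, j) \<in> r \<longrightarrow> restrict f (Q - ?B) i \<le> restrict f (Q - ?B) j"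
        using mono by auto
      show "(?B, restrict f (Q - ?B)) \<in> (SIGMA B:filters r Q. ?M (Q - B) s)"
        by (intro SigmaI CollectI conjI 1 2 3)
    qed
    show "(\<lambda>(B, g) x. if x \<in> B then s else g x) ` (SIGMA B:filters r Q. ?M (Q - B) s) \<subseteq> ?M Q (Suc s)"
    proof (rule image_subsetI)
      fix p assume "p \<in> (SIGMA B:filters r Q. ?M (Q - B) s)"
      then obtain B g where p: "p = (B, g)" and B: "B \<in> filters r Q" and g: "g \<in> (Q - B) \<rightarrow>\<^sub>E {..<s}"
        and mono: "\<forall>i\<in>Q - B. \<forall>j\<in>Q - B. (i, j) \<in> r \<longrightarrow> g i \<le> g j"
        by auto
      have 1: "(\<lambda>x. if x \<in> B then s else g x) \<in> Q \<rightarrow>\<^sub>E {..<Suc s}"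
        using B g by (auto simp: filters_def PiE_def Pi_def extensional_def less_Suc_eq)
      have 2: "(if i \<in> B then s else g i) \<le> (if j \<in> B then s else g j)"
        if "i \<in> Q" "j \<in> Q" "(i, j) \<in> r" for i j
        using that B g mono by (auto simp: filters_def PiE_def Pi_def less_imp_le)
      show "(\<lambda>(B, g) x. if x \<in> B then s else g x) p \<in> ?M Q (Suc s)"
        using 1 2 by (simp add: p)
    qed
  qed
  also have "\<dots> = (\<Sum>B\<in>filters r Q. card (?M (Q - B) s))"
    by (rule card_SigmaI) (use assms fin in auto)
  finally show ?thesis
    by (simp only: mono_count_def)
qed

section \<open>Good sets and their derivative\<close>

text \<open>The probability that \<open>i\<close> given elements lie in the random set and
  \<open>j\<close> given others do not; a Bernstein basis polynomial without its binomial
  factor.\<close>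

definition bm :: "nat \<Rightarrow> nat \<Rightarrow> real poly" where
  "bm i j = [:0, 1:] ^ i * [:1, -1:] ^ j"

lemma bm_mult: "bm i j * bm k l = bm (i + k) (j + l)"
  by (simp add: bm_def power_add mult_ac)

lemma bm_0_0 [simp]: "bm 0 0 = 1"
  by (simp add: bm_def)

lemma pderiv_sum': "pderiv (\<Sum>x\<in>A. f x) = (\<Sum>x\<in>A. pderiv (f x))"
  by (induction A rule: infinite_finite_induct) (simp_all add: pderiv_add)

lemma pderiv_bm:
  "pderiv (bm i j) = smult (real i) (bm (i - 1) j) - smult (real j) (bm i (j - 1))"
proof -
  have 1: "pderiv [:1, -1::real:] = [:-1:]" and 2: "pderiv [:0, 1::real:] = [:1:]"
    by (simp_all add: pderiv_pCons)
  show ?thesis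
    unfolding bm_def pderiv_mult pderiv_power 1 2 by (simp add: algebra_simps)
qed

lemma poly_bm: "poly (bm i j) x = x ^ i * (1 - x) ^ j"
  by (simp add: bm_def)

text \<open>For constant marks equal to \<open>m > 0\<close> the weight is nonpositive exactly if
  \<open>S\<close> contains at least half of \<open>U\<close>.\<close>

definition wt :: "int \<Rightarrow> ('a \<Rightarrow> int) \<Rightarrow> 'a set \<Rightarrow> 'a set \<Rightarrow> int" where
  "wt m a S U = (\<Sum>x\<in>U. if x \<in> S then - m else a x)"

definition good :: "('a \<times> 'a) set \<Rightarrow> int \<Rightarrow> ('a \<Rightarrow> int) \<Rightarrow> 'a set \<Rightarrow> 'a set \<Rightarrow> bool" where
  "good r m a Q S \<longleftrightarrow> (\<forall>U\<in>filters r Q. wt m a S U \<le> 0)"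

definition good_poly :: "('a \<times> 'a) set \<Rightarrow> int \<Rightarrow> ('a \<Rightarrow> int) \<Rightarrow> 'a set \<Rightarrow> real poly" where
  "good_poly r m a Q = (\<Sum>S | S \<subseteq> Q \<and> good r m a Q S. bm (card S) (card Q - card S))"

text \<open>These are the pivotal pairs whose least filter of maximal weight is all of
  \<open>B\<close>. They are what remains inside the filter when a pivotal pair of a larger poset is
  cut.\<close>

definition primes :: "('a \<times> 'a) set \<Rightarrow> int \<Rightarrow> ('a \<Rightarrow> int) \<Rightarrow> 'a set \<Rightarrow> ('a \<times> 'a set) set" where
  "primes r m a B = {(x, R). x \<in> B \<and> R \<subseteq> B - {x} \<and> good r m a B (insert x R) \<and> 0 < wt m a R B \<and>
     (\<forall>U\<in>filters r B. U \<noteq> B \<longrightarrow> wt m a R U < wt m a R B)}"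

definition prime_poly :: "('a \<times> 'a) set \<Rightarrow> int \<Rightarrow> ('a \<Rightarrow> int) \<Rightarrow> 'a set \<Rightarrow> real poly" where
  "prime_poly r m a B = (\<Sum>(x, R)\<in>primes r m a B. bm (card R) (card B - 1 - card R))"

lemma wt_cong: "(\<And>x. x \<in> U \<Longrightarrow> x \<in> S \<longleftrightarrow> x \<in> S') \<Longrightarrow> (\<And>x. x \<in> U \<Longrightarrow> a x = a' x) \<Longrightarrow> wt m a S U = wt m a' S' U"
  by (auto simp: wt_def intro!: sum.cong)

lemma wt_empty [simp]: "wt m a S {} = 0"
  by (simp add: wt_def)

lemma wt_Un: "finite U \<Longrightarrow> finite U' \<Longrightarrow> U \<inter> U' = {} \<Longrightarrow> wt m a S (U \<union> U') = wt m a S U + wt m a S U'"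
  by (simp add: wt_def sum.union_disjoint)

lemma wt_Un_Int: "finite U \<Longrightarrow> finite U' \<Longrightarrow> wt m a S (U \<union> U') + wt m a S (U \<inter> U') = wt m a S U + wt m a S U'"
  by (simp add: wt_def sum.union_inter)

lemma wt_insert_le: "finite U \<Longrightarrow> 0 \<le> m + a x \<Longrightarrow> wt m a (insert x R) U \<le> wt m a R U"
  unfolding wt_def by (intro sum_mono) auto

lemma good_insert: "finite Q \<Longrightarrow> 0 \<le> m + a x \<Longrightarrow> good r m a Q R \<Longrightarrow> good r m a Q (insert x R)"
  unfolding good_def by (meson filters_subset finite_subset order_trans wt_insert_le)

lemma finite_primes [simp]: "finite B \<Longrightarrow> finite (primes r m a B)"
  by (rule finite_subset[of _ "B \<times> Pow B"]) (auto simp: primes_def)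

text \<open>Russo's formula. The product rule gives a sum over pairs with \<open>insert x R\<close>
  good minus a sum over pairs with \<open>R\<close> good. As goodness survives the insertion of
  elements, the second set of pairs lies in the first, and the pivotal pairs remain.\<close>

lemma pderiv_good_poly:
  assumes Q: "finite Q" and a: "\<And>x. 0 < m + a x"
  shows "pderiv (good_poly r m a Q) = (\<Sum>(x, R) | x \<in> Q \<and> R \<subseteq> Q - {x} \<and> good r m a Q (insert x R) \<and> \<not> good r m a Q R.
           bm (card R) (card Q - 1 - card R))" (is "_ = sum ?g ?Piv")
proof -
  let ?G = "{S. S \<subseteq> Q \<and> good r m a Q S}"
  let ?n = "card Q"
  let ?P1 = "{(x, R). x \<in> Q \<and> R \<subseteq> Q - {x} \<and> good r m a Q (insert x R)}"
  let ?P2 = "{(x, R). x \<in> Q \<and> R \<subseteq> Q - {x} \<and> good r m a Q R}"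
  have finG: "finite ?G"
    using Q by auto
  have fin1: "finite ?P1"
    by (rule finite_subset[of _ "Q \<times> Pow Q"]) (use Q in auto)
  have fS: "finite S" if "S \<in> ?G" for S
    using that Q finite_subset by auto
  \<comment> \<open>The factors \<open>card S\<close> and, in the next formula,
    \<open>?n - card S\<close> that come from differentiation are read as choices of
    \<open>x\<close> inside and outside of \<open>S\<close>.\<close>
  have 1: "(\<Sum>S\<in>?G. smult (real (card S)) (bm (card S - 1) (?n - card S))) = sum ?g ?P1"
  proof -
    have "(\<Sum>S\<in>?G. smult (real (card S)) (bm (card S - 1) (?n - card S))) =
        (\<Sum>S\<in>?G. \<Sum>x\<in>S. bm (card S - 1) (?n - card S))"
      by (simp add: of_nat_poly)
    also have "\<dots> = (\<Sum>(S, x)\<in>(SIGMA S:?G. S). bm (card S - 1) (?n - card S))"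
      by (rule sum.Sigma) (use finG fS in auto)
    also have "\<dots> = sum ?g ?P1"
    proof (rule sum.reindex_bij_witness[where i = "\<lambda>(x, R). (insert x R, x)" and j = "\<lambda>(S, x). (x, S - {x})"], goal_cases)
      case (5 p)
      then obtain S x where p: "p = (S, x)" "S \<subseteq> Q" "x \<in> S" by auto
      then have "finite S" using Q finite_subset by auto
      with p have "card S \<noteq> 0" "card (S - {x}) = card S - 1" by auto
      then show ?case using p by auto
    qed (auto simp: insert_absorb)
    finally show ?thesis .
  qed
  have 2: "(\<Sum>S\<in>?G. smult (real (?n - card S)) (bm (card S) (?n - card S - 1))) = sum ?g ?P2"
  proof -
    have "(\<Sum>S\<in>?G. smult (real (?n - card S)) (bm (card S) (?n - card S - 1))) =
        (\<Sum>S\<in>?G. \<Sum>x\<in>Q - S. bm (card S) (?n - card S - 1))"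
      by (rule sum.cong) (use Q in \<open>auto simp: of_nat_poly card_Diff_subset finite_subset\<close>)
    also have "\<dots> = (\<Sum>(S, x)\<in>(SIGMA S:?G. Q - S). bm (card S) (?n - card S - 1))"
      by (rule sum.Sigma) (use finG Q in auto)
    also have "\<dots> = sum ?g ?P2"
      by (rule sum.reindex_bij_witness[where i = "\<lambda>(x, R). (R, x)" and j = "\<lambda>(S, x). (x, S)"]) auto
    finally show ?thesis .
  qed
  have sub: "?P2 \<subseteq> ?P1"
    using good_insert[OF Q] a by (auto simp: less_imp_le)
  have "pderiv (good_poly r m a Q) = sum ?g ?P1 - sum ?g ?P2"
    unfolding good_poly_def pderiv_sum' pderiv_bm sum_subtractf 1[symmetric] 2[symmetric] ..
  also have "\<dots> = sum ?g (?P1 - ?P2)"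
    using sub fin1 by (simp add: sum_diff)
  also have "?P1 - ?P2 = ?Piv"
    by auto
  finally show ?thesis .
qed

text \<open>
  Among the filters of largest weight there is a least one, because the weight is modular.
\<close>

definition least_max :: "('a \<times> 'a) set \<Rightarrow> int \<Rightarrow> ('a \<Rightarrow> int) \<Rightarrow> 'a set \<Rightarrow> 'a set \<Rightarrow> 'a set \<Rightarrow> bool" where
  "least_max r m a Q R B \<longleftrightarrow> B \<in> filters r Q \<and>
     (\<forall>U\<in>filters r Q. wt m a R U \<le> wt m a R B \<and> (wt m a R U = wt m a R B \<longrightarrow> B \<subseteq> U))"

lemma least_max_exists:
  assumes Q: "finite Q"
  shows "\<exists>B. least_max r m a Q R B"
proof -
  let ?F = "filters r Q" and ?w = "wt m a R"
  have fin: "finite ?F" and ne: "?F \<noteq> {}"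
    using Q empty_in_filters[of r Q] by (simp, blast)
  define mx where "mx = Max (?w ` ?F)"
  have mx: "?w U \<le> mx" if "U \<in> ?F" for U
    using that fin by (auto simp: mx_def)
  have "mx \<in> ?w ` ?F"
    unfolding mx_def using fin ne by (intro Max_in) auto
  then have "\<exists>B. B \<in> ?F \<and> ?w B = mx"
    by auto
  then obtain B where B: "B \<in> ?F" "?w B = mx"
    and min: "\<And>U. U \<in> ?F \<and> ?w U = mx \<Longrightarrow> card B \<le> card U"
    using ex_has_least_nat[of "\<lambda>B. B \<in> ?F \<and> ?w B = mx" _ card] by metis
  have finB: "finite U" if "U \<in> ?F" for U
    using finite_subset[OF filters_subset[OF that] Q] .
  \<comment> \<open>Modularity forces the union and the intersection to have weight
    \<open>mx\<close> too, and \<open>B\<close> has the least cardinality among such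
    filters.\<close>
  have "B \<subseteq> U" if U: "U \<in> ?F" "?w U = mx" for U
  proof -
    have "?w (U \<union> B) + ?w (U \<inter> B) = mx + mx"
      using wt_Un_Int[of U B m a R] finB U B by simp
    moreover have "?w (U \<union> B) \<le> mx" "?w (U \<inter> B) \<le> mx"
      using mx filters_Un2 filters_Int2 U B by blast+
    ultimately have "?w (U \<inter> B) = mx"
      by linarith
    then have "card B \<le> card (U \<inter> B)"
      using min filters_Int2 U B by blast
    then have "U \<inter> B = B"
      using finB[OF B(1)] by (metis Int_lower2 card_seteq)
    then show ?thesis by blast
  qed
  then show ?thesis
    using B mx unfolding least_max_def by metis
qed

lemma least_max_unique: "least_max r m a Q R B \<Longrightarrow> least_max r m a Q R B' \<Longrightarrow> B = B'"
  unfolding least_max_def by (metis order_antisym)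

text \<open>Outside \<open>B\<close> the set is good, since a filter of \<open>Q - B\<close> of
  positive weight could be added to \<open>B\<close>. The pivot lies in \<open>B\<close>, since
  otherwise \<open>B\<close> would keep its positive weight after the insertion. Inside
  \<open>B\<close> the pair is prime because \<open>B\<close> is the least maximizer. For the
  converse, weights split along \<open>B\<close> and its complement, so the two parts can be chosen
  independently.\<close>

lemma pivot_decomposition:
  assumes Q: "finite Q" and B: "B \<in> filters r Q"
  shows "bij_betw (\<lambda>(x, R). (R - B, x, R \<inter> B))
     {(x, R). x \<in> Q \<and> R \<subseteq> Q - {x} \<and> good r m a Q (insert x R) \<and> \<not> good r m a Q R \<and> least_max r m a Q R B}
     ({S. S \<subseteq> Q - B \<and> good r m a (Q - B) S} \<times> primes r m a B)" (is "bij_betw ?f ?P ?S")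
proof (rule bij_betw_byWitness[where f' = "\<lambda>(S, x, R). (x, S \<union> R)"])
  have BQ: "B \<subseteq> Q" and finB: "finite B"
    using filters_subset[OF B] finite_subset[OF filters_subset[OF B] Q] by auto
  have split: "wt m a R U = wt m a R (U - B) + wt m a R (U \<inter> B)" if "U \<subseteq> Q" for U R
  proof -
    have "finite U" "(U - B) \<inter> (U \<inter> B) = {}" "(U - B) \<union> (U \<inter> B) = U"
      using finite_subset[OF that Q] by auto
    then show ?thesis
      using wt_Un[of "U - B" "U \<inter> B" m a R] by simp
  qed
  show "\<forall>p\<in>?P. (\<lambda>(S, x, R). (x, S \<union> R)) (?f p) = p"
  proof
    fix p :: "'a \<times> 'a set"
    obtain x R where p: "p = (x, R)"
      by (cases p)
    have "(R - B) \<union> (R \<inter> B) = R"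
      by blast
    then show "(\<lambda>(S, x, R). (x, S \<union> R)) (?f p) = p"
      by (simp add: p)
  qed
  show "\<forall>p\<in>?S. ?f ((\<lambda>(S, x, R). (x, S \<union> R)) p) = p"
  proof
    fix p assume "p \<in> ?S"
    then obtain S x R where p: "p = (S, x, R)" and "S \<subseteq> Q - B" "(x, R) \<in> primes r m a B"
      by auto
    then have "R \<subseteq> B" "S \<inter> B = {}"
      by (auto simp: primes_def)
    then have "(S \<union> R) - B = S" "(S \<union> R) \<inter> B = R"
      by blast+
    then show "?f ((\<lambda>(S, x, R). (x, S \<union> R)) p) = p"
      by (simp add: p)
  qed
  show "?f ` ?P \<subseteq> ?S"
  proof (rule image_subsetI)
    fix p assume "p \<in> ?P"
    then obtain x R where p: "p = (x, R)" and x: "x \<in> Q" and R: "R \<subseteq> Q - {x}" and g: "good r m a Q (insert x R)"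
      and ng: "\<not> good r m a Q R" and lm: "least_max r m a Q R B"
      by blast
    obtain U where U: "U \<in> filters r Q" "0 < wt m a R U"
      using ng by (auto simp: good_def not_le)
    then have pos: "0 < wt m a R B"
      using lm unfolding least_max_def by force
    have xB: "x \<in> B"
    proof (rule ccontr)
      assume "x \<notin> B"
      then have "wt m a (insert x R) B = wt m a R B"
        by (intro wt_cong) auto
      then show False
        using pos g B unfolding good_def by force
    qed
    have g': "good r m a (Q - B) (R - B)"
      unfolding good_def
    proof
      fix U assume U: "U \<in> filters r (Q - B)"
      then have fU: "finite U" "U \<inter> B = {}"
        using filters_subset[OF U] finite_subset[OF filters_subset[OF U]] Q by auto
      have "wt m a R (U \<union> B) \<le> wt m a R B"
        using lm filters_Un[OF B U] by (simp add: least_max_def)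
      moreover have "wt m a R (U \<union> B) = wt m a R U + wt m a R B"
        using fU finB by (intro wt_Un)
      moreover have "wt m a (R - B) U = wt m a R U"
        by (rule wt_cong) (use fU in auto)
      ultimately show "wt m a (R - B) U \<le> 0" by simp
    qed
    have loc: "wt m a (R \<inter> B) U = wt m a R U" "wt m a (insert x (R \<inter> B)) U = wt m a (insert x R) U"
      if "U \<subseteq> B" for U
      using that by (auto intro!: wt_cong)
    have "good r m a B (insert x (R \<inter> B))"
      unfolding good_def
    proof
      fix U assume U: "U \<in> filters r B"
      then have "wt m a (insert x R) U \<le> 0"
        using g filters_trans[OF B U] by (simp add: good_def)
      then show "wt m a (insert x (R \<inter> B)) U \<le> 0"
        using loc(2)[OF filters_subset[OF U]] by simp
    qed
    moreover have "\<forall>U\<in>filters r B. U \<noteq> B \<longrightarrow> wt m a (R \<inter> B) U < wt m a (R \<inter> B) B"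
    proof (intro ballI impI)
      fix U assume U: "U \<in> filters r B" "U \<noteq> B"
      have "wt m a R U \<le> wt m a R B" "wt m a R U = wt m a R B \<Longrightarrow> B \<subseteq> U"
        using lm filters_trans[OF B U(1)] by (simp_all add: least_max_def)
      then have "wt m a R U < wt m a R B"
        using U(2) filters_subset[OF U(1)] by (metis order_antisym order_le_less)
      then show "wt m a (R \<inter> B) U < wt m a (R \<inter> B) B"
        using loc(1)[OF filters_subset[OF U(1)]] loc(1)[of B] by simp
    qed
    moreover have "R \<inter> B \<subseteq> B - {x}" "R - B \<subseteq> Q - B"
      using R by auto
    moreover have "0 < wt m a (R \<inter> B) B"
      using pos loc(1)[of B] by simp
    ultimately have "(x, R \<inter> B) \<in> primes r m a B" "R - B \<subseteq> Q - B"
      using xB unfolding primes_def by blast+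
    then show "?f p \<in> ?S"
      using g' by (simp add: p)
  qed
  show "(\<lambda>(S, x, R). (x, S \<union> R)) ` ?S \<subseteq> ?P"
  proof (rule image_subsetI)
    fix q assume "q \<in> ?S"
    moreover obtain S x R' where q: "q = (S, x, R')"
      by (cases q)
    ultimately have S: "S \<subseteq> Q - B" and gS: "good r m a (Q - B) S" and p: "(x, R') \<in> primes r m a B"
      by simp_all
    from p have x: "x \<in> B" and R': "R' \<subseteq> B - {x}" and gx: "good r m a B (insert x R')"
      and pos: "0 < wt m a R' B"
      by (simp_all add: primes_def)
    from p have proper: "wt m a R' U < wt m a R' B" if "U \<in> filters r B" "U \<noteq> B" for U
      using that by (simp add: primes_def)
    let ?R = "S \<union> R'"
    have xQ: "x \<in> Q" and RQ: "?R \<subseteq> Q - {x}"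
      using x BQ S R' by auto
    have loc: "wt m a ?R (U - B) = wt m a S (U - B)" "wt m a (insert x ?R) (U - B) = wt m a S (U - B)"
      "wt m a ?R (U \<inter> B) = wt m a R' (U \<inter> B)" "wt m a (insert x ?R) (U \<inter> B) = wt m a (insert x R') (U \<inter> B)" for U
      using S R' x by (auto intro!: wt_cong)
    have fil: "U - B \<in> filters r (Q - B)" "U \<inter> B \<in> filters r B" if "U \<in> filters r Q" for U
      using that filters_Int[OF that, of "Q - B"] filters_Int[OF that BQ] filters_subset[OF that]
      by (auto simp: Int_Diff[symmetric] Int_absorb2)
    have le: "wt m a R' U \<le> wt m a R' B" if "U \<in> filters r B" for U
      using proper[OF that] by (cases "U = B") auto
    have g: "good r m a Q (insert x ?R)"
      unfolding good_def
    proof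
      fix U assume U: "U \<in> filters r Q"
      have "wt m a (insert x ?R) U = wt m a S (U - B) + wt m a (insert x R') (U \<inter> B)"
        using split[OF filters_subset[OF U]] loc by simp
      also have "\<dots> \<le> 0"
        using gS gx fil[OF U] unfolding good_def by (meson add_nonpos_nonpos)
      finally show "wt m a (insert x ?R) U \<le> 0" .
    qed
    have wB: "wt m a ?R B = wt m a R' B"
      using loc(3)[of B] by simp
    have lm: "least_max r m a Q ?R B"
      unfolding least_max_def
    proof (intro conjI ballI impI)
      fix U assume U: "U \<in> filters r Q"
      have eq: "wt m a ?R U = wt m a S (U - B) + wt m a R' (U \<inter> B)"
        using split[OF filters_subset[OF U]] loc by simp
      have a1: "wt m a S (U - B) \<le> 0" and a2: "wt m a R' (U \<inter> B) \<le> wt m a R' B"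
        using gS le fil[OF U] unfolding good_def by auto
      show "wt m a ?R U \<le> wt m a ?R B"
        using eq a1 a2 wB by linarith
      show "B \<subseteq> U" if "wt m a ?R U = wt m a ?R B"
      proof -
        have "wt m a R' (U \<inter> B) = wt m a R' B"
          using eq a1 a2 wB that by linarith
        then have "U \<inter> B = B"
          using proper[OF fil(2)[OF U]] by force
        then show ?thesis by blast
      qed
    qed (rule B)
    have "\<not> good r m a Q ?R"
      using B pos wB unfolding good_def by force
    then show "(\<lambda>(S, x, R). (x, S \<union> R)) q \<in> ?P"
      using xQ RQ g lm by (simp add: q)
  qed
qed

text \<open>The pivotal pairs are sorted by their least filter of maximal weight; for a fixed
  filter, \<open>pivot_decomposition\<close> turns the sum into a product.\<close>

lemma pderiv_good_poly_filters:
  assumes Q: "finite Q" and a: "\<And>x. 0 < m + a x"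
  shows "pderiv (good_poly r m a Q) = (\<Sum>B\<in>filters r Q. good_poly r m a (Q - B) * prime_poly r m a B)"
proof -
  let ?Piv = "{(x, R). x \<in> Q \<and> R \<subseteq> Q - {x} \<and> good r m a Q (insert x R) \<and> \<not> good r m a Q R}"
  let ?PB = "\<lambda>B. {(x, R). x \<in> Q \<and> R \<subseteq> Q - {x} \<and> good r m a Q (insert x R) \<and> \<not> good r m a Q R \<and> least_max r m a Q R B}"
  let ?g = "\<lambda>(x, R). bm (card R) (card Q - 1 - card R)"
  have fin: "finite ?Piv"
    by (rule finite_subset[of _ "Q \<times> Pow Q"]) (use Q in auto)
  have "?Piv = (\<Union>B\<in>filters r Q. ?PB B)"
    using least_max_exists[OF Q] by (fastforce simp: least_max_def)
  then have "sum ?g ?Piv = sum ?g (\<Union>B\<in>filters r Q. ?PB B)"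
    by (rule arg_cong)
  also have "\<dots> = (\<Sum>B\<in>filters r Q. sum ?g (?PB B))"
  proof (rule sum.UNION_disjoint)
    show "finite (filters r Q)"
      using Q by simp
    show "\<forall>B\<in>filters r Q. finite (?PB B)"
      by (intro ballI finite_subset[OF _ fin]) auto
    show "\<forall>B\<in>filters r Q. \<forall>B'\<in>filters r Q. B \<noteq> B' \<longrightarrow> ?PB B \<inter> ?PB B' = {}"
      using least_max_unique by fast
  qed
  also have "\<dots> = (\<Sum>B\<in>filters r Q. good_poly r m a (Q - B) * prime_poly r m a B)"
  proof (rule sum.cong)
    fix B assume B: "B \<in> filters r Q"
    have BQ: "B \<subseteq> Q" and finB: "finite B"
      using filters_subset[OF B] finite_subset[OF filters_subset[OF B] Q] by auto
    let ?S = "{S. S \<subseteq> Q - B \<and> good r m a (Q - B) S}"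
    let ?h = "\<lambda>(S, x, R). bm (card S) (card (Q - B) - card S) * bm (card R) (card B - 1 - card R)"
    let ?f = "\<lambda>(x, R). (R - B, x, R \<inter> B)"
    note bij = pivot_decomposition[OF Q B, of m a]
    have "sum ?g (?PB B) = (\<Sum>p\<in>?PB B. ?h (?f p))"
    proof (rule sum.cong[OF refl])
      fix p assume p: "p \<in> ?PB B"
      obtain x R where [simp]: "p = (x, R)"
        by (cases p)
      have x: "x \<in> Q" and R: "R \<subseteq> Q - {x}"
        using p by auto
      have "?f p \<in> ?S \<times> primes r m a B"
        using bij_betwE[OF bij] p by blast
      then have xB: "x \<in> B"
        by (auto simp: primes_def)
      have finR: "finite R" using R Q finite_subset by auto
      have c1: "card R = card (R - B) + card (R \<inter> B)"
        using card_Int_Diff[OF finR, of B] by simp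
      have c2: "card Q = card (Q - B) + card B"
        using card_Int_Diff[OF Q, of B] BQ by (simp add: Int_absorb1)
      have "R \<inter> B \<subseteq> B - {x}" using R by auto
      then have c3: "card (R \<inter> B) \<le> card B - 1"
        using xB finB card_mono[of "B - {x}" "R \<inter> B"] by simp
      have "R - B \<subseteq> Q - B" using R by auto
      then have c4: "card (R - B) \<le> card (Q - B)"
        using Q by (intro card_mono) auto
      have c5: "card B > 0" using xB finB card_gt_0_iff by blast
      \<comment> \<open>The exponents of \<open>1 - x\<close> add up as well; the bounds on the
        cardinalities keep the subtractions of natural numbers from truncating.\<close>
      have "card Q - 1 - card R = (card (Q - B) - card (R - B)) + (card B - 1 - card (R \<inter> B))"
        using c1 c2 c3 c4 c5 by linarith
      then show "?g p = ?h (?f p)"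
        using c1 by (simp add: bm_mult)
    qed
    also have "\<dots> = sum ?h (?S \<times> primes r m a B)"
      by (rule sum.reindex_bij_betw[OF bij])
    also have "\<dots> = (\<Sum>S\<in>?S. bm (card S) (card (Q - B) - card S)) * prime_poly r m a B"
      unfolding prime_poly_def sum_product sum.cartesian_product
      by (rule sum.cong) auto
    finally show "sum ?g (?PB B) = good_poly r m a (Q - B) * prime_poly r m a B"
      by (simp add: good_poly_def)
  qed simp
  finally show ?thesis
    using pderiv_good_poly[OF assms] by simp
qed

section \<open>Averaging over the tie-breaking marks\<close>

lemma smult_sum_right: "smult c (\<Sum>x\<in>A. f x) = (\<Sum>x\<in>A. smult c (f x))"
  by (induction A rule: infinite_finite_induct) (simp_all add: smult_add_right)

lemma good_cong: "(\<And>x. x \<in> Q \<Longrightarrow> a x = a' x) \<Longrightarrow> good r m a Q S = good r m a' Q S"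
  unfolding good_def using wt_cong[of _ S S a a' m] filters_subset[of _ r Q] by (metis subsetD)

lemma good_poly_cong: "(\<And>x. x \<in> Q \<Longrightarrow> a x = a' x) \<Longrightarrow> good_poly r m a Q = good_poly r m a' Q"
  unfolding good_poly_def using good_cong[of Q a a'] by metis

lemma prime_poly_cong:
  assumes "\<And>x. x \<in> B \<Longrightarrow> a x = a' x"
  shows "prime_poly r m a B = prime_poly r m a' B"
proof -
  have "wt m a R U = wt m a' R U" if "U \<in> filters r B" for R U
    by (rule wt_cong) (use filters_subset[OF that] assms in auto)
  then have "primes r m a B = primes r m a' B"
    unfolding primes_def using good_cong[of B a a' r m] assms self_in_filters[of B r] by auto
  then show ?thesis
    by (simp add: prime_poly_def)
qed

text \<open>
  With all marks equal to \<open>m\<close> a filter is heavy if at least half of it lies in the random set. The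
  perturbation by 1, with sign averaged over all choices, breaks the ties of filters of even size;
  12 is larger than the number of elements, so it affects nothing but ties.
\<close>

definition mark :: "int \<Rightarrow> 'a set \<Rightarrow> 'a \<Rightarrow> int" where
  "mark m c x = (if x \<in> c then m + 1 else m - 1)"

definition avg_good :: "('a \<times> 'a) set \<Rightarrow> 'a set \<Rightarrow> real poly" where
  "avg_good r Q = smult ((1 / 2) ^ card Q) (\<Sum>c\<in>Pow Q. good_poly r 12 (mark 12 c) Q)"

definition avg_prime :: "('a \<times> 'a) set \<Rightarrow> 'a set \<Rightarrow> real poly" where
  "avg_prime r Q = smult ((1 / 2) ^ card Q) (\<Sum>c\<in>Pow Q. prime_poly r 12 (mark 12 c) Q)"

lemma mark_pos: "0 < mark 12 c x" "0 < 12 + mark 12 c x"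
  by (auto simp: mark_def)

text \<open>Averaging respects the products: the marks on \<open>Q - B\<close> and on
  \<open>B\<close> are independent, and each factor depends only on the marks of its own
  part.\<close>

lemma pderiv_avg_good:
  assumes Q: "finite Q"
  shows "pderiv (avg_good r Q) = (\<Sum>B\<in>filters r Q. avg_good r (Q - B) * avg_prime r B)"
proof -
  let ?g = "\<lambda>c. good_poly r 12 (mark 12 c)" and ?p = "\<lambda>c. prime_poly r 12 (mark 12 c)"
  have "pderiv (avg_good r Q) = smult ((1 / 2) ^ card Q) (\<Sum>c\<in>Pow Q. \<Sum>B\<in>filters r Q. ?g c (Q - B) * ?p c B)"
    unfolding avg_good_def pderiv_smult pderiv_sum'
    by (simp add: pderiv_good_poly_filters[OF Q mark_pos(2)])
  also have "\<dots> = (\<Sum>B\<in>filters r Q. smult ((1 / 2) ^ card Q) (\<Sum>c\<in>Pow Q. ?g c (Q - B) * ?p c B))"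
    by (subst sum.swap) (simp add: smult_sum_right)
  also have "\<dots> = (\<Sum>B\<in>filters r Q. avg_good r (Q - B) * avg_prime r B)"
  proof (rule sum.cong[OF refl])
    fix B assume B: "B \<in> filters r Q"
    then have BQ: "B \<subseteq> Q"
      by (rule filters_subset)
    have "(\<Sum>c\<in>Pow Q. ?g c (Q - B) * ?p c B) =
        (\<Sum>(c1, c2)\<in>Pow (Q - B) \<times> Pow B. ?g c1 (Q - B) * ?p c2 B)"
    proof (rule sum.reindex_bij_witness[where i = "\<lambda>(c1, c2). c1 \<union> c2" and j = "\<lambda>c. (c - B, c \<inter> B)"], goal_cases)
      case (5 c)
      have "?g (c - B) (Q - B) = ?g c (Q - B)"
        by (rule good_poly_cong) (auto simp: mark_def)
      moreover have "?p (c \<inter> B) B = ?p c B"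
        by (rule prime_poly_cong) (auto simp: mark_def)
      ultimately show ?case by simp
    qed (use BQ in auto)
    also have "\<dots> = (\<Sum>c\<in>Pow (Q - B). ?g c (Q - B)) * (\<Sum>c\<in>Pow B. ?p c B)"
      by (simp add: sum_product sum.cartesian_product)
    finally have *: "(\<Sum>c\<in>Pow Q. ?g c (Q - B) * ?p c B) = \<dots>" .
    have "card Q = card (Q - B) + card B"
      using card_Int_Diff[OF Q, of B] BQ by (simp add: Int_absorb1)
    then show "smult ((1 / 2) ^ card Q) (\<Sum>c\<in>Pow Q. ?g c (Q - B) * ?p c B) = avg_good r (Q - B) * avg_prime r B"
      unfolding * avg_good_def avg_prime_def by (simp add: power_add mult.commute)
  qed
  finally show ?thesis .
qed

text \<open>At \<open>x = 1\<close> only the full set has nonzero probability, and it is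
  good.\<close>

lemma poly_good_poly_1:
  assumes Q: "finite Q"
  shows "poly (good_poly r 12 a Q) 1 = 1"
proof -
  have "good r 12 a Q Q"
    unfolding good_def
  proof
    fix U assume "U \<in> filters r Q"
    then have "wt 12 a Q U = (\<Sum>x\<in>U. - 12)"
      unfolding wt_def using filters_subset by (intro sum.cong) auto
    then show "wt 12 a Q U \<le> 0"
      by simp
  qed
  moreover have "card S < card Q" if "S \<subseteq> Q" "S \<noteq> Q" for S
    using that Q by (intro psubset_card_mono) auto
  moreover have "poly (good_poly r 12 a Q) 1 =
      (\<Sum>S | S \<subseteq> Q \<and> good r 12 a Q S. if S = Q then 1 else 0)"
    unfolding good_poly_def poly_sum poly_bm
    by (rule sum.cong) (use calculation(2) in auto)
  ultimately show ?thesis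
    using Q by (simp add: sum.delta)
qed

text \<open>At \<open>x = 0\<close> only the empty set has nonzero probability, and for it the
  filter \<open>Q\<close> has positive weight.\<close>

lemma poly_good_poly_0:
  assumes Q: "finite Q" "Q \<noteq> {}" and a: "\<And>x. 0 < a x"
  shows "poly (good_poly r 12 a Q) 0 = 0"
proof -
  have "wt 12 a {} Q > 0"
    unfolding wt_def using Q a by (auto intro!: sum_pos)
  then have "\<not> good r 12 a Q {}"
    unfolding good_def using self_in_filters[of Q r] by (metis not_le)
  then show ?thesis
    unfolding good_poly_def poly_sum poly_bm
    using Q finite_subset[of _ Q] by (intro sum.neutral) (auto simp: card_eq_0_iff)
qed

lemma poly_avg_good_1: "finite Q \<Longrightarrow> poly (avg_good r Q) 1 = 1"
  by (simp add: avg_good_def poly_sum poly_good_poly_1 card_Pow power_divide)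

lemma poly_avg_good_0: "finite Q \<Longrightarrow> Q \<noteq> {} \<Longrightarrow> poly (avg_good r Q) 0 = 0"
  by (simp add: avg_good_def poly_sum poly_good_poly_0 mark_pos)

lemma avg_good_empty [simp]: "avg_good r {} = 1"
proof -
  have "good r 12 a {} {}" for a
    by (simp add: good_def)
  then have "{S. S \<subseteq> {} \<and> good r 12 a {} S} = {{}}" for a
    by auto
  then show ?thesis
    by (simp add: avg_good_def good_poly_def)
qed

lemma avg_prime_empty [simp]: "avg_prime r {} = 0"
  by (simp add: avg_prime_def prime_poly_def primes_def)

section \<open>Densities of blocks with at most 11 elements\<close>

lemma wt_mark_bounds:
  assumes "finite U" "R \<subseteq> U"
  shows "wt 12 (mark 12 c) R U \<le> 13 * int (card (U - R)) - 12 * int (card R)"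
    and "wt 12 (mark 12 c) R U \<ge> 11 * int (card (U - R)) - 12 * int (card R)"
proof -
  have "wt 12 (mark 12 c) R U = wt 12 (mark 12 c) R (U - R) + wt 12 (mark 12 c) R R"
    using assms wt_Un[of "U - R" R 12 "mark 12 c" R] finite_subset
    by (metis Diff_disjoint Diff_partition Int_commute Un_commute finite_Diff)
  moreover have "wt 12 (mark 12 c) R R = - 12 * int (card R)"
    by (simp add: wt_def)
  moreover have "wt 12 (mark 12 c) R (U - R) \<le> (\<Sum>x\<in>U - R. 13)"
    unfolding wt_def by (rule sum_mono) (auto simp: mark_def)
  moreover have "wt 12 (mark 12 c) R (U - R) \<ge> (\<Sum>x\<in>U - R. 11)"
    unfolding wt_def by (rule sum_mono) (auto simp: mark_def)
  ultimately show "wt 12 (mark 12 c) R U \<le> 13 * int (card (U - R)) - 12 * int (card R)"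
    and "wt 12 (mark 12 c) R U \<ge> 11 * int (card (U - R)) - 12 * int (card R)"
    by simp_all
qed

text \<open>The possible cardinalities of \<open>R\<close> in a prime pair of a block of size
  \<open>d\<close>: only \<open>k\<close> for \<open>d = 2 * k + 1\<close>, but both halves
  \<open>d / 2 - 1\<close> and \<open>d / 2\<close> for positive even \<open>d\<close>.\<close>

definition block_ranks :: "nat \<Rightarrow> nat set" where
  "block_ranks d = {k. d = 2 * k + 1 \<or> 0 < d \<and> d = 2 * k \<or> d = 2 * k + 2}"

lemma finite_block_ranks [simp]: "finite (block_ranks d)"
  by (rule finite_subset[of _ "{..d}"]) (auto simp: block_ranks_def)

lemma block_ranks_odd: "block_ranks (2 * k + 1) = {k}"
  unfolding block_ranks_def by auto

lemma block_ranks_even: "block_ranks (2 * k + 2) = {k, k + 1}"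
  unfolding block_ranks_def by auto

text \<open>The weight of \<open>B\<close> is positive for \<open>R\<close> and at most zero after
  one insertion. The perturbation of the marks amounts to at most 11 in total, hence to less than
  12, so these two inequalities place \<open>card B - 2 * card R\<close> between 0 and 2.\<close>

lemma prime_rank:
  assumes B: "finite B" "card B \<le> 11" and p: "(x, R) \<in> primes r 12 (mark 12 c) B"
  shows "card R \<in> block_ranks (card B)"
proof -
  from p have x: "x \<in> B" and R: "R \<subseteq> B - {x}" and g: "good r 12 (mark 12 c) B (insert x R)"
    and pos: "0 < wt 12 (mark 12 c) R B"
    by (simp_all add: primes_def)
  have finR: "finite R" and RB: "R \<subseteq> B" "insert x R \<subseteq> B" and xR: "x \<notin> R"
    using R B x finite_subset[of R B] by auto
  have "wt 12 (mark 12 c) (insert x R) B \<le> 0"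
    using g self_in_filters[of B r] unfolding good_def by blast
  then have 1: "11 * int (card (B - insert x R)) - 12 * int (card (insert x R)) \<le> 0"
    using wt_mark_bounds(2)[OF B(1) RB(2), of c] by linarith
  have 2: "0 < 13 * int (card (B - R)) - 12 * int (card R)"
    using wt_mark_bounds(1)[OF B(1) RB(1), of c] pos by linarith
  have 3: "card (insert x R) = card R + 1"
    using finR xR by simp
  have 4: "card B = card (B - R) + card R" "card B = card (B - insert x R) + card (insert x R)"
    using card_Int_Diff[OF B(1), of R] card_Int_Diff[OF B(1), of "insert x R"] RB by (simp_all add: Int_absorb1)
  show ?thesis
    using 1 2 3 4 B(2) unfolding block_ranks_def by simp linarith
qed

text \<open>The coefficient \<open>N k\<close> is the average, over the marks, of the number of
  prime pairs with \<open>card R = k\<close>.\<close>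

lemma avg_prime_expand:
  assumes B: "finite B" "card B \<le> 11"
  obtains N where "\<And>k. 0 \<le> N k"
    "avg_prime r B = (\<Sum>k\<in>block_ranks (card B). smult (N k) (bm k (card B - 1 - k)))"
proof
  let ?P = "\<lambda>c. primes r 12 (mark 12 c) B"
  let ?N = "\<lambda>k. (1 / 2) ^ card B * (\<Sum>c\<in>Pow B. real (card {p \<in> ?P c. card (snd p) = k}))"
  show "0 \<le> ?N k" for k
    by (simp add: sum_nonneg)
  have "prime_poly r 12 (mark 12 c) B =
      (\<Sum>k\<in>block_ranks (card B). smult (real (card {p \<in> ?P c. card (snd p) = k})) (bm k (card B - 1 - k)))" for c
  proof -
    have "prime_poly r 12 (mark 12 c) B = (\<Sum>p\<in>?P c. bm (card (snd p)) (card B - 1 - card (snd p)))"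
      by (simp add: prime_poly_def case_prod_unfold)
    also have "\<dots> = (\<Sum>k\<in>block_ranks (card B). \<Sum>p | p \<in> ?P c \<and> card (snd p) = k. bm (card (snd p)) (card B - 1 - card (snd p)))"
      using B prime_rank[OF B, of _ _ r c] by (intro sum.group[symmetric]) auto
    also have "\<dots> = (\<Sum>k\<in>block_ranks (card B). \<Sum>p | p \<in> ?P c \<and> card (snd p) = k. bm k (card B - 1 - k))"
      by (intro sum.cong) auto
    finally show ?thesis
      by (simp add: of_nat_poly)
  qed
  then have "avg_prime r B = smult ((1 / 2) ^ card B) (\<Sum>c\<in>Pow B. \<Sum>k\<in>block_ranks (card B).
      smult (real (card {p \<in> ?P c. card (snd p) = k})) (bm k (card B - 1 - k)))"
    unfolding avg_prime_def by (simp only:)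
  also have "\<dots> = (\<Sum>k\<in>block_ranks (card B). smult (?N k) (bm k (card B - 1 - k)))"
    by (subst sum.swap) (simp add: smult_sum_right smult_sum[symmetric] sum_distrib_left)
  finally show "avg_prime r B = (\<Sum>k\<in>block_ranks (card B). smult (?N k) (bm k (card B - 1 - k)))" .
qed

text \<open>The density is constant because the only rank is 0, and its antiderivative runs from 0
  to 1 on the unit interval, so the constant is 1.\<close>

lemma avg_prime_single: "avg_prime r {x} = 1"
  and avg_good_single: "avg_good r {x} = [:0, 1:]"
proof -
  obtain N where "avg_prime r {x} = (\<Sum>k\<in>block_ranks 1. smult (N k) (bm k (1 - 1 - k)))"
    using avg_prime_expand[of "{x}" r] by auto
  then have N: "avg_prime r {x} = [:N 0:]"
    using block_ranks_odd[of 0] by simp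
  have "filters r {x} = {{}, {x}}"
    by (auto simp: filters_def)
  then have d: "pderiv (avg_good r {x}) = [:N 0:]"
    using pderiv_avg_good[of "{x}" r] N by simp
  have "pderiv (avg_good r {x} - [:0, N 0:]) = 0"
    by (simp add: pderiv_diff d pderiv_pCons)
  then obtain c where "avg_good r {x} - [:0, N 0:] = [:c:]"
    using pderiv_iszero by blast
  then have "avg_good r {x} = [:c, N 0:]"
    by (simp add: diff_eq_eq)
  moreover from this have "c = 0" "N 0 = 1"
    using poly_avg_good_0[of "{x}" r] poly_avg_good_1[of "{x}" r] by auto
  ultimately show "avg_prime r {x} = 1" "avg_good r {x} = [:0, 1:]"
    using N by (simp_all add: one_pCons)
qed

text \<open>The element \<open>q\<close> outside the set has positive weight, so it must not be a
  filter by itself; the whole pair is a tie, decided by the mark of \<open>q\<close>.\<close>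

lemma good_pair:
  assumes "p \<noteq> q"
  shows "good r 12 (mark 12 c) {p, q} {p} \<longleftrightarrow> {q} \<notin> filters r {p, q} \<and> q \<notin> c"
proof -
  have sub: "filters r {p, q} \<subseteq> {{}, {p}, {q}, {p, q}}"
    by (auto simp: filters_def)
  have w: "wt 12 (mark 12 c) {p} {q} > 0" "wt 12 (mark 12 c) {p} {p} \<le> 0"
    "wt 12 (mark 12 c) {p} {p, q} \<le> 0 \<longleftrightarrow> q \<notin> c"
    using assms by (auto simp: wt_def mark_def)
  show ?thesis
  proof
    assume "good r 12 (mark 12 c) {p, q} {p}"
    then show "{q} \<notin> filters r {p, q} \<and> q \<notin> c"
      using w self_in_filters[of "{p, q}" r] unfolding good_def by force
  next
    assume "{q} \<notin> filters r {p, q} \<and> q \<notin> c"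
    then show "good r 12 (mark 12 c) {p, q} {p}"
      using w sub unfolding good_def by (metis (no_types, lifting) empty_iff insert_iff order_refl subsetD wt_empty)
  qed
qed

text \<open>The density is what remains of the derivative of \<open>avg_good\<close> after the
  contributions of the filters with one element are removed. Averaging lets each tie count one half,
  and this is what makes the density constant.\<close>

lemma avg_prime_pair:
  assumes pq: "p \<noteq> q"
  shows "avg_prime r {p, q} = [:(of_bool ({p} \<notin> filters r {p, q}) + of_bool ({q} \<notin> filters r {p, q})) / 2:]"
proof -
  let ?B = "{p, q}"
  let ?kp = "of_bool ({p} \<notin> filters r ?B) :: real" and ?kq = "of_bool ({q} \<notin> filters r ?B) :: real"
  let ?g = "\<lambda>c. good r 12 (mark 12 c) ?B"
  have g1: "?g c ?B" for c
    unfolding good_def wt_def by (auto simp: filters_def intro!: sum_nonpos)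
  have g0: "\<not> ?g c {}" for c
    using pq self_in_filters[of ?B r] mark_pos(1)[of c p] mark_pos(1)[of c q]
    unfolding good_def wt_def by (force simp del: self_in_filters)
  have Pow: "Pow ?B = {{}, {p}, {q}, ?B}"
    by auto
  have G: "good_poly r 12 (mark 12 c) ?B =
      bm 2 0 + (if {q} \<notin> filters r ?B \<and> q \<notin> c then bm 1 1 else 0) + (if {p} \<notin> filters r ?B \<and> p \<notin> c then bm 1 1 else 0)" for c
  proof -
    have "good_poly r 12 (mark 12 c) ?B = (\<Sum>S\<in>Pow ?B. if ?g c S then bm (card S) (card ?B - card S) else 0)"
      unfolding good_poly_def by (rule sum.mono_neutral_cong_left) (auto simp: Pow_def)
    also have "\<dots> = bm 2 0 + (if {q} \<notin> filters r ?B \<and> q \<notin> c then bm 1 1 else 0) + (if {p} \<notin> filters r ?B \<and> p \<notin> c then bm 1 1 else 0)"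
      unfolding Pow using pq g1[of c] g0[of c] good_pair[OF pq, of r c] good_pair[of q p r c] pq
      by (simp add: insert_commute doubleton_eq_iff numeral_2_eq_2)
    finally show ?thesis .
  qed
  have V: "avg_good r ?B = bm 2 0 + smult ((?kp + ?kq) / 2) (bm 1 1)"
    unfolding avg_good_def G sum.distrib unfolding Pow
    using pq by (cases "{p} \<in> filters r ?B"; cases "{q} \<in> filters r ?B")
      (simp_all add: doubleton_eq_iff smult_add_right numeral_poly power2_eq_square)
  have F: "filters r ?B = {{}, ?B} \<union> (if {p} \<in> filters r ?B then {{p}} else {}) \<union> (if {q} \<in> filters r ?B then {{q}} else {})"
    by (auto simp: filters_def)
  have D: "pderiv (avg_good r ?B) = avg_prime r ?B + smult ((1 - ?kp) + (1 - ?kq)) [:0, 1:]"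
  proof -
    have "pderiv (avg_good r ?B) = (\<Sum>C\<in>filters r ?B. avg_good r (?B - C) * avg_prime r C)"
      by (rule pderiv_avg_good) simp
    also have "\<dots> = avg_prime r ?B + smult ((1 - ?kp) + (1 - ?kq)) [:0, 1:]"
      by (subst F, cases "{p} \<in> filters r ?B"; cases "{q} \<in> filters r ?B")
        (use pq in \<open>simp_all add: avg_prime_single avg_good_single doubleton_eq_iff insert_Diff_if numeral_poly\<close>)
    finally show ?thesis .
  qed
  have "pderiv (avg_good r ?B) = [:(?kp + ?kq) / 2, 2 - (?kp + ?kq):]"
    unfolding V by (simp add: bm_def pderiv_add pderiv_smult power2_eq_square pderiv_mult pderiv_pCons field_simps)
  then show ?thesis
    unfolding D by (simp add: eq_diff_eq[symmetric])
qed

section \<open>Expansion over words\<close>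

type_synonym letter = "nat \<times> (nat \<times> nat) list"

text \<open>
  A letter consists of the size of a block and the exponents of its density. The two ranks possible
  for a block of even size give two letters, except that for size 2 they come with equal weights and
  are merged.
\<close>

definition letters :: "letter list" where
  "letters = [(1, [(0, 0)]), (2, [(1, 0), (0, 1)]), (3, [(1, 1)]), (4, [(1, 2)]), (4, [(2, 1)]),
     (5, [(2, 2)]), (6, [(2, 3)]), (6, [(3, 2)]), (7, [(3, 3)]), (8, [(3, 4)]), (8, [(4, 3)]),
     (9, [(4, 4)]), (10, [(4, 5)]), (10, [(5, 4)]), (11, [(5, 5)])]"

definition density :: "letter \<Rightarrow> real poly" where
  "density l = (\<Sum>(i, j)\<leftarrow>snd l. bm i j)"

lemma letters_pos: "l \<in> set letters \<Longrightarrow> 1 \<le> fst l"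
  by (auto simp: letters_def)

definition block_coeffs :: "('a \<times> 'a) set \<Rightarrow> 'a set \<Rightarrow> (letter \<Rightarrow> real) \<Rightarrow> bool" where
  "block_coeffs r B n \<longleftrightarrow> (\<forall>l. 0 \<le> n l) \<and>
     avg_prime r B = (\<Sum>l | l \<in> set letters \<and> fst l = card B. smult (n l) (density l))"

text \<open>For sizes other than 2 each possible rank has a letter of its own, so the coefficients
  by rank can be reused. For size 2 the constant density is a multiple of that of the merged
  letter.\<close>

lemma block_coeffs_exist:
  assumes B: "finite B" "card B \<le> 11"
  shows "\<exists>n. block_coeffs r B n"
proof -
  obtain N where N: "\<And>k. 0 \<le> N k"
    and eq: "avg_prime r B = (\<Sum>k\<in>block_ranks (card B). smult (N k) (bm k (card B - 1 - k)))"
    using avg_prime_expand[OF B, of r] by blast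
  \<comment> \<open>Except for the merged letter of size 2, the first exponent of a letter is its
    rank.\<close>
  define n where "n l = N (fst (hd (snd l)))" for l :: letter
  have n: "0 \<le> n l" for l
    by (simp add: n_def N)
  have set_filter: "{l. l \<in> set letters \<and> fst l = d} = set (filter (\<lambda>l. fst l = d) letters)" for d
    by auto
  have odd: "block_coeffs r B n" if "card B = 2 * k + 1"
    "filter (\<lambda>l. fst l = 2 * k + 1) letters = [(2 * k + 1, [(k, k)])]" for k
    using n eq unfolding block_coeffs_def that(1) set_filter that(2) block_ranks_odd
    by (simp add: density_def n_def)
  have even: "block_coeffs r B n" if "card B = 2 * k + 2"
    "filter (\<lambda>l. fst l = 2 * k + 2) letters = [(2 * k + 2, [(k, k + 1)]), (2 * k + 2, [(k + 1, k)])]" for k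
    using n eq unfolding block_coeffs_def that(1) set_filter that(2) block_ranks_even
    by (simp add: density_def n_def)
  have "card B = 0 \<or> card B = 1 \<or> card B = 2 \<or> card B = 3 \<or> card B = 4 \<or> card B = 5 \<or> card B = 6 \<or>
      card B = 7 \<or> card B = 8 \<or> card B = 9 \<or> card B = 10 \<or> card B = 11"
    using B(2) by presburger
  then show ?thesis
  proof (elim disjE)
    assume "card B = 0"
    then have "B = {}"
      using B by simp
    moreover have "filter (\<lambda>l. fst l = 0) letters = []"
      by (simp add: letters_def)
    ultimately have "block_coeffs r B (\<lambda>_. 0 :: real)"
      unfolding block_coeffs_def set_filter by simp
    then show ?thesis
      by (rule exI[of "block_coeffs r B"])
  next
    assume "card B = 1"
    then have "block_coeffs r B n"
      using odd[of 0] by (simp add: letters_def)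
    then show ?thesis
      by (rule exI[of "block_coeffs r B"])
  next
    assume c: "card B = 2"
    then obtain p q where pq: "B = {p, q}" "p \<noteq> q"
      by (auto simp: card_2_iff)
    define \<kappa> :: real where "\<kappa> = (of_bool ({p} \<notin> filters r {p, q}) + of_bool ({q} \<notin> filters r {p, q})) / 2"
    have f: "filter (\<lambda>l. fst l = 2) letters = [(2, [(1, 0), (0, 1)])]"
      by (simp add: letters_def)
    have "density (2, [(1, 0), (0, 1)]) = 1"
      by (simp add: density_def bm_def one_pCons)
    then have "avg_prime r B = smult \<kappa> (density (2, [(1, 0), (0, 1)]))"
      using avg_prime_pair[OF pq(2), of r] pq by (simp add: \<kappa>_def one_pCons)
    moreover have "0 \<le> \<kappa>"
      by (simp add: \<kappa>_def)
    ultimately have "block_coeffs r B (\<lambda>_. \<kappa>)"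
      unfolding block_coeffs_def c set_filter f by simp
    then show ?thesis
      by (rule exI[of "block_coeffs r B"])
  next
    assume "card B = 3"
    then have "block_coeffs r B n"
      using odd[of 1] by (simp add: letters_def)
    then show ?thesis
      by (rule exI[of "block_coeffs r B"])
  next
    assume "card B = 4"
    then have "block_coeffs r B n"
      using even[of 1] by (simp add: letters_def)
    then show ?thesis
      by (rule exI[of "block_coeffs r B"])
  next
    assume "card B = 5"
    then have "block_coeffs r B n"
      using odd[of 2] by (simp add: letters_def)
    then show ?thesis
      by (rule exI[of "block_coeffs r B"])
  next
    assume "card B = 6"
    then have "block_coeffs r B n"
      using even[of 2] by (simp add: letters_def)
    then show ?thesis
      by (rule exI[of "block_coeffs r B"])
  next
    assume "card B = 7"
    then have "block_coeffs r B n"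
      using odd[of 3] by (simp add: letters_def)
    then show ?thesis
      by (rule exI[of "block_coeffs r B"])
  next
    assume "card B = 8"
    then have "block_coeffs r B n"
      using even[of 3] by (simp add: letters_def)
    then show ?thesis
      by (rule exI[of "block_coeffs r B"])
  next
    assume "card B = 9"
    then have "block_coeffs r B n"
      using odd[of 4] by (simp add: letters_def)
    then show ?thesis
      by (rule exI[of "block_coeffs r B"])
  next
    assume "card B = 10"
    then have "block_coeffs r B n"
      using even[of 4] by (simp add: letters_def)
    then show ?thesis
      by (rule exI[of "block_coeffs r B"])
  next
    assume "card B = 11"
    then have "block_coeffs r B n"
      using odd[of 5] by (simp add: letters_def)
    then show ?thesis
      by (rule exI[of "block_coeffs r B"])
  qed
qed

definition block_coeff :: "('a \<times> 'a) set \<Rightarrow> letter \<Rightarrow> 'a set \<Rightarrow> real" where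
  "block_coeff r l B = (SOME n. block_coeffs r B n) l"

lemma
  assumes "finite B" "card B \<le> 11"
  shows block_coeff_nonneg: "0 \<le> block_coeff r l B"
    and avg_prime_letters: "avg_prime r B = (\<Sum>l | l \<in> set letters \<and> fst l = card B. smult (block_coeff r l B) (density l))"
  using someI_ex[OF block_coeffs_exist[OF assms, of r]] unfolding block_coeff_def block_coeffs_def by blast+

text \<open>Words are written backwards: the head is the topmost block.\<close>

fun chain_sum :: "('a \<times> 'a) set \<Rightarrow> letter list \<Rightarrow> 'a set \<Rightarrow> real" where
  "chain_sum r [] Q = of_bool (Q = {})"
| "chain_sum r (l # w) Q = (\<Sum>B | B \<in> filters r Q \<and> card B = fst l. chain_sum r w (Q - B) * block_coeff r l B)"

definition words :: "nat \<Rightarrow> letter list set" where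
  "words n = {w. set w \<subseteq> set letters \<and> sum_list (map fst w) = n}"

lemma words_0: "words 0 = {[]}"
proof (intro set_eqI iffI)
  fix w assume "w \<in> words 0"
  then show "w \<in> {[]}"
    using letters_pos by (cases w) (force simp: words_def)+
qed (simp add: words_def)

lemma words_pos: "0 < n \<Longrightarrow> words n = (\<Union>l\<in>{l \<in> set letters. fst l \<le> n}. (#) l ` words (n - fst l))"
proof (intro set_eqI iffI)
  fix w assume n: "0 < n" and w: "w \<in> words n"
  then obtain l w' where "w = l # w'"
    by (cases w) (auto simp: words_def)
  with w show "w \<in> (\<Union>l\<in>{l \<in> set letters. fst l \<le> n}. (#) l ` words (n - fst l))"
    by (auto simp: words_def image_iff)
qed (auto simp: words_def)

lemma length_words: "w \<in> words n \<Longrightarrow> length w \<le> n"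
proof (induction w arbitrary: n)
  case (Cons l w)
  then have "w \<in> words (n - fst l)" "1 \<le> fst l" "fst l \<le> n"
    using letters_pos by (auto simp: words_def)
  then show ?case
    using Cons.IH[of "n - fst l"] by simp
qed simp

lemma finite_words [simp]: "finite (words n)"
proof (rule finite_subset)
  show "words n \<subseteq> {w. set w \<subseteq> set letters \<and> length w \<le> n}"
    using length_words by (auto simp: words_def)
qed (rule finite_lists_length_le, simp)

lemma sum_words:
  assumes "0 < n"
  shows "(\<Sum>w\<in>words n. f w) = (\<Sum>l | l \<in> set letters \<and> fst l \<le> n. \<Sum>w\<in>words (n - fst l). f (l # w))"
proof -
  have "(\<Sum>w\<in>words n. f w) = (\<Sum>l\<in>{l \<in> set letters. fst l \<le> n}. sum f ((#) l ` words (n - fst l)))"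
    unfolding words_pos[OF assms] by (rule sum.UNION_disjoint) auto
  also have "\<dots> = (\<Sum>l | l \<in> set letters \<and> fst l \<le> n. \<Sum>w\<in>words (n - fst l). f (l # w))"
    by (rule sum.cong[OF refl]) (simp add: sum.reindex)
  finally show ?thesis .
qed

text \<open>The head letter of a word is matched with the topmost block \<open>B\<close>, and the
  sum over \<open>B\<close> is moved to the outside.\<close>

lemma sum_words_chain:
  assumes Q: "finite Q" "Q \<noteq> {}"
  shows "(\<Sum>w\<in>words (card Q). smult (chain_sum r w Q) (f w)) =
     (\<Sum>B\<in>filters r Q. \<Sum>l | l \<in> set letters \<and> fst l = card B. \<Sum>w\<in>words (card (Q - B)).
        smult (chain_sum r w (Q - B) * block_coeff r l B) (f (l # w)))"
proof -
  let ?t = "\<lambda>B l w. smult (chain_sum r w (Q - B) * block_coeff r l B) (f (l # w))"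
  have n: "0 < card Q"
    using Q by (simp add: card_gt_0_iff)
  have le: "card B \<le> card Q" and diff: "card Q - card B = card (Q - B)" if "B \<in> filters r Q" for B
    using filters_subset[OF that] Q by (simp_all add: card_mono card_Diff_subset finite_subset)
  have "(\<Sum>w\<in>words (card Q). smult (chain_sum r w Q) (f w)) =
      (\<Sum>l | l \<in> set letters \<and> fst l \<le> card Q. \<Sum>w\<in>words (card Q - fst l). \<Sum>B | B \<in> filters r Q \<and> card B = fst l. ?t B l w)"
    by (simp add: sum_words[OF n] smult_sum)
  also have "\<dots> = (\<Sum>l | l \<in> set letters \<and> fst l \<le> card Q. \<Sum>B | B \<in> filters r Q \<and> fst l = card B. \<Sum>w\<in>words (card (Q - B)). ?t B l w)"
  proof (rule sum.cong[OF refl])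
    fix l
    show "(\<Sum>w\<in>words (card Q - fst l). \<Sum>B | B \<in> filters r Q \<and> card B = fst l. ?t B l w) =
        (\<Sum>B | B \<in> filters r Q \<and> fst l = card B. \<Sum>w\<in>words (card (Q - B)). ?t B l w)"
      by (subst sum.swap, rule sum.cong) (auto simp: diff)
  qed
  also have "\<dots> = (\<Sum>B\<in>filters r Q. \<Sum>l | l \<in> {l \<in> set letters. fst l \<le> card Q} \<and> fst l = card B. \<Sum>w\<in>words (card (Q - B)). ?t B l w)"
    by (subst sum.swap_restrict) (use Q in auto)
  also have "\<dots> = (\<Sum>B\<in>filters r Q. \<Sum>l | l \<in> set letters \<and> fst l = card B. \<Sum>w\<in>words (card (Q - B)). ?t B l w)"
    by (intro sum.cong refl) (use le in auto)
  finally show ?thesis .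
qed

section \<open>Antiderivatives and the polynomials of words on unit cells\<close>

definition pint :: "real poly \<Rightarrow> real poly" where
  "pint p = (SOME q. pderiv q = p \<and> poly q 0 = 0)"

lemma antideriv_exists: "\<exists>q. pderiv q = p \<and> poly q 0 = (0::real)"
proof -
  let ?q = "\<Sum>i\<le>degree p. monom (coeff p i / real (Suc i)) (Suc i)"
  have "pderiv ?q = (\<Sum>i\<le>degree p. monom (coeff p i) i)"
    by (simp add: pderiv_sum' pderiv_monom)
  then have "pderiv ?q = p"
    by (simp add: poly_as_sum_of_monoms)
  moreover have "poly ?q 0 = 0"
    by (simp add: poly_sum poly_monom)
  ultimately show ?thesis by blast
qed

lemma pderiv_pint [simp]: "pderiv (pint p) = p" and poly_pint_0 [simp]: "poly (pint p) 0 = 0"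
  using someI_ex[OF antideriv_exists[of p]] by (simp_all add: pint_def)

lemma poly_eq_by_pderiv:
  fixes p q :: "real poly"
  assumes "pderiv p = pderiv q" "poly p 0 = poly q 0"
  shows "p = q"
proof -
  have "pderiv (p - q) = 0"
    by (simp add: pderiv_diff assms)
  then obtain c where "p - q = [:c:]"
    using pderiv_iszero by blast
  moreover have "poly (p - q) 0 = 0"
    by (simp add: assms)
  ultimately show ?thesis by simp
qed

lemma pint_0 [simp]: "pint 0 = 0"
  by (rule poly_eq_by_pderiv) simp_all

text \<open>
  On the cell \<open>[j, j + 1]\<close>, at height \<open>x\<close> above its floor, the polynomial attached to a word is
  \<open>\<Sum>k. (j choose k) * poly (cell w k) x\<close>.
\<close>

fun cell :: "letter list \<Rightarrow> nat \<Rightarrow> real poly" where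
  "cell [] k = of_bool (k = 0)"
| "cell (l # w) k = pint (cell w k * density l) +
     [:case k of 0 \<Rightarrow> 0 | Suc j \<Rightarrow> poly (pint (cell w j * density l)) 1:]"

definition node :: "letter list \<Rightarrow> nat \<Rightarrow> real" where
  "node w k = poly (cell w k) 0"

lemma cell_beyond: "length w < k \<Longrightarrow> cell w k = 0"
  by (induction w arbitrary: k) (auto split: nat.split)

lemma node_Cons_0 [simp]: "node (l # w) 0 = 0"
  by (simp add: node_def)

text \<open>The constant term of \<open>cell (l # w) (Suc k)\<close> is the increment of
  \<open>cell (l # w) k\<close> over the unit interval. By Pascal's rule the polynomial on the cell
  of \<open>j\<close> therefore ends at the value where the one on the cell of \<open>j + 1\<close>
  starts.\<close>

lemma poly_cell_1: "poly (cell (l # w) k) 1 = node (l # w) k + node (l # w) (Suc k)"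
  by (simp add: node_def)

lemma pderiv_cell: "pderiv (cell (l # w) k) = cell w k * density l"
  by (simp add: pderiv_add pderiv_pCons)

lemma sum_choose_Suc:
  fixes f :: "nat \<Rightarrow> real"
  assumes "f 0 = 0" "\<And>k. n < k \<Longrightarrow> f k = 0"
  shows "(\<Sum>k\<le>n. real (Suc j choose k) * f k) = (\<Sum>k\<le>n. real (j choose k) * (f k + f (Suc k)))"
proof -
  have "(\<Sum>k\<le>Suc n. real (Suc j choose k) * f k) = (\<Sum>k\<le>n. real (Suc j choose Suc k) * f (Suc k))"
    by (subst sum.atMost_Suc_shift) (simp add: assms)
  also have "\<dots> = (\<Sum>k\<le>n. real (j choose k) * f (Suc k)) + (\<Sum>k\<le>n. real (j choose Suc k) * f (Suc k))"
    by (simp add: sum.distrib distrib_right add.commute)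
  also have "(\<Sum>k\<le>n. real (j choose Suc k) * f (Suc k)) = (\<Sum>k\<le>Suc n. real (j choose k) * f k)"
    by (subst sum.atMost_Suc_shift) (simp add: assms)
  finally show ?thesis
    by (simp add: assms sum.distrib distrib_left)
qed

text \<open>The bound 11 cuts off nothing for words of length at most 11, because
  \<open>cell w k\<close> vanishes for \<open>k > length w\<close>.\<close>

definition cell_poly :: "nat \<Rightarrow> letter list \<Rightarrow> real poly" where
  "cell_poly j w = (\<Sum>k\<le>11. smult (real (j choose k)) (cell w k))"

lemma cell_poly_Nil: "cell_poly j [] = 1"
proof -
  have "cell_poly j [] = (\<Sum>k\<le>11. if k = 0 then smult (real (j choose k)) 1 else 0)"
    unfolding cell_poly_def by (rule sum.cong) auto
  then show ?thesis by (simp add: sum.delta)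
qed

lemma pderiv_cell_poly: "pderiv (cell_poly j (l # w)) = cell_poly j w * density l"
  unfolding cell_poly_def pderiv_sum' pderiv_smult pderiv_cell by (simp add: sum_distrib_right)

lemma poly_cell_poly_0: "poly (cell_poly j w) 0 = (\<Sum>k\<le>11. real (j choose k) * node w k)"
  by (simp add: cell_poly_def poly_sum node_def)

lemma poly_cell_poly_1:
  assumes "length (l # w) \<le> 11"
  shows "poly (cell_poly j (l # w)) 1 = poly (cell_poly (Suc j) (l # w)) 0"
proof -
  have "node (l # w) k = 0" if "11 < k" for k
    using cell_beyond[of "l # w" k] that assms by (simp add: node_def del: cell.simps)
  then show ?thesis
    unfolding poly_cell_poly_0
    by (subst sum_choose_Suc) (simp_all add: cell_poly_def poly_sum poly_cell_1 del: cell.simps)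
qed

text \<open>On both sides the derivative is the sum over \<open>C\<close> of the same quantity for
  \<open>Q - C\<close>, multiplied by \<open>avg_prime r C\<close>. The term of the empty
  \<open>C\<close> is zero, so induction on the cardinality identifies the derivatives. The values
  at 0 agree for \<open>j = 0\<close>, and on both sides the value at 1 is the value at 0 for
  \<open>j + 1\<close>.\<close>

theorem mono_count_cell:
  assumes "finite Q" "card Q \<le> 11"
  shows "(\<Sum>B\<in>filters r Q. smult (real (mono_count r (Q - B) j)) (avg_good r B)) =
     (\<Sum>w\<in>words (card Q). smult (chain_sum r w Q) (cell_poly j w))"
  using assms
proof (induction "card Q" arbitrary: Q j rule: less_induct)
  case less
  define F where "F Q j = (\<Sum>B\<in>filters r Q. smult (real (mono_count r (Q - B) j)) (avg_good r B))" for Q j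
  define H where "H Q j = (\<Sum>w\<in>words (card Q). smult (chain_sum r w Q) (cell_poly j w))" for Q j
  show ?case
  proof (cases "Q = {}")
    case True
    then show ?thesis
      by (simp add: words_0 cell_poly_Nil)
  next
    case False
    note Q = \<open>finite Q\<close> False
    have IH: "F (Q - B) j = H (Q - B) j" if "B \<in> filters r Q" "B \<noteq> {}" for B j
    proof -
      have "Q - B \<subset> Q"
        using that filters_subset[of B r Q] by auto
      then have "card (Q - B) < card Q"
        by (rule psubset_card_mono[OF Q(1)])
      then show ?thesis
        unfolding F_def H_def using less.prems by (intro less.hyps) auto
    qed
    have Un_diff: "Q - (C \<union> D) = Q - C - D" for C D
      by blast
    have dF: "pderiv (F Q j) = (\<Sum>C\<in>filters r Q. F (Q - C) j * avg_prime r C)" for j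
    proof -
      \<comment> \<open>Here \<open>B\<close> is written as the union of \<open>C\<close> and
        \<open>B - C\<close>, which is the form that \<open>sum_filters_swap\<close>
        requires.\<close>
      have "pderiv (F Q j) = (\<Sum>B\<in>filters r Q. \<Sum>C\<in>filters r B.
          smult (real (mono_count r (Q - (C \<union> (B - C))) j)) (avg_good r (B - C)) * avg_prime r C)"
        unfolding F_def pderiv_sum' pderiv_smult
      proof (rule sum.cong[OF refl])
        fix B assume "B \<in> filters r Q"
        then have "finite B"
          using filters_subset[of B r Q] finite_subset[of B Q] Q by auto
        have "smult (real (mono_count r (Q - (C \<union> (B - C))) j)) (avg_good r (B - C)) * avg_prime r C =
            smult (real (mono_count r (Q - B) j)) (avg_good r (B - C) * avg_prime r C)" if "C \<in> filters r B" for C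
        proof -
          have "C \<union> (B - C) = B"
            using filters_subset[OF that] by auto
          then show ?thesis by simp
        qed
        then show "smult (real (mono_count r (Q - B) j)) (pderiv (avg_good r B)) =
            (\<Sum>C\<in>filters r B. smult (real (mono_count r (Q - (C \<union> (B - C))) j)) (avg_good r (B - C)) * avg_prime r C)"
          by (simp add: pderiv_avg_good[OF \<open>finite B\<close>] smult_sum_right del: Un_Diff_cancel)
      qed
      also have "\<dots> = (\<Sum>C\<in>filters r Q. \<Sum>D\<in>filters r (Q - C).
          smult (real (mono_count r (Q - (C \<union> D)) j)) (avg_good r D) * avg_prime r C)"
        by (rule sum_filters_swap[OF Q(1), where f = "\<lambda>D C. smult (real (mono_count r (Q - (C \<union> D)) j)) (avg_good r D) * avg_prime r C"])
      also have "\<dots> = (\<Sum>C\<in>filters r Q. F (Q - C) j * avg_prime r C)"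
        unfolding F_def sum_distrib_right Un_diff ..
      finally show ?thesis .
    qed
    have dH: "pderiv (H Q j) = (\<Sum>B\<in>filters r Q. H (Q - B) j * avg_prime r B)" for j
    proof -
      have "pderiv (H Q j) = (\<Sum>w\<in>words (card Q). smult (chain_sum r w Q) (pderiv (cell_poly j w)))"
        unfolding H_def pderiv_sum' pderiv_smult ..
      also have "\<dots> = (\<Sum>B\<in>filters r Q. \<Sum>l | l \<in> set letters \<and> fst l = card B. \<Sum>w\<in>words (card (Q - B)).
          smult (chain_sum r w (Q - B)) (cell_poly j w) * smult (block_coeff r l B) (density l))"
        by (simp add: sum_words_chain[OF Q] pderiv_cell_poly mult.commute)
      also have "\<dots> = (\<Sum>B\<in>filters r Q. H (Q - B) j * avg_prime r B)"
      proof (rule sum.cong[OF refl])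
        fix B assume "B \<in> filters r Q"
        then have "finite B" "card B \<le> 11"
          using filters_subset[of B r Q] finite_subset[of B Q] card_mono[of Q B] Q less.prems by auto
        then show "(\<Sum>l | l \<in> set letters \<and> fst l = card B. \<Sum>w\<in>words (card (Q - B)).
            smult (chain_sum r w (Q - B)) (cell_poly j w) * smult (block_coeff r l B) (density l)) = H (Q - B) j * avg_prime r B"
          unfolding H_def avg_prime_letters[OF \<open>finite B\<close> \<open>card B \<le> 11\<close>] sum_product by (intro sum.swap)
      qed
      finally show ?thesis .
    qed
    have dFH: "pderiv (F Q j) = pderiv (H Q j)" for j
      unfolding dF dH
    proof (rule sum.cong[OF refl])
      fix B assume "B \<in> filters r Q"
      then show "F (Q - B) j * avg_prime r B = H (Q - B) j * avg_prime r B"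
        by (cases "B = {}") (simp_all add: IH)
    qed
    have fin: "finite B" if "B \<in> filters r Q" for B
      using finite_subset[OF filters_subset[OF that] Q(1)] .
    have F0: "poly (F Q j) 0 = real (mono_count r Q j)" for j
    proof -
      have "poly (F Q j) 0 = (\<Sum>B\<in>filters r Q. if B = {} then real (mono_count r Q j) else 0)"
        unfolding F_def poly_sum by (rule sum.cong) (auto simp: poly_avg_good_0 fin)
      then show ?thesis
        using Q by (simp add: sum.delta)
    qed
    have F1: "poly (F Q j) 1 = real (mono_count r Q (Suc j))" for j
      unfolding F_def poly_sum mono_count_Suc[OF Q(1)] by (simp add: poly_avg_good_1 fin)
    have Cons: "\<exists>l w'. w = l # w'" if "w \<in> words (card Q)" for w
      using that Q by (cases w) (auto simp: words_def card_eq_0_iff)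
    have "F Q j = H Q j" for j
    proof (induction j)
      case 0
      have "poly (cell_poly 0 w) 0 = 0" if "w \<in> words (card Q)" for w
      proof -
        have "poly (cell_poly 0 w) 0 = (\<Sum>k\<le>11. if k = 0 then node w k else 0)"
          unfolding poly_cell_poly_0 by (rule sum.cong) auto
        then show ?thesis
          using Cons[OF that] by (auto simp: sum.delta)
      qed
      then have "poly (H Q 0) 0 = 0"
        unfolding H_def poly_sum by simp
      then show ?case
        using F0[of 0] Q by (intro poly_eq_by_pderiv[OF dFH]) (simp add: mono_count_0)
    next
      case (Suc j)
      have "poly (H Q (Suc j)) 0 = poly (H Q j) 1"
        unfolding H_def poly_sum poly_smult
      proof (rule sum.cong[OF refl])
        fix w assume w: "w \<in> words (card Q)"
        then obtain l w' where "w = l # w'"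
          using Cons by blast
        moreover have "length w \<le> 11"
          using length_words[OF w] less.prems by simp
        ultimately show "chain_sum r w Q * poly (cell_poly (Suc j) w) 0 = chain_sum r w Q * poly (cell_poly j w) 1"
          using poly_cell_poly_1 by metis
      qed
      then show ?case
        using F0[of "Suc j"] F1[of j] Suc.IH by (intro poly_eq_by_pderiv[OF dFH]) simp
    qed
    then show ?thesis
      by (simp add: F_def H_def)
  qed
qed

text \<open>At \<open>x = 0\<close> only the empty filter contributes to the left side of
  \<open>mono_count_cell\<close>.\<close>

corollary mono_count_words:
  assumes "finite Q" "card Q \<le> 11"
  shows "real (mono_count r Q j) = (\<Sum>w\<in>words (card Q). chain_sum r w Q * (\<Sum>k\<le>11. real (j choose k) * node w k))"
proof -
  have "poly (\<Sum>B\<in>filters r Q. smult (real (mono_count r (Q - B) j)) (avg_good r B)) 0 =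
      (\<Sum>B\<in>filters r Q. if B = {} then real (mono_count r Q j) else 0)"
    unfolding poly_sum
  proof (rule sum.cong[OF refl])
    fix B assume "B \<in> filters r Q"
    then have "finite B"
      using filters_subset[of B r Q] assms finite_subset by auto
    then show "poly (smult (real (mono_count r (Q - B) j)) (avg_good r B)) 0 =
        (if B = {} then real (mono_count r Q j) else 0)"
      by (simp add: poly_avg_good_0)
  qed
  also have "\<dots> = real (mono_count r Q j)"
    using assms by (simp add: sum.delta)
  finally show ?thesis
    unfolding mono_count_cell[OF assms] by (simp add: poly_sum poly_cell_poly_0)
qed

section \<open>Integer computation of the word polynomials\<close>

text \<open>
  Polynomials of degree \<open>n\<close> are given by their Bernstein coefficients multiplied by \<open>n!\<close>: in this scaling
  integration is a prefix sum and multiplication by \<open>bm a b\<close> needs no division.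
\<close>

definition bern :: "int list \<Rightarrow> real poly" where
  "bern xs = (\<Sum>s<length xs. smult (real_of_int (xs ! s) / (fact s * fact (length xs - 1 - s))) (bm s (length xs - 1 - s)))"

fun accum :: "int \<Rightarrow> int list \<Rightarrow> int list" where
  "accum c [] = [c]"
| "accum c (x # xs) = c # accum (c + x) xs"

fun vmul :: "int list \<Rightarrow> int list \<Rightarrow> int list" where
  "vmul (x # xs) (y # ys) = x * y # vmul xs ys"
| "vmul _ _ = []"

fun vadd :: "int list \<Rightarrow> int list \<Rightarrow> int list" where
  "vadd (x # xs) (y # ys) = (x + y) # vadd xs ys"
| "vadd _ _ = []"

fun vsum :: "int list \<Rightarrow> int" where
  "vsum [] = 0"
| "vsum (x # xs) = x + vsum xs"

fun zeros :: "nat \<Rightarrow> int list \<Rightarrow> int list" where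
  "zeros 0 xs = xs"
| "zeros (Suc n) xs = 0 # zeros n xs"

text \<open>For natural \<open>s\<close> this is \<open>(s + a)! / s!\<close>, the correction needed
  when the index of a factorial moves by \<open>a\<close>.\<close>

fun rise :: "int \<Rightarrow> nat \<Rightarrow> int" where
  "rise s 0 = 1"
| "rise s (Suc a) = (s + 1) * rise (s + 1) a"

fun weights :: "nat \<Rightarrow> nat \<Rightarrow> int \<Rightarrow> int \<Rightarrow> nat \<Rightarrow> int list" where
  "weights a b s u 0 = [rise s a * rise u b]"
| "weights a b s u (Suc n) = rise s a * rise u b # weights a b (s + 1) (u - 1) n"

lemma length_accum [simp]: "length (accum c xs) = Suc (length xs)"
  by (induction c xs rule: accum.induct) auto

lemma accum_0 [simp]: "accum c xs ! 0 = c"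
  by (cases xs) auto

lemma accum_Suc: "s < length xs \<Longrightarrow> accum c xs ! Suc s = accum c xs ! s + xs ! s"
proof (induction c xs arbitrary: s rule: accum.induct)
  case (2 c x xs)
  then show ?case by (cases s) auto
qed simp

lemma accum_last: "accum c xs ! length xs = c + vsum xs"
  by (induction c xs rule: accum.induct) auto

lemma length_vmul [simp]: "length (vmul xs ys) = min (length xs) (length ys)"
  by (induction xs ys rule: vmul.induct) auto

lemma nth_vmul: "s < length xs \<Longrightarrow> s < length ys \<Longrightarrow> vmul xs ys ! s = xs ! s * ys ! s"
proof (induction xs ys arbitrary: s rule: vmul.induct)
  case (1 x xs y ys)
  then show ?case by (cases s) auto
qed auto

lemma length_vadd [simp]: "length (vadd xs ys) = min (length xs) (length ys)"
  by (induction xs ys rule: vadd.induct) auto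

lemma nth_vadd: "s < length xs \<Longrightarrow> s < length ys \<Longrightarrow> vadd xs ys ! s = xs ! s + ys ! s"
proof (induction xs ys arbitrary: s rule: vadd.induct)
  case (1 x xs y ys)
  then show ?case by (cases s) auto
qed auto

lemma zeros_eq: "zeros n xs = replicate n 0 @ xs"
  by (induction n) auto

lemma length_weights [simp]: "length (weights a b s u n) = Suc n"
  by (induction n arbitrary: s u) auto

lemma nth_weights: "i \<le> n \<Longrightarrow> weights a b s u n ! i = rise (s + int i) a * rise (u - int i) b"
proof (induction n arbitrary: s u i)
  case (Suc n)
  then show ?case by (cases i) (auto simp: algebra_simps)
qed simp

lemma rise_fact: "fact n * real_of_int (rise (int n) a) = fact (n + a)"
proof (induction a arbitrary: n)
  case (Suc a)
  have "rise (int n) (Suc a) = int (Suc n) * rise (int (Suc n)) a"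
    by (simp add: add.commute)
  then have "fact n * real_of_int (rise (int n) (Suc a)) = fact (Suc n) * real_of_int (rise (int (Suc n)) a)"
    by (simp del: rise.simps)
  then show ?case
    using Suc.IH[of "Suc n"] by (simp add: mult.assoc mult.left_commute del: rise.simps)
qed simp

lemma rise_nonzero: "rise (int n) a \<noteq> 0"
  using rise_fact[of n a] fact_nonzero[of "n + a", where 'a = real] by (metis mult_zero_right of_int_0)

lemma poly_bern_0: "xs \<noteq> [] \<Longrightarrow> poly (bern xs) 0 = real_of_int (xs ! 0) / fact (length xs - 1)"
proof -
  assume "xs \<noteq> []"
  have "poly (bern xs) 0 = (\<Sum>s<length xs. if s = 0 then real_of_int (xs ! 0) / fact (length xs - 1) else 0)"
    unfolding bern_def poly_sum poly_smult poly_bm by (rule sum.cong) auto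
  then show ?thesis
    using \<open>xs \<noteq> []\<close> by (simp add: sum.delta)
qed

lemma poly_bern_1: "xs \<noteq> [] \<Longrightarrow> poly (bern xs) 1 = real_of_int (xs ! (length xs - 1)) / fact (length xs - 1)"
proof -
  assume "xs \<noteq> []"
  have "poly (bern xs) 1 = (\<Sum>s<length xs. if s = length xs - 1 then real_of_int (xs ! s) / fact (length xs - 1) else 0)"
    unfolding bern_def poly_sum poly_smult poly_bm by (rule sum.cong) auto
  then show ?thesis
    using \<open>xs \<noteq> []\<close> by (simp add: sum.delta)
qed

text \<open>Differentiation takes differences of the usual Bernstein coefficients and multiplies by
  the degree. The factorial in the scaling absorbs that multiplier, so prefix sums with start value
  \<open>c\<close> invert it exactly.\<close>

lemma pderiv_bern_accum: "pderiv (bern (accum c xs)) = bern xs"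
proof -
  let ?b = "\<lambda>s. real_of_int (accum c xs ! s)" and ?n = "length xs"
  let ?g = "\<lambda>s. smult (?b s / (fact s * fact (?n - s)) * real s) (bm (s - 1) (?n - s))"
  let ?h = "\<lambda>s. smult (?b s / (fact s * fact (?n - s)) * real (?n - s)) (bm s (?n - s - 1))"
  have "pderiv (bern (accum c xs)) = (\<Sum>s<Suc ?n. ?g s) - (\<Sum>s<Suc ?n. ?h s)"
    unfolding bern_def pderiv_sum' pderiv_smult pderiv_bm
    by (simp add: smult_diff_right sum_subtractf)
  also have "(\<Sum>s<Suc ?n. ?g s) = (\<Sum>s<?n. smult (?b (Suc s) / (fact s * fact (?n - 1 - s))) (bm s (?n - 1 - s)))"
  proof -
    have "x / (fact (Suc s) * y) * real (Suc s) = x / (fact s * y)" for x y :: real and s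
      by (simp add: field_simps del: of_nat_Suc)
    then have "?g (Suc s) = smult (?b (Suc s) / (fact s * fact (?n - 1 - s))) (bm s (?n - 1 - s))" for s
      by (simp del: of_nat_Suc fact_Suc)
    then show ?thesis
      by (subst sum.lessThan_Suc_shift) simp
  qed
  also have "(\<Sum>s<Suc ?n. ?h s) = (\<Sum>s<?n. smult (?b s / (fact s * fact (?n - 1 - s))) (bm s (?n - 1 - s)))"
  proof -
    have "?h s = smult (?b s / (fact s * fact (?n - 1 - s))) (bm s (?n - 1 - s))" if "s < ?n" for s
    proof -
      define k where "k = ?n - 1 - s"
      then have k: "?n - s = Suc k" "?n - 1 - s = k"
        using that by auto
      have "?n - s - 1 = k"
        using k by simp
      moreover have "x / (y * fact (Suc k)) * real (Suc k) = x / (y * fact k)" for x y :: real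
        by (simp add: field_simps del: of_nat_Suc)
      ultimately show ?thesis
        unfolding k by (simp del: of_nat_Suc fact_Suc)
    qed
    then show ?thesis by simp
  qed
  also have "(\<Sum>s<?n. smult (?b (Suc s) / (fact s * fact (?n - 1 - s))) (bm s (?n - 1 - s))) -
      (\<Sum>s<?n. smult (?b s / (fact s * fact (?n - 1 - s))) (bm s (?n - 1 - s))) = bern xs"
    unfolding bern_def sum_subtractf[symmetric]
    by (rule sum.cong) (simp_all add: accum_Suc smult_diff_left[symmetric] diff_divide_distrib[symmetric])
  finally show ?thesis .
qed

lemma bern_vadd: "length xs = length ys \<Longrightarrow> bern (vadd xs ys) = bern xs + bern ys"
  unfolding bern_def by (simp add: sum.distrib[symmetric] nth_vadd smult_add_left[symmetric] add_divide_distrib)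

lemma bern_zeros: "bern (zeros n []) = 0"
  by (simp add: bern_def zeros_eq)

text \<open>The factor \<open>bm a b\<close> moves the term of index \<open>s\<close> to index
  \<open>s + a\<close> in degree \<open>n + a + b\<close>. The weights compensate for the change of
  the factorials \<open>s!\<close> and \<open>(n - s)!\<close> into \<open>(s + a)!\<close> and
  \<open>(n - s + b)!\<close>, and the remaining entries are zero.\<close>

lemma bern_shift:
  assumes n: "length xs = Suc n"
  shows "bern (zeros a (vmul (weights a b 0 (int n) n) xs @ zeros b [])) = bern xs * bm a b"
proof -
  let ?ys = "vmul (weights a b 0 (int n) n) xs"
  let ?zs = "zeros a (?ys @ zeros b [])"
  define N where "N = a + n + b"
  have len: "length ?zs = Suc N"
    using n by (simp add: zeros_eq N_def)
  have nth: "?zs ! i = (if a \<le> i \<and> i < a + Suc n then ?ys ! (i - a) else 0)" if "i < Suc N" for i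
    using that n by (auto simp: zeros_eq nth_append N_def)
  let ?t = "\<lambda>y i. smult (real_of_int y / (fact i * fact (N - i))) (bm i (N - i))"
  have "bern ?zs = (\<Sum>i<Suc N. ?t (?zs ! i) i)"
    unfolding bern_def len by simp
  also have "\<dots> = (\<Sum>i\<in>{a..<a + Suc n}. ?t (?ys ! (i - a)) i)"
  proof (rule sum.mono_neutral_cong_right)
    show "{a..<a + Suc n} \<subseteq> {..<Suc N}"
      by (auto simp: N_def)
    then show "?t (?zs ! i) i = ?t (?ys ! (i - a)) i" if "i \<in> {a..<a + Suc n}" for i
      using that by (subst nth) auto
    show "\<forall>i\<in>{..<Suc N} - {a..<a + Suc n}. ?t (?zs ! i) i = 0"
      by (auto simp: nth)
  qed simp
  also have "\<dots> = (\<Sum>s<Suc n. ?t (?ys ! s) (s + a))"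
    by (rule sum.reindex_bij_witness[where i = "\<lambda>s. s + a" and j = "\<lambda>i. i - a"]) auto
  also have "\<dots> = (\<Sum>s<Suc n. smult (real_of_int (xs ! s) / (fact s * fact (n - s))) (bm s (n - s)) * bm a b)"
  proof (rule sum.cong[OF refl])
    fix s assume "s \<in> {..<Suc n}"
    then have s: "s \<le> n" by simp
    have y: "real_of_int (?ys ! s) = real_of_int (rise (int s) a) * real_of_int (rise (int (n - s)) b) * real_of_int (xs ! s)"
      using s n by (simp add: nth_vmul nth_weights of_nat_diff)
    have "real_of_int (?ys ! s) / (fact (s + a) * fact (n - s + b)) = real_of_int (xs ! s) / (fact s * fact (n - s))"
      unfolding y rise_fact[symmetric]
      using rise_nonzero[of s a] rise_nonzero[of "n - s" b] by simp
    moreover have "N - (s + a) = n - s + b"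
      using s by (simp add: N_def)
    ultimately show "?t (?ys ! s) (s + a) =
        smult (real_of_int (xs ! s) / (fact s * fact (n - s))) (bm s (n - s)) * bm a b"
      by (simp add: bm_mult)
  qed
  also have "\<dots> = bern xs * bm a b"
    unfolding bern_def n by (simp add: sum_distrib_right del: sum.lessThan_Suc)
  finally show ?thesis .
qed

section \<open>Prepending a letter in terms of Bernstein coefficients\<close>

fun increments :: "(nat \<times> nat \<times> int list) list \<Rightarrow> int list \<Rightarrow> int list" where
  "increments [] xs = []"
| "increments [(a, b, ws)] xs = zeros a (vmul ws xs @ zeros b [])"
| "increments ((a, b, ws) # q # qs) xs = vadd (zeros a (vmul ws xs @ zeros b [])) (increments (q # qs) xs)"

text \<open>The weights depend on the degree but not on the polynomial, so one list serves all cells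
  of a word.\<close>

fun with_weights :: "(nat \<times> nat) list \<Rightarrow> nat \<Rightarrow> (nat \<times> nat \<times> int list) list" where
  "with_weights [] m = []"
| "with_weights ((a, b) # qs) m = (a, b, weights a b 0 (int m) m) # with_weights qs m"

text \<open>The lists of \<open>cell w k\<close>, \<open>cell w (k + 1)\<close>, ... become those of
  the word with one more letter. The constant passed on is \<open>vsum i\<close>, the value at 1 of
  the integral just formed, and a constant polynomial is appended at the end.
  \<open>step_aux\<close> takes the increments as an argument because they are used twice.\<close>

fun step :: "(nat \<times> nat \<times> int list) list \<Rightarrow> int list \<Rightarrow> int \<Rightarrow> int list list \<Rightarrow> int list list"
and step_aux :: "(nat \<times> nat \<times> int list) list \<Rightarrow> int list \<Rightarrow> int \<Rightarrow> int list \<Rightarrow> int list list \<Rightarrow> int list list" where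
  "step q z c [] = [accum c z]"
| "step q z c (b # bs) = step_aux q z c (increments q b) bs"
| "step_aux q z c i bs = accum c i # step q z (vsum i) bs"

lemma increments_correct:
  assumes "length xs = Suc m" "qs \<noteq> []" "\<And>a b. (a, b) \<in> set qs \<Longrightarrow> a + b + 1 = d"
  shows "length (increments (with_weights qs m) xs) = m + d \<and>
     bern (increments (with_weights qs m) xs) = bern xs * (\<Sum>(a, b)\<leftarrow>qs. bm a b)"
  using assms(2,3)
proof (induction qs)
  case (Cons p qs)
  obtain a b where p: "p = (a, b)"
    by (cases p)
  let ?ys = "zeros a (vmul (weights a b 0 (int m) m) xs @ zeros b [])"
  have ab: "a + b + 1 = d"
    using Cons.prems p by simp
  then have len: "length ?ys = m + d"
    using assms(1) by (simp add: zeros_eq)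
  show ?case
  proof (cases qs)
    case Nil
    then show ?thesis
      using len bern_shift[OF assms(1), of a b] by (simp add: p)
  next
    case (Cons q qs')
    have IH: "length (increments (with_weights qs m) xs) = m + d \<and>
        bern (increments (with_weights qs m) xs) = bern xs * (\<Sum>(a, b)\<leftarrow>qs. bm a b)"
      using Cons Cons.prems Cons.IH by auto
    obtain c e where q: "q = (c, e)"
      by (cases q)
    have "increments (with_weights (p # qs) m) xs = vadd ?ys (increments (with_weights qs m) xs)"
      by (simp add: p q Cons)
    then show ?thesis
      using IH len bern_shift[OF assms(1), of a b] bern_vadd[of ?ys "increments (with_weights qs m) xs"]
      by (simp add: p distrib_left)
  qed
qed simp

lemma letters_sizes: "l \<in> set letters \<Longrightarrow> snd l \<noteq> [] \<and> (\<forall>(a, b)\<in>set (snd l). a + b + 1 = fst l)"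
  by (auto simp: letters_def)

definition size_word :: "letter list \<Rightarrow> nat" where
  "size_word w = sum_list (map fst w)"

fun represents :: "letter list \<Rightarrow> nat \<Rightarrow> int list list \<Rightarrow> bool" where
  "represents w k [] = (\<forall>i\<ge>k. cell w i = 0)"
| "represents w k (b # bs) = (length b = Suc (size_word w) \<and> bern b = cell w k \<and> represents w (Suc k) bs)"

text \<open>The derivatives agree by \<open>increments_correct\<close>, and the value at 0 is given
  by \<open>c\<close>. The value at 1 then yields, through \<open>poly_cell_1\<close>, the constant
  for the next cell.\<close>

lemma represents_step:
  assumes l: "l \<in> set letters" and rep: "represents w k bs"
    and c: "real_of_int c / fact (fst l + size_word w) = node (l # w) k"
  shows "represents (l # w) k (step (with_weights (snd l) (size_word w)) (zeros (fst l + size_word w) []) c bs)"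
  using rep c
proof (induction bs arbitrary: k c)
  case Nil
  let ?z = "zeros (fst l + size_word w) []"
  have 0: "cell w i = 0" if "k \<le> i" for i
    using Nil that by simp
  have "cell (l # w) k = bern (accum c ?z)"
  proof (rule poly_eq_by_pderiv)
    show "pderiv (cell (l # w) k) = pderiv (bern (accum c ?z))"
      by (simp add: pderiv_cell pderiv_bern_accum bern_zeros 0 del: cell.simps)
    show "poly (cell (l # w) k) 0 = poly (bern (accum c ?z)) 0"
      using Nil.prems(2) by (subst poly_bern_0) (auto simp: node_def zeros_eq simp del: cell.simps accum.simps dest: arg_cong[of _ _ length])
  qed
  moreover have "cell (l # w) i = 0" if "Suc k \<le> i" for i
    using that 0 by (cases i) auto
  ultimately show ?case
    by (simp add: size_word_def zeros_eq del: cell.simps)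
next
  case (Cons b bs)
  let ?q = "with_weights (snd l) (size_word w)"
  let ?i = "increments ?q b"
  have b: "length b = Suc (size_word w)" "bern b = cell w k" and rep: "represents w (Suc k) bs"
    using Cons.prems by simp_all
  have "length ?i = size_word w + fst l \<and> bern ?i = bern b * (\<Sum>(a, b)\<leftarrow>snd l. bm a b)"
    by (rule increments_correct) (use b letters_sizes[OF l] in auto)
  then have i: "length ?i = size_word w + fst l" "bern ?i = cell w k * density l"
    using b by (simp_all add: density_def)
  have eq: "cell (l # w) k = bern (accum c ?i)"
  proof (rule poly_eq_by_pderiv)
    show "pderiv (cell (l # w) k) = pderiv (bern (accum c ?i))"
      by (simp add: pderiv_cell pderiv_bern_accum i del: cell.simps)
    show "poly (cell (l # w) k) 0 = poly (bern (accum c ?i)) 0"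
      using Cons.prems(2) i by (subst poly_bern_0) (auto simp: node_def add.commute simp del: cell.simps dest: arg_cong[of _ _ length])
  qed
  have ne: "accum c ?i \<noteq> []"
    by (metis length_accum list.size(3) nat.distinct(1))
  have "node (l # w) k + node (l # w) (Suc k) = real_of_int (c + vsum ?i) / fact (fst l + size_word w)"
    unfolding poly_cell_1[symmetric] eq poly_bern_1[OF ne] using i accum_last[of c ?i] by (simp add: add.commute)
  then have "real_of_int (vsum ?i) / fact (fst l + size_word w) = node (l # w) (Suc k)"
    using Cons.prems(2) by (simp add: add_divide_distrib)
  from Cons.IH[OF rep this] show ?case
    using eq i by (simp add: size_word_def del: cell.simps)
qed

section \<open>From Newton coefficients to monomial coefficients\<close>

fun heads :: "int list list \<Rightarrow> int list" where
  "heads [] = []"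
| "heads ((x # _) # xs) = x # heads xs"
| "heads ([] # xs) = heads xs"

fun rev_onto :: "int list \<Rightarrow> int list \<Rightarrow> int list" where
  "rev_onto [] ys = ys"
| "rev_onto (x # xs) ys = rev_onto xs (x # ys)"

fun mult_linear :: "int \<Rightarrow> int \<Rightarrow> int list \<Rightarrow> int list" where
  "mult_linear p c [] = [p]"
| "mult_linear p c (x # xs) = (p + c * x) # mult_linear x c xs"

fun add_const :: "int \<Rightarrow> int list \<Rightarrow> int list" where
  "add_const y [] = [y]"
| "add_const y (x # xs) = (x + y) # xs"

text \<open>The Horner scheme in the Newton basis, with the highest coefficient first. The argument
  \<open>f\<close> accumulates a quotient of factorials, so that the result is an integral multiple
  of the polynomial and no division occurs.\<close>

fun horner :: "int list \<Rightarrow> int \<Rightarrow> int list \<Rightarrow> int \<Rightarrow> int list" where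
  "horner [] j q f = q"
| "horner (t # ts) j q f = horner ts (j - 1) (add_const (t * f) (mult_linear 0 (1 - j) q)) (f * j)"

fun ehrhart_coeffs :: "int list \<Rightarrow> int list" where
  "ehrhart_coeffs [] = []"
| "ehrhart_coeffs (t # ts) = horner ts (int (length ts) - 1) [t] (int (length ts))"

fun poly_ints :: "int list \<Rightarrow> real poly" where
  "poly_ints [] = 0"
| "poly_ints (x # xs) = pCons (real_of_int x) (poly_ints xs)"

text \<open>In the dilation factor \<open>t\<close> this is
  \<open>(t + 1) * t * ... * (t + 2 - k)\<close>, that is \<open>k!\<close> times the binomial
  \<open>t + 1\<close> over \<open>k\<close>. The shift is there because the dilate by
  \<open>t\<close> admits \<open>t + 1\<close> values.\<close>

definition falling :: "nat \<Rightarrow> real poly" where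
  "falling k = (\<Prod>i<k. [:1 - real i, 1:])"

lemma poly_ints_mult_linear: "poly_ints (mult_linear p c xs) = [:real_of_int p:] + [:real_of_int c, 1:] * poly_ints xs"
  by (induction p c xs rule: mult_linear.induct) (simp_all add: algebra_simps)

lemma poly_ints_add_const: "poly_ints (add_const y xs) = [:real_of_int y:] + poly_ints xs"
  by (cases xs) (simp_all add: add.commute)

lemma rev_onto_eq: "rev_onto xs ys = rev xs @ ys"
  by (induction xs arbitrary: ys) simp_all

lemma poly_ints_horner:
  "poly_ints (horner ts (int (length ts) - 1) q f) = poly_ints q * falling (length ts) +
     (\<Sum>k<length ts. smult (real_of_int (rev ts ! k) * real_of_int f * (fact (length ts - 1) / fact k)) (falling k))"
proof (induction ts arbitrary: q f)
  case Nil
  then show ?case by (simp add: falling_def)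
next
  case (Cons t ts)
  let ?n = "length ts"
  have "poly_ints (horner (t # ts) (int (length (t # ts)) - 1) q f) =
      ([:real_of_int (t * f):] + [:1 - real ?n, 1:] * poly_ints q) * falling ?n +
      (\<Sum>k<?n. smult (real_of_int (rev ts ! k) * real_of_int (f * int ?n) * (fact (?n - 1) / fact k)) (falling k))"
    by (simp add: Cons.IH poly_ints_add_const poly_ints_mult_linear)
  also have "(\<Sum>k<?n. smult (real_of_int (rev ts ! k) * real_of_int (f * int ?n) * (fact (?n - 1) / fact k)) (falling k)) =
      (\<Sum>k<?n. smult (real_of_int (rev (t # ts) ! k) * real_of_int f * (fact ?n / fact k)) (falling k))"
  proof (rule sum.cong[OF refl])
    fix k assume "k \<in> {..<?n}"
    then have k: "k < ?n" by simp
    then have "fact ?n = real ?n * fact (?n - 1)"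
      by (intro fact_reduce) auto
    then have "real_of_int (rev ts ! k) * real_of_int (f * int ?n) * (fact (?n - 1) / fact k) =
        real_of_int (rev (t # ts) ! k) * real_of_int f * (fact ?n / fact k)"
      using k by (simp add: nth_append)
    then show "smult (real_of_int (rev ts ! k) * real_of_int (f * int ?n) * (fact (?n - 1) / fact k)) (falling k) =
        smult (real_of_int (rev (t # ts) ! k) * real_of_int f * (fact ?n / fact k)) (falling k)"
      by (simp only:)
  qed
  also have "([:real_of_int (t * f):] + [:1 - real ?n, 1:] * poly_ints q) * falling ?n =
      poly_ints q * falling (Suc ?n) + smult (real_of_int t * real_of_int f) (falling ?n)"
    by (simp add: falling_def algebra_simps)
  finally show ?case
    by (simp add: nth_append add.assoc add.commute)
qed

lemma poly_ints_ehrhart_coeffs: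
  "poly_ints (ehrhart_coeffs (rev ts)) =
     (\<Sum>k<length ts. smult (real_of_int (ts ! k) * (fact (length ts - 1) / fact k)) (falling k))"
proof (cases "rev ts")
  case (Cons t us)
  then have ts: "ts = rev us @ [t]"
    by (simp add: rev_swap)
  have "poly_ints (ehrhart_coeffs (rev ts)) = smult (real_of_int t) (falling (length us)) +
      (\<Sum>k<length us. smult (real_of_int (rev us ! k) * real (length us) * (fact (length us - 1) / fact k)) (falling k))"
    unfolding Cons by (simp add: poly_ints_horner)
  also have "(\<Sum>k<length us. smult (real_of_int (rev us ! k) * real (length us) * (fact (length us - 1) / fact k)) (falling k)) =
     (\<Sum>k<length us. smult (real_of_int (ts ! k) * (fact (length us) / fact k)) (falling k))"
  proof (rule sum.cong[OF refl])
    fix k assume "k \<in> {..<length us}"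
    then have k: "k < length us" by simp
    then have "fact (length us) = real (length us) * fact (length us - 1)"
      by (intro fact_reduce) auto
    then have "real_of_int (rev us ! k) * real (length us) * (fact (length us - 1) / fact k) =
        real_of_int (ts ! k) * (fact (length us) / fact k)"
      using k by (simp add: ts nth_append)
    then show "smult (real_of_int (rev us ! k) * real (length us) * (fact (length us - 1) / fact k)) (falling k) =
       smult (real_of_int (ts ! k) * (fact (length us) / fact k)) (falling k)"
      by (simp only:)
  qed
  finally show ?thesis
    by (simp add: ts nth_append add.commute)
qed simp

text \<open>At \<open>t = j - 1\<close> its value is the sum of
  \<open>(j choose k) * node w k\<close>. By \<open>mono_count_words\<close> the Ehrhart polynomials
  of small posets are combinations of these polynomials with the chain sums as coefficients.\<close>

definition word_poly :: "letter list \<Rightarrow> real poly" where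
  "word_poly w = (\<Sum>k\<le>11. smult (node w k / fact k) (falling k))"

lemma heads_represents:
  assumes "represents w k bs"
  shows "length (heads bs) = length bs \<and>
    (\<forall>i<length bs. real_of_int (heads bs ! i) = fact (size_word w) * node w (k + i)) \<and>
    (\<forall>i\<ge>length bs. node w (k + i) = 0)"
  using assms
proof (induction bs arbitrary: k)
  case Nil
  then show ?case by (simp add: node_def)
next
  case (Cons b bs)
  then obtain x xs where b: "b = x # xs"
    by (cases b) auto
  have IH: "length (heads bs) = length bs"
    "\<And>i. i < length bs \<Longrightarrow> real_of_int (heads bs ! i) = fact (size_word w) * node w (Suc k + i)"
    "\<And>i. length bs \<le> i \<Longrightarrow> node w (Suc k + i) = 0"
    using Cons.IH[of "Suc k"] Cons.prems by auto
  have "node w k = real_of_int x / fact (size_word w)"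
    using Cons.prems poly_bern_0[of b] by (simp add: node_def b)
  then have x: "real_of_int x = fact (size_word w) * node w k"
    by simp
  show ?case
  proof (intro conjI allI impI)
    show "real_of_int (heads (b # bs) ! i) = fact (size_word w) * node w (k + i)" if "i < length (b # bs)" for i
      using that IH x by (cases i) (auto simp: b)
    show "node w (k + i) = 0" if "length (b # bs) \<le> i" for i
      using that IH(3)[of "i - 1"] by (cases i) auto
  qed (simp add: b IH)
qed

text \<open>The computed integers differ from the coefficients of \<open>word_poly w\<close> only by
  a positive factor, so the signs can be read off from them.\<close>

lemma poly_ints_word:
  assumes "represents w 0 bs" "length bs \<le> 12"
  shows "poly_ints (ehrhart_coeffs (rev_onto (heads bs) [])) = smult (fact (size_word w) * fact (length bs - 1)) (word_poly w)"
proof -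
  note h = heads_represents[OF assms(1)]
  have "poly_ints (ehrhart_coeffs (rev_onto (heads bs) [])) =
      (\<Sum>k<length bs. smult (real_of_int (heads bs ! k) * (fact (length bs - 1) / fact k)) (falling k))"
    using poly_ints_ehrhart_coeffs[of "heads bs"] h by (simp add: rev_onto_eq)
  also have "\<dots> = (\<Sum>k<length bs. smult (fact (size_word w) * fact (length bs - 1)) (smult (node w k / fact k) (falling k)))"
    using h by (intro sum.cong) (auto simp: mult_ac)
  also have "\<dots> = (\<Sum>k\<le>11. smult (fact (size_word w) * fact (length bs - 1)) (smult (node w k / fact k) (falling k)))"
    by (rule sum.mono_neutral_left) (use assms(2) h in auto)
  finally show ?thesis
    by (simp add: word_poly_def smult_sum_right)
qed

fun nonneg :: "int list \<Rightarrow> bool" where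
  "nonneg [] = True"
| "nonneg (x # xs) = (0 \<le> x \<and> nonneg xs)"

lemma nonneg_coeff: "nonneg xs \<Longrightarrow> 0 \<le> coeff (poly_ints xs) k"
proof (induction xs arbitrary: k)
  case (Cons x xs)
  then show ?case by (cases k) auto
qed simp

section \<open>Exhaustive search over the words of size at most 11\<close>

fun run :: "letter list \<Rightarrow> int list list" where
  "run [] = [[1]]"
| "run (l # w) = step (with_weights (snd l) (size_word w)) (zeros (fst l + size_word w) []) 0 (run w)"

definition coeffs_word :: "letter list \<Rightarrow> int list" where
  "coeffs_word w = ehrhart_coeffs (rev_onto (heads (run w)) [])"

text \<open>
  A depth-first search over all words, extending a word at its head. The search stops at the first letter
  exceeding the remaining size \<open>n\<close>, since \<open>letters\<close> is sorted by size.
\<close>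

fun check :: "nat \<Rightarrow> nat \<Rightarrow> nat list \<Rightarrow> nat \<Rightarrow> int list list \<Rightarrow> bool"
and check_letters :: "nat \<Rightarrow> letter list \<Rightarrow> nat \<Rightarrow> nat list \<Rightarrow> nat \<Rightarrow> int list list \<Rightarrow> bool"
where
  "check 0 n ds m bs = (nonneg (ehrhart_coeffs (rev_onto (heads bs) [])) \<or> ds = [1, 1, 1, 1, 3, 1, 1, 1, 1])"
| "check (Suc f) n ds m bs = ((nonneg (ehrhart_coeffs (rev_onto (heads bs) [])) \<or> ds = [1, 1, 1, 1, 3, 1, 1, 1, 1]) \<and>
     check_letters f letters n ds m bs)"
| "check_letters f [] n ds m bs = True"
| "check_letters f ((d, q) # ls) n ds m bs = (if d \<le> n then
     check f (n - d) (d # ds) (m + d) (step (with_weights q m) (zeros (d + m) []) 0 bs) \<and> check_letters f ls n ds m bs else True)"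

text \<open>The word \<open>v @ w\<close> arises from \<open>w\<close> by prepending the letters of
  \<open>v\<close> from last to first, hence the induction from the right end. The fuel
  \<open>f\<close> suffices because every letter has size at least 1.\<close>

lemma check_sound:
  assumes "check f n (map fst w) (size_word w) bs" "represents w 0 bs" "n \<le> f"
    and "length bs = Suc (length w)" "length w + n \<le> 11" "set w \<subseteq> set letters"
    and "set v \<subseteq> set letters" "size_word v \<le> n"
  shows "(\<forall>k. 0 \<le> coeff (word_poly (v @ w)) k) \<or> map fst (v @ w) = [1, 1, 1, 1, 3, 1, 1, 1, 1]"
  using assms
proof (induction v arbitrary: f n w bs rule: rev_induct)
  case Nil
  then have "nonneg (ehrhart_coeffs (rev_onto (heads bs) [])) \<or> map fst w = [1, 1, 1, 1, 3, 1, 1, 1, 1]"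
    by (cases f) auto
  moreover have "0 \<le> coeff (word_poly w) k" if "nonneg (ehrhart_coeffs (rev_onto (heads bs) []))" for k
  proof -
    have "poly_ints (ehrhart_coeffs (rev_onto (heads bs) [])) = smult (fact (size_word w) * fact (length bs - 1)) (word_poly w)"
      using Nil.prems by (intro poly_ints_word) auto
    then have "0 \<le> fact (size_word w) * fact (length bs - 1) * coeff (word_poly w) k"
      using nonneg_coeff[OF that, of k] by simp
    moreover have "0 < (fact (size_word w) * fact (length bs - 1) :: real)"
      by simp
    ultimately show ?thesis
      using mult_le_cancel_left_pos[of "fact (size_word w) * fact (length bs - 1)" 0 "coeff (word_poly w) k"] by simp
  qed
  ultimately show ?case by auto
next
  case (snoc l v)
  have l: "l \<in> set letters" and d: "1 \<le> fst l" and le: "fst l + size_word v \<le> n"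
    using snoc.prems letters_pos by (auto simp: size_word_def)
  then obtain f' where f: "f = Suc f'"
    using snoc.prems(3) by (cases f) auto
  let ?bs = "step (with_weights (snd l) (size_word w)) (zeros (fst l + size_word w) []) 0 bs"
  have "check_letters f' letters n (map fst w) (size_word w) bs"
    using snoc.prems(1) by (simp add: f)
  \<comment> \<open>The scan over the letters cannot stop before \<open>l\<close>, since all earlier
    letters are at most as large.\<close>
  moreover have "check f' (n - fst l) (fst l # map fst w) (size_word w + fst l) ?bs"
    if "check_letters f' ls n (map fst w) (size_word w) bs" "l \<in> set ls" "sorted (map fst ls)" for ls
    using that
  proof (induction ls)
    case (Cons a ls)
    then show ?case
      using le by (cases a) (auto split: if_splits)
  qed simp
  moreover have "sorted (map fst letters)"
    by (simp add: letters_def)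
  ultimately have "check f' (n - fst l) (map fst (l # w)) (size_word (l # w)) ?bs"
    using l by (simp add: size_word_def add.commute)
  moreover have "represents (l # w) 0 ?bs"
    by (rule represents_step[OF l snoc.prems(2)]) simp
  moreover have "length (step q z c bs) = Suc (length bs)" for q z c bs
    by (induction bs arbitrary: c) auto
  ultimately have "(\<forall>k. 0 \<le> coeff (word_poly (v @ l # w)) k) \<or> map fst (v @ l # w) = [1, 1, 1, 1, 3, 1, 1, 1, 1]"
    using snoc.prems l le f d by (intro snoc.IH[of f' "n - fst l" "l # w" ?bs]) (auto simp: size_word_def)
  then show ?case by simp
qed

lemma represents_Nil: "represents [] 0 [[1]]"
  by (simp add: size_word_def bern_def)

lemma run_correct:
  "set w \<subseteq> set letters \<Longrightarrow> represents w 0 (run w) \<and> length (run w) = Suc (length w)"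
proof (induction w)
  case Nil
  then show ?case by (simp add: represents_Nil del: represents.simps)
next
  case (Cons l w)
  have "length (step q z c bs) = Suc (length bs)" for q z c bs
    by (induction bs arbitrary: c) auto
  moreover have "represents (l # w) 0 (run (l # w))"
    unfolding run.simps by (rule represents_step) (use Cons in auto)
  ultimately show ?case
    using Cons by simp
qed

lemma poly_ints_coeffs_word:
  assumes "set w \<subseteq> set letters" "length w \<le> 11"
  shows "poly_ints (coeffs_word w) = smult (fact (size_word w) * fact (length w)) (word_poly w)"
  using poly_ints_word[of w "run w"] run_correct[OF assms(1)] assms(2) by (simp add: coeffs_word_def)

lemma check_11: "check 11 11 [] 0 [[1]]"
  by code_simp

definition letter1 :: letter where "letter1 = (1, [(0, 0)])"
definition letter2 :: letter where "letter2 = (2, [(1, 0), (0, 1)])"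
definition letter3 :: letter where "letter3 = (3, [(1, 1)])"

lemma fst_letter [simp]: "fst letter1 = 1" "fst letter2 = 2" "fst letter3 = 3"
  by (simp_all add: letter1_def letter2_def letter3_def)

abbreviation word3 :: "letter list" where
  "word3 \<equiv> replicate 4 letter1 @ letter3 # replicate 4 letter1"
abbreviation word12 :: "letter list" where
  "word12 \<equiv> replicate 4 letter1 @ letter1 # letter2 # replicate 4 letter1"
abbreviation word21 :: "letter list" where
  "word21 \<equiv> replicate 4 letter1 @ letter2 # letter1 # replicate 4 letter1"

lemma small_letters [simp]: "letter1 \<in> set letters" "letter2 \<in> set letters" "letter3 \<in> set letters"
  by (simp_all add: letters_def letter1_def letter2_def letter3_def)

text \<open>These are the coefficients of \<open>word_poly word3\<close> multiplied by
  \<open>11! * 9!\<close>; the linear one is negative.\<close>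

lemma coeffs_word3:
  "coeffs_word (replicate 4 letter1 @ letter3 # replicate 4 letter1) =
   [9072000, -17539200, 119750400, 518918400, 838252800, 838252800, 558835200, 239500800, 59875200, 6652800]"
  by code_simp

lemma coeffs_word12:
  "coeffs_word (replicate 4 letter1 @ letter1 # letter2 # replicate 4 letter1) =
   [39916800, 399168000, 1796256000, 4790016000, 8382528000, 10059033600, 8382528000, 4790016000, 1796256000, 399168000, 39916800]"
  by code_simp

lemma coeffs_word21:
  "coeffs_word (replicate 4 letter1 @ letter2 # letter1 # replicate 4 letter1) =
   [39916800, 399168000, 1796256000, 4790016000, 8382528000, 10059033600, 8382528000, 4790016000, 1796256000, 399168000, 39916800]"
  by code_simp

fun all_positive :: "int list \<Rightarrow> bool" where
  "all_positive [] = True"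
| "all_positive (x # xs) = (0 < x \<and> all_positive xs)"

lemma all_positive_coeff: "all_positive xs \<Longrightarrow> k < length xs \<Longrightarrow> 0 < coeff (poly_ints xs) k"
proof (induction xs arbitrary: k)
  case (Cons x xs)
  then show ?case by (cases k) auto
qed simp

fun positive_ones :: "nat \<Rightarrow> bool" where
  "positive_ones 0 = (all_positive (coeffs_word (replicate 0 letter1)) \<and> length (coeffs_word (replicate 0 letter1)) = 1)"
| "positive_ones (Suc n) = (all_positive (coeffs_word (replicate (Suc n) letter1)) \<and>
     length (coeffs_word (replicate (Suc n) letter1)) = Suc (Suc n) \<and> positive_ones n)"

lemma positive_ones_11: "positive_ones 11"
  by code_simp

text \<open>The Ehrhart coefficients will owe their strict positivity to the word with all blocks of
  size 1.\<close>

lemma word_poly_ones_pos: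
  assumes "n \<le> 11" "k \<le> n"
  shows "0 < coeff (word_poly (replicate n letter1)) k"
proof -
  have "all_positive (coeffs_word (replicate n letter1)) \<and> length (coeffs_word (replicate n letter1)) = Suc n"
    if "n \<le> m" "positive_ones m" for m
    using that by (induction m) (auto simp: le_Suc_eq)
  from this[OF assms(1) positive_ones_11]
  have "0 < coeff (poly_ints (coeffs_word (replicate n letter1))) k"
    using assms(2) by (intro all_positive_coeff) auto
  then have "0 < fact (size_word (replicate n letter1)) * fact n * coeff (word_poly (replicate n letter1)) k"
    using poly_ints_coeffs_word[of "replicate n letter1"] assms(1) by (auto simp: set_replicate_conv_if)
  then show ?thesis
    by (rule zero_less_mult_pos) simp
qed

lemma word_poly_coeff:
  assumes "set w \<subseteq> set letters" "length w \<le> 11"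
  shows "coeff (word_poly w) k = coeff (poly_ints (coeffs_word w)) k / (fact (size_word w) * fact (length w))"
  using poly_ints_coeffs_word[OF assms] by simp

text \<open>The search leaves one sequence of sizes in doubt. Sizes 1 and 3 have one letter each, so
  the sequence determines the word, and its explicit coefficients show that only the linear one is
  negative.\<close>

lemma word_poly_nonneg:
  assumes w: "w \<in> words n" and n: "n \<le> 11"
  shows "0 \<le> coeff (word_poly w) k \<or> w = word3 \<and> k = 1"
proof -
  have sw: "set w \<subseteq> set letters" "size_word w \<le> 11"
    using w n by (auto simp: words_def size_word_def)
  have "(\<forall>k. 0 \<le> coeff (word_poly (w @ [])) k) \<or> map fst (w @ []) = [1, 1, 1, 1, 3, 1, 1, 1, 1]"
    by (rule check_sound[of 11 11 "[]" "[[1]]" w])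
      (use sw check_11 represents_Nil in \<open>auto simp: size_word_def simp del: represents.simps check.simps\<close>)
  then consider "\<forall>k. 0 \<le> coeff (word_poly w) k" | "map fst w = [1, 1, 1, 1, 3, 1, 1, 1, 1]"
    by auto
  then show ?thesis
  proof cases
    case 2
    have "l = letter1" if "l \<in> set letters" "fst l = 1" for l
      using that by (auto simp: letters_def letter1_def)
    moreover have "l = letter3" if "l \<in> set letters" "fst l = 3" for l
      using that by (auto simp: letters_def letter3_def)
    ultimately have w3: "w = word3"
      using 2 sw(1) by (auto simp: map_eq_Cons_conv numeral_eq_Suc)
    have "coeff (word_poly word3) k = coeff (poly_ints (coeffs_word word3)) k / (fact (size_word word3) * fact (length word3))"
      by (rule word_poly_coeff) auto
    moreover have "0 \<le> coeff (poly_ints (coeffs_word word3)) k" if "k \<noteq> 1"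
      unfolding coeffs_word3 using that by (auto simp: coeff_pCons split: nat.split)
    ultimately show ?thesis
      using w3 by (cases "k = 1") auto
  qed auto
qed

lemma size_words [simp]: "size_word word3 = 11" "size_word word12 = 11" "size_word word21 = 11"
  by (simp_all add: size_word_def sum_list_replicate)

lemma word_poly_linear:
  "coeff (word_poly word3) 1 = -17539200 / (fact 11 * fact 9)"
  "coeff (word_poly word12) 1 = 399168000 / (fact 11 * fact 10)"
  "coeff (word_poly word21) 1 = 399168000 / (fact 11 * fact 10)"
proof -
  have "coeff (word_poly word3) 1 = coeff (poly_ints (coeffs_word word3)) 1 / (fact (size_word word3) * fact (length word3))"
    by (rule word_poly_coeff) auto
  then show "coeff (word_poly word3) 1 = -17539200 / (fact 11 * fact 9)"
    unfolding coeffs_word3 size_words by simp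
  have "coeff (word_poly word12) 1 = coeff (poly_ints (coeffs_word word12)) 1 / (fact (size_word word12) * fact (length word12))"
    by (rule word_poly_coeff) auto
  then show "coeff (word_poly word12) 1 = 399168000 / (fact 11 * fact 10)"
    unfolding coeffs_word12 size_words by simp
  have "coeff (word_poly word21) 1 = coeff (poly_ints (coeffs_word word21)) 1 / (fact (size_word word21) * fact (length word21))"
    by (rule word_poly_coeff) auto
  then show "coeff (word_poly word21) 1 = 399168000 / (fact 11 * fact 10)"
    unfolding coeffs_word21 size_words by simp
qed

section \<open>Splitting a block of size 3\<close>

lemma degree_falling: "degree (falling k) \<le> k"
proof -
  have "degree (falling k) \<le> (\<Sum>i<k. degree [:1 - real i, 1:])"
    unfolding falling_def using degree_prod_sum_le[of "{..<k}" "\<lambda>i. [:1 - real i, 1:]"] by simp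
  then show ?thesis by simp
qed

text \<open>Newton terms beyond the length of the word vanish, and the others have too small a
  degree.\<close>

lemma coeff_word_poly_beyond:
  assumes "length w < k"
  shows "coeff (word_poly w) k = 0"
  unfolding word_poly_def coeff_sum
proof (rule sum.neutral, rule ballI)
  fix i
  show "coeff (smult (node w i / fact i) (falling i)) k = 0"
  proof (cases "i \<le> length w")
    case True
    then have "degree (falling i) < k"
      using degree_falling[of i] assms by linarith
    then show ?thesis
      by (simp add: coeff_eq_0)
  next
    case False
    then show ?thesis
      by (simp add: node_def cell_beyond)
  qed
qed

lemma chain_sum_nonneg: "finite Q \<Longrightarrow> card Q \<le> 11 \<Longrightarrow> 0 \<le> chain_sum r w Q"
proof (induction w arbitrary: Q)
  case (Cons l w)
  have "0 \<le> chain_sum r w (Q - B) * block_coeff r l B" if "B \<in> filters r Q" for B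
  proof -
    have B: "finite B" "card B \<le> 11"
      using finite_subset[OF filters_subset[OF that]] card_mono[OF _ filters_subset[OF that]] Cons.prems by auto
    have "card (Q - B) \<le> 11"
      using card_mono[of Q "Q - B"] Cons.prems by auto
    then show ?thesis
      using block_coeff_nonneg[OF B] Cons by simp
  qed
  then show ?case
    by (auto intro!: sum_nonneg)
qed simp

text \<open>The two topmost blocks \<open>C\<close> and \<open>B - C\<close> are merged into one
  filter \<open>B\<close>, so that a block and its splittings can be compared for each
  \<open>B\<close> separately.\<close>

lemma chain_sum_two:
  assumes Q: "finite Q"
  shows "chain_sum r (a # b # w) Q = (\<Sum>B | B \<in> filters r Q \<and> card B = fst a + fst b. chain_sum r w (Q - B) *
    (\<Sum>C | C \<in> filters r B \<and> card C = fst a. block_coeff r b (B - C) * block_coeff r a C))"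
proof -
  \<comment> \<open>The conditions on the sizes are moved into the summand, because
    \<open>sum_filters_swap\<close> sums over all filters.\<close>
  let ?t = "\<lambda>D C. if card C = fst a \<and> card D = fst b then
      chain_sum r w (Q - C - D) * (block_coeff r b D * block_coeff r a C) else 0"
  have "chain_sum r (a # b # w) Q = (\<Sum>C\<in>filters r Q. \<Sum>D\<in>filters r (Q - C). ?t D C)"
  proof -
    have "chain_sum r (b # w) (Q - C) * block_coeff r a C = (\<Sum>D\<in>filters r (Q - C). ?t D C)"
      if "card C = fst a" for C
      using that Q by (simp add: sum.inter_filter sum_distrib_right mult.assoc if_distrib[of "\<lambda>x. x * _"] cong: if_cong)
    then have "chain_sum r (a # b # w) Q = (\<Sum>C | C \<in> filters r Q \<and> card C = fst a. \<Sum>D\<in>filters r (Q - C). ?t D C)"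
      unfolding chain_sum.simps(2)[of r a "b # w"] by (intro sum.cong refl) auto
    also have "\<dots> = (\<Sum>C\<in>filters r Q. if card C = fst a then \<Sum>D\<in>filters r (Q - C). ?t D C else 0)"
      by (rule sum.inter_filter) (simp add: Q)
    also have "\<dots> = (\<Sum>C\<in>filters r Q. \<Sum>D\<in>filters r (Q - C). ?t D C)"
      by (intro sum.cong refl) auto
    finally show ?thesis .
  qed
  also have "\<dots> = (\<Sum>B\<in>filters r Q. \<Sum>C\<in>filters r B. ?t (B - C) C)"
    by (rule sum_filters_swap[OF Q, symmetric])
  also have "\<dots> = (\<Sum>B\<in>filters r Q. if card B = fst a + fst b then chain_sum r w (Q - B) *
    (\<Sum>C | C \<in> filters r B \<and> card C = fst a. block_coeff r b (B - C) * block_coeff r a C) else 0)"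
  proof (rule sum.cong[OF refl])
    fix B assume "B \<in> filters r Q"
    then have B: "finite B"
      using filters_subset[of B r Q] finite_subset[of B Q] Q by auto
    have *: "Q - C - (B - C) = Q - B" "card (B - C) = card B - card C" "card C \<le> card B" if "C \<in> filters r B" for C
      using filters_subset[OF that] B by (auto simp: card_Diff_subset finite_subset card_mono)
    show "(\<Sum>C\<in>filters r B. ?t (B - C) C) = (if card B = fst a + fst b then chain_sum r w (Q - B) *
      (\<Sum>C | C \<in> filters r B \<and> card C = fst a. block_coeff r b (B - C) * block_coeff r a C) else 0)"
    proof (cases "card B = fst a + fst b")
      case True
      have "(\<Sum>C\<in>filters r B. ?t (B - C) C) = (\<Sum>C\<in>filters r B. if card C = fst a then
          chain_sum r w (Q - B) * (block_coeff r b (B - C) * block_coeff r a C) else 0)"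
        by (rule sum.cong[OF refl]) (use True * in auto)
      then show ?thesis
        using True B by (auto simp: sum_distrib_left sum.inter_filter intro!: sum.cong)
    next
      case False
      then have "?t (B - C) C = 0" if "C \<in> filters r B" for C
        using *[OF that] by auto
      then show ?thesis
        using False by simp
    qed
  qed
  also have "\<dots> = (\<Sum>B | B \<in> filters r Q \<and> card B = fst a + fst b. chain_sum r w (Q - B) *
    (\<Sum>C | C \<in> filters r B \<and> card C = fst a. block_coeff r b (B - C) * block_coeff r a C))"
    using Q by (simp add: sum.inter_filter)
  finally show ?thesis .
qed

lemma letters_of_size:
  "{l \<in> set letters. fst l = 1} = {letter1}" "{l \<in> set letters. fst l = 2} = {letter2}"
  "{l \<in> set letters. fst l \<le> 1} = {letter1}" "{l \<in> set letters. fst l \<le> 2} = {letter1, letter2}"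
  "{l \<in> set letters. fst l \<le> 3} = {letter1, letter2, letter3}"
proof -
  have *: "{l \<in> set letters. P l} = set (filter P letters)" for P
    by auto
  show "{l \<in> set letters. fst l = 1} = {letter1}" "{l \<in> set letters. fst l = 2} = {letter2}"
    "{l \<in> set letters. fst l \<le> 1} = {letter1}" "{l \<in> set letters. fst l \<le> 2} = {letter1, letter2}"
    "{l \<in> set letters. fst l \<le> 3} = {letter1, letter2, letter3}"
    unfolding * by (simp_all add: letters_def letter1_def letter2_def letter3_def)
qed

lemma block_coeff_single [simp]: "block_coeff r letter1 {x} = 1"
proof -
  have "avg_prime r {x} = (\<Sum>l\<in>{l \<in> set letters. fst l = 1}. smult (block_coeff r l {x}) (density l))"
    using avg_prime_letters[of "{x}" r] by simp
  then show ?thesis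
    unfolding letters_of_size by (simp add: avg_prime_single density_def letter1_def one_pCons)
qed

lemma block_coeff_pair:
  assumes "p \<noteq> q"
  shows "block_coeff r letter2 {p, q} = (of_bool ({p} \<notin> filters r {p, q}) + of_bool ({q} \<notin> filters r {p, q})) / 2"
proof -
  have "avg_prime r {p, q} = (\<Sum>l\<in>{l \<in> set letters. fst l = 2}. smult (block_coeff r l {p, q}) (density l))"
    using avg_prime_letters[of "{p, q}" r] assms by (simp add: numeral_2_eq_2)
  moreover have "density letter2 = 1"
    by (simp add: density_def letter2_def bm_def one_pCons)
  ultimately show ?thesis
    unfolding letters_of_size avg_prime_pair[OF assms] by (simp add: one_pCons)
qed

lemma filters_card_1:
  assumes "finite B"
  shows "(\<Sum>C | C \<in> filters r B \<and> card C = 1. f C) = (\<Sum>x\<in>B. if {x} \<in> filters r B then f {x} else 0)"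
proof -
  have "{C. C \<in> filters r B \<and> card C = 1} = (\<lambda>x. {x}) ` {x \<in> B. {x} \<in> filters r B}"
    using filters_subset by (fastforce simp: card_1_singleton_iff)
  then have "(\<Sum>C | C \<in> filters r B \<and> card C = 1. f C) = (\<Sum>x | x \<in> B \<and> {x} \<in> filters r B. f {x})"
    by (simp add: sum.reindex)
  then show ?thesis
    using assms by (simp add: sum.inter_filter)
qed

lemma letters_distinct [simp]: "letter1 \<noteq> letter2" "letter1 \<noteq> letter3" "letter2 \<noteq> letter3"
  by (simp_all add: letter1_def letter2_def letter3_def)

lemma words_1_2_3:
  "(\<Sum>w\<in>words 1. f w) = f [letter1]"
  "(\<Sum>w\<in>words 2. f w) = f [letter1, letter1] + f [letter2]"
  "(\<Sum>w\<in>words 3. f w) = f [letter1, letter1, letter1] + f [letter1, letter2] + (f [letter2, letter1] + f [letter3])"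
proof -
  show 1: "(\<Sum>w\<in>words 1. f w) = f [letter1]" for f :: "letter list \<Rightarrow> 'a"
    by (subst sum_words) (simp_all add: letters_of_size words_0 del: One_nat_def)
  show 2: "(\<Sum>w\<in>words 2. f w) = f [letter1, letter1] + f [letter2]" for f :: "letter list \<Rightarrow> 'a"
    by (subst sum_words) (simp_all add: letters_of_size words_0 1 1[unfolded One_nat_def])
  show "(\<Sum>w\<in>words 3. f w) = f [letter1, letter1, letter1] + f [letter1, letter2] + (f [letter2, letter1] + f [letter3])"
    by (subst sum_words) (simp_all add: letters_of_size words_0 1 1[unfolded One_nat_def] 2 2[unfolded numeral_2_eq_2])
qed

lemma node_small:
  "node [letter1, letter1, letter1] 1 = 1 / 6" "node [letter1, letter2] 1 = 1 / 2"
  "node [letter2, letter1] 1 = 1 / 2" "node [letter3] 1 = 1 / 6"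
proof -
  have *: "node w 1 = real_of_int (heads (run w) ! 1) / fact (size_word w)" if "set w \<subseteq> set letters" "w \<noteq> []" for w
  proof -
    have "1 < length (run w)"
      using run_correct[OF that(1)] that(2) by (cases w) auto
    then show ?thesis
      using heads_represents[of w 0 "run w"] run_correct[OF that(1)] by simp
  qed
  have h: "heads (run [letter1, letter1, letter1]) = [0, 1, 6, 6]" "heads (run [letter1, letter2]) = [0, 3, 6]"
    "heads (run [letter2, letter1]) = [0, 3, 6]" "heads (run [letter3]) = [0, 1]"
    by code_simp+
  show "node [letter1, letter1, letter1] 1 = 1 / 6" "node [letter1, letter2] 1 = 1 / 2"
    "node [letter2, letter1] 1 = 1 / 2" "node [letter3] 1 = 1 / 6"
    using *[of "[letter1, letter1, letter1]"] *[of "[letter1, letter2]"] *[of "[letter2, letter1]"] *[of "[letter3]"]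
    unfolding h by (simp_all add: size_word_def fact_numeral del: run.simps)
qed

lemma mono_count_1: "mono_count r Q 1 = 1"
proof -
  have "{f \<in> Q \<rightarrow>\<^sub>E {..<1::nat}. \<forall>i\<in>Q. \<forall>j\<in>Q. (i, j) \<in> r \<longrightarrow> f i \<le> f j} = {restrict (\<lambda>_. 0) Q}"
    by (auto simp: PiE_def extensional_def fun_eq_iff Pi_def)
  then show ?thesis
    by (simp only: mono_count_def) simp
qed

text \<open>This is \<open>mono_count_words\<close> for \<open>j = 1\<close>, multiplied by 6: there
  is one map into a single value, and the words of size 3 enter through their nodes 1/6, 1/2, 1/2
  and 1/6.\<close>

lemma chain_sum_triple:
  assumes "finite B" "card B = 3"
  shows "6 = chain_sum r [letter1, letter1, letter1] B + 3 * (chain_sum r [letter1, letter2] B + chain_sum r [letter2, letter1] B) +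
     block_coeff r letter3 B"
proof -
  have one: "(\<Sum>k\<le>11. real (1 choose k) * node w k) = node w 0 + node w 1" for w
  proof -
    have "(\<Sum>k\<le>11. real (1 choose k) * node w k) = (\<Sum>k\<in>{0, 1}. real (1 choose k) * node w k)"
      by (rule sum.mono_neutral_right) (auto simp: binomial_eq_0_iff)
    then show ?thesis by simp
  qed
  have "chain_sum r [letter3] B = (\<Sum>C | C \<in> filters r B \<and> card C = 3. if C = B then block_coeff r letter3 B else 0)"
  proof -
    have "C = B" if "C \<in> filters r B" "card C = 3" for C
      using that assms filters_subset card_subset_eq[of B C] by auto
    then show ?thesis
      unfolding chain_sum.simps by (intro sum.cong) (auto simp: of_bool_def)
  qed
  also have "\<dots> = block_coeff r letter3 B"
    using assms by (simp add: sum.delta)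
  finally have "chain_sum r [letter3] B = block_coeff r letter3 B" .
  moreover have "real (mono_count r B 1) = (\<Sum>w\<in>words 3. chain_sum r w B * (node w 0 + node w 1))"
    using mono_count_words[OF assms(1), of r 1] assms(2) unfolding one by simp
  ultimately show ?thesis
    unfolding mono_count_1 words_1_2_3 node_small node_Cons_0 by (simp add: field_simps del: chain_sum.simps)
qed

text \<open>For a partial order these are the number of linear extensions of the pair and half the
  number of its strict relations.\<close>

lemma pair_sum:
  assumes "x \<noteq> y"
  shows "chain_sum r [letter1, letter1] {x, y} = of_bool ((x, y) \<notin> r) + of_bool ((y, x) \<notin> r)"
    and "block_coeff r letter2 {x, y} = (of_bool ((x, y) \<in> r) + of_bool ((y, x) \<in> r)) / 2"
proof -
  have f: "{x} \<in> filters r {x, y} \<longleftrightarrow> (x, y) \<notin> r" "{y} \<in> filters r {x, y} \<longleftrightarrow> (y, x) \<notin> r"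
    using assms by (auto simp: filters_def)
  have "chain_sum r [letter1, letter1] {x, y} = (\<Sum>C | C \<in> filters r {x, y} \<and> card C = 1. chain_sum r [letter1] ({x, y} - C) * block_coeff r letter1 C)"
    by simp
  also have "\<dots> = of_bool ((x, y) \<notin> r) + of_bool ((y, x) \<notin> r)"
  proof -
    have "chain_sum r [letter1] {z} = 1" for z
    proof -
      have "chain_sum r [letter1] {z} = (\<Sum>C | C \<in> filters r {z} \<and> card C = 1. of_bool ({z} - C = {}) * block_coeff r letter1 C)"
        by simp
      then show ?thesis
        by (subst (asm) filters_card_1) simp_all
    qed
    moreover have "{x, y} - {x} = {y}" "{x, y} - {y} = {x}"
      using assms by auto
    ultimately show ?thesis
      using assms f by (subst filters_card_1) (simp_all del: chain_sum.simps)
  qed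
  finally show "chain_sum r [letter1, letter1] {x, y} = of_bool ((x, y) \<notin> r) + of_bool ((y, x) \<notin> r)" .
  show "block_coeff r letter2 {x, y} = (of_bool ((x, y) \<in> r) + of_bool ((y, x) \<in> r)) / 2"
    unfolding block_coeff_pair[OF assms] f by simp
qed

lemma filters_card_2:
  assumes "finite B" "card B = 3"
  shows "(\<Sum>C | C \<in> filters r B \<and> card C = 2. f C) = (\<Sum>x\<in>B. if B - {x} \<in> filters r B then f (B - {x}) else 0)"
proof -
  have inj: "inj_on (\<lambda>x. B - {x}) B"
    by (auto simp: inj_on_def)
  have "{C. C \<in> filters r B \<and> card C = 2} = (\<lambda>x. B - {x}) ` {x \<in> B. B - {x} \<in> filters r B}"
  proof (intro set_eqI iffI)
    fix C assume "C \<in> {C. C \<in> filters r B \<and> card C = 2}"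
    then have C: "C \<in> filters r B" "card C = 2" "C \<subseteq> B"
      using filters_subset by auto
    then have "card (B - C) = 1"
      using assms by (simp add: card_Diff_subset finite_subset)
    then obtain x where "B - C = {x}"
      by (auto simp: card_1_singleton_iff)
    then have "x \<in> B" "C = B - {x}"
      using C(3) by auto
    then show "C \<in> (\<lambda>x. B - {x}) ` {x \<in> B. B - {x} \<in> filters r B}"
      using C by auto
  qed (use assms in auto)
  then have "(\<Sum>C | C \<in> filters r B \<and> card C = 2. f C) = (\<Sum>x | x \<in> B \<and> B - {x} \<in> filters r B. f (B - {x}))"
    using inj by (simp add: sum.reindex inj_on_subset)
  then show ?thesis
    using assms by (simp add: sum.inter_filter)
qed

text \<open>The variables \<open>a\<close> to \<open>f\<close> stand for the relations x < y, y < x,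
  y < z, z < y, x < z, z < x among three points, and the hypotheses are antisymmetry and
  transitivity. The summands are the chain sums of the three words of size 3 without a block of size
  3.\<close>

lemma triple_count:
  assumes "\<not> (a \<and> b)" "\<not> (c \<and> d)" "\<not> (e \<and> f)"
    and "a \<and> c \<longrightarrow> e" "e \<and> d \<longrightarrow> a" "b \<and> e \<longrightarrow> c" "c \<and> f \<longrightarrow> b" "f \<and> a \<longrightarrow> d" "d \<and> b \<longrightarrow> f"
  shows "(6::real) \<le> (if \<not> a \<and> \<not> e then of_bool (\<not> c) + of_bool (\<not> d) else 0) +
      (if \<not> b \<and> \<not> c then of_bool (\<not> e) + of_bool (\<not> f) else 0) +
      (if \<not> f \<and> \<not> d then of_bool (\<not> a) + of_bool (\<not> b) else 0) +
    5 * ((if \<not> a \<and> \<not> e then (of_bool c + of_bool d) / 2 else 0) +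
      (if \<not> b \<and> \<not> c then (of_bool e + of_bool f) / 2 else 0) +
      (if \<not> f \<and> \<not> d then (of_bool a + of_bool b) / 2 else 0) +
      ((if \<not> b \<and> \<not> f then (of_bool c + of_bool d) / 2 else 0) +
      (if \<not> a \<and> \<not> d then (of_bool e + of_bool f) / 2 else 0) +
      (if \<not> e \<and> \<not> c then (of_bool a + of_bool b) / 2 else 0)))"
proof -
  \<comment> \<open>Quantifying over the truth values reduces the claim to 64 numerical
    cases.\<close>
  have *: "\<forall>a b c d e f. \<not> (a \<and> b) \<and> \<not> (c \<and> d) \<and> \<not> (e \<and> f) \<and> (a \<and> c \<longrightarrow> e) \<and> (e \<and> d \<longrightarrow> a) \<and> (b \<and> e \<longrightarrow> c) \<and> (c \<and> f \<longrightarrow> b) \<and> (f \<and> a \<longrightarrow> d) \<and> (d \<and> b \<longrightarrow> f) \<longrightarrow> (6::real) \<le> (if \<not> a \<and> \<not> e then of_bool (\<not> c) + of_bool (\<not> d) else 0) +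
      (if \<not> b \<and> \<not> c then of_bool (\<not> e) + of_bool (\<not> f) else 0) +
      (if \<not> f \<and> \<not> d then of_bool (\<not> a) + of_bool (\<not> b) else 0) +
    5 * ((if \<not> a \<and> \<not> e then (of_bool c + of_bool d) / 2 else 0) +
      (if \<not> b \<and> \<not> c then (of_bool e + of_bool f) / 2 else 0) +
      (if \<not> f \<and> \<not> d then (of_bool a + of_bool b) / 2 else 0) +
      ((if \<not> b \<and> \<not> f then (of_bool c + of_bool d) / 2 else 0) +
      (if \<not> a \<and> \<not> d then (of_bool e + of_bool f) / 2 else 0) +
      (if \<not> e \<and> \<not> c then (of_bool a + of_bool b) / 2 else 0)))"
    unfolding all_bool_eq by simp
  have "\<not> (a \<and> b) \<and> \<not> (c \<and> d) \<and> \<not> (e \<and> f) \<and> (a \<and> c \<longrightarrow> e) \<and> (e \<and> d \<longrightarrow> a) \<and> (b \<and> e \<longrightarrow> c) \<and> (c \<and> f \<longrightarrow> b) \<and> (f \<and> a \<longrightarrow> d) \<and> (d \<and> b \<longrightarrow> f)"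
    using assms by blast
  then show ?thesis
    by (rule *[THEN spec, THEN spec, THEN spec, THEN spec, THEN spec, THEN spec, THEN mp])
qed

text \<open>The estimate of \<open>triple_count\<close> eliminates the chain sum of three single
  blocks from \<open>chain_sum_triple\<close>; the factor 2 is the difference of the factors 5 and 3
  there.\<close>

lemma triple_bound:
  assumes B: "finite B" "card B = 3" and r: "trans r" "antisym r"
  shows "block_coeff r letter3 B \<le> 2 * (chain_sum r [letter1, letter2] B + chain_sum r [letter2, letter1] B)"
proof -
  obtain x y z where xyz: "B = {x, y, z}" "x \<noteq> y" "y \<noteq> z" "x \<noteq> z"
    using B(2) by (auto simp: card_3_iff)
  have D: "B - {x} = {y, z}" "B - {y} = {x, z}" "B - {z} = {x, y}"
    using xyz by auto
  have f: "{x} \<in> filters r B \<longleftrightarrow> (x, y) \<notin> r \<and> (x, z) \<notin> r" "{y} \<in> filters r B \<longleftrightarrow> (y, x) \<notin> r \<and> (y, z) \<notin> r"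
    "{z} \<in> filters r B \<longleftrightarrow> (z, x) \<notin> r \<and> (z, y) \<notin> r"
    "{y, z} \<in> filters r B \<longleftrightarrow> (y, x) \<notin> r \<and> (z, x) \<notin> r" "{x, z} \<in> filters r B \<longleftrightarrow> (x, y) \<notin> r \<and> (z, y) \<notin> r"
    "{x, y} \<in> filters r B \<longleftrightarrow> (x, z) \<notin> r \<and> (y, z) \<notin> r"
    unfolding xyz(1) filters_def using xyz(2-) by auto
  have t: "\<And>a b c. (a, b) \<in> r \<Longrightarrow> (b, c) \<in> r \<Longrightarrow> (a, c) \<in> r" and as: "\<And>a b. (a, b) \<in> r \<Longrightarrow> (b, a) \<in> r \<Longrightarrow> a = b"
    using r by (auto dest: transD antisymD)
  have single: "chain_sum r [l] C = block_coeff r l C" if "card C = fst l" "finite C" for l C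
  proof -
    have "C' = C" if "C' \<in> filters r C" "card C' = fst l" for C'
      using that \<open>card C = fst l\<close> \<open>finite C\<close> filters_subset card_subset_eq[of C C'] by auto
    then have "chain_sum r [l] C = (\<Sum>C' | C' \<in> filters r C \<and> card C' = fst l. if C' = C then block_coeff r l C else 0)"
      unfolding chain_sum.simps by (intro sum.cong) (auto simp: of_bool_def)
    then show ?thesis
      using that by (simp add: sum.delta)
  qed
  have s2: "chain_sum r [letter2] {p, q} = block_coeff r letter2 {p, q}" if "p \<noteq> q" for p q
    using that by (intro single) auto
  have s1: "chain_sum r [letter1] {p} = 1" for p
    by (subst single) auto
  have ne: "y \<noteq> x" "z \<noteq> y" "z \<noteq> x"
    using xyz by auto
  have "chain_sum r [letter1, letter1, letter1] B = (\<Sum>C | C \<in> filters r B \<and> card C = 1. chain_sum r [letter1, letter1] (B - C) * block_coeff r letter1 C)"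
    by simp
  then have e: "chain_sum r [letter1, letter1, letter1] B = (\<Sum>v\<in>B. if {v} \<in> filters r B then chain_sum r [letter1, letter1] (B - {v}) else 0)"
    by (subst (asm) filters_card_1[OF B(1)]) (simp del: chain_sum.simps cong: if_cong)
  have "chain_sum r [letter1, letter2] B = (\<Sum>C | C \<in> filters r B \<and> card C = 1. chain_sum r [letter2] (B - C) * block_coeff r letter1 C)"
    by simp
  then have e12: "chain_sum r [letter1, letter2] B = (\<Sum>v\<in>B. if {v} \<in> filters r B then chain_sum r [letter2] (B - {v}) else 0)"
    by (subst (asm) filters_card_1[OF B(1)]) (simp del: chain_sum.simps cong: if_cong)
  have "chain_sum r [letter2, letter1] B = (\<Sum>C | C \<in> filters r B \<and> card C = 2. chain_sum r [letter1] (B - C) * block_coeff r letter2 C)"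
    by simp
  also have "\<dots> = (\<Sum>v\<in>B. if B - {v} \<in> filters r B then block_coeff r letter2 (B - {v}) else 0)"
  proof (subst filters_card_2[OF B], rule sum.cong[OF refl])
    fix v assume "v \<in> B"
    then have "B - (B - {v}) = {v}" by auto
    then show "(if B - {v} \<in> filters r B then chain_sum r [letter1] (B - (B - {v})) * block_coeff r letter2 (B - {v}) else 0) =
      (if B - {v} \<in> filters r B then block_coeff r letter2 (B - {v}) else 0)"
      by (simp add: s1 del: chain_sum.simps cong: if_cong)
  qed
  finally have e21: "chain_sum r [letter2, letter1] B = (\<Sum>v\<in>B. if B - {v} \<in> filters r B then block_coeff r letter2 (B - {v}) else 0)" .
  have sumB: "(\<Sum>v\<in>B. g v) = g x + g y + g z" for g :: "'a \<Rightarrow> real"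
    using xyz by (simp add: add.assoc)
  have "6 \<le> chain_sum r [letter1, letter1, letter1] B + 5 * (chain_sum r [letter1, letter2] B + chain_sum r [letter2, letter1] B)"
    unfolding e e12 e21 sumB D f s2[OF xyz(2)] s2[OF xyz(3)] s2[OF xyz(4)] pair_sum[OF xyz(2)] pair_sum[OF xyz(3)] pair_sum[OF xyz(4)]
    by (rule triple_count) (use t[of x y z] t[of x z y] t[of y x z] t[of y z x] t[of z x y] t[of z y x] as[of x y] as[of y z] as[of x z] xyz(2-) in blast)+
  then show ?thesis
    using chain_sum_triple[OF B, of r] by linarith
qed

text \<open>The bound for a single block is summed over all ways to choose the other blocks; since
  chain sums and block coefficients are nonnegative, the blocks before and after it keep the
  direction of the inequality.\<close>

lemma chain_sum_word3:
  assumes Q: "finite Q" "card Q \<le> 11" and r: "trans r" "antisym r"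
  shows "chain_sum r (u @ letter3 # w) Q \<le> 2 * (chain_sum r (u @ letter1 # letter2 # w) Q + chain_sum r (u @ letter2 # letter1 # w) Q)"
  using Q
proof (induction u arbitrary: Q)
  case Nil
  have *: "chain_sum r [a, b] B = (\<Sum>C | C \<in> filters r B \<and> card C = fst a. block_coeff r b (B - C) * block_coeff r a C)"
    if "finite B" "card B = fst a + fst b" for a b B
  proof -
    have "chain_sum r [a, b] B = (\<Sum>B' | B' \<in> filters r B \<and> card B' = fst a + fst b.
        if B' = B then (\<Sum>C | C \<in> filters r B \<and> card C = fst a. block_coeff r b (B - C) * block_coeff r a C) else 0)"
    proof (subst chain_sum_two[OF that(1)], rule sum.cong[OF refl])
      fix B' assume "B' \<in> {B'. B' \<in> filters r B \<and> card B' = fst a + fst b}"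
      then have "B' = B"
        using that filters_subset card_subset_eq[of B B'] by auto
      then show "chain_sum r [] (B - B') * (\<Sum>C | C \<in> filters r B' \<and> card C = fst a. block_coeff r b (B' - C) * block_coeff r a C) =
        (if B' = B then (\<Sum>C | C \<in> filters r B \<and> card C = fst a. block_coeff r b (B - C) * block_coeff r a C) else 0)"
        by simp
    qed
    then show ?thesis
      using that by (simp add: sum.delta)
  qed
  have "chain_sum r (letter3 # w) Q = (\<Sum>B | B \<in> filters r Q \<and> card B = 3. chain_sum r w (Q - B) * block_coeff r letter3 B)"
    by simp
  also have "\<dots> \<le> (\<Sum>B | B \<in> filters r Q \<and> card B = 3. chain_sum r w (Q - B) *
      (2 * (chain_sum r [letter1, letter2] B + chain_sum r [letter2, letter1] B)))"
  proof (rule sum_mono)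
    fix B assume "B \<in> {B. B \<in> filters r Q \<and> card B = 3}"
    then have B: "finite B" "card B = 3" "B \<subseteq> Q"
      using filters_subset[of B r Q] finite_subset[of B Q] Nil by auto
    have "0 \<le> chain_sum r w (Q - B)"
      using card_mono[of Q "Q - B"] Nil by (intro chain_sum_nonneg) auto
    then show "chain_sum r w (Q - B) * block_coeff r letter3 B \<le>
        chain_sum r w (Q - B) * (2 * (chain_sum r [letter1, letter2] B + chain_sum r [letter2, letter1] B))"
      by (intro mult_left_mono triple_bound B r)
  qed
  also have "\<dots> = 2 * (chain_sum r (letter1 # letter2 # w) Q + chain_sum r (letter2 # letter1 # w) Q)"
  proof -
    have "chain_sum r (a # b # w) Q = (\<Sum>B | B \<in> filters r Q \<and> card B = 3. chain_sum r w (Q - B) * chain_sum r [a, b] B)"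
      if "fst a + fst b = 3" for a b
    proof (subst chain_sum_two[OF Nil(1)], rule sum.cong)
      fix B assume "B \<in> {B. B \<in> filters r Q \<and> card B = 3}"
      then have "finite B" "card B = fst a + fst b"
        using filters_subset[of B r Q] finite_subset[of B Q] Nil that by auto
      then show "chain_sum r w (Q - B) * (\<Sum>C | C \<in> filters r B \<and> card C = fst a. block_coeff r b (B - C) * block_coeff r a C) =
          chain_sum r w (Q - B) * chain_sum r [a, b] B"
        by (simp only: *)
    qed (use that in simp)
    from this[of letter1 letter2] this[of letter2 letter1] show ?thesis
      by (simp add: sum.distrib[symmetric] sum_distrib_left algebra_simps del: chain_sum.simps)
  qed
  finally show ?case by simp
next
  case (Cons l u)
  have "chain_sum r ((l # u) @ letter3 # w) Q \<le> (\<Sum>B | B \<in> filters r Q \<and> card B = fst l.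
      2 * (chain_sum r (u @ letter1 # letter2 # w) (Q - B) + chain_sum r (u @ letter2 # letter1 # w) (Q - B)) * block_coeff r l B)"
    unfolding append_Cons chain_sum.simps(2)[of r l]
  proof (rule sum_mono)
    fix B assume "B \<in> {B. B \<in> filters r Q \<and> card B = fst l}"
    then have B: "finite B" "B \<subseteq> Q"
      using filters_subset[of B r Q] finite_subset[of B Q] Cons.prems by auto
    then have "card B \<le> 11" "card (Q - B) \<le> 11"
      using card_mono[of Q B] card_mono[of Q "Q - B"] Cons.prems by auto
    then show "chain_sum r (u @ letter3 # w) (Q - B) * block_coeff r l B \<le>
      2 * (chain_sum r (u @ letter1 # letter2 # w) (Q - B) + chain_sum r (u @ letter2 # letter1 # w) (Q - B)) * block_coeff r l B"
      using Cons B by (intro mult_right_mono Cons.IH block_coeff_nonneg) auto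
  qed
  also have "\<dots> = 2 * (chain_sum r ((l # u) @ letter1 # letter2 # w) Q + chain_sum r ((l # u) @ letter2 # letter1 # w) Q)"
    unfolding append_Cons chain_sum.simps(2)[of r l]
    by (simp add: sum.distrib[symmetric] sum_distrib_left algebra_simps del: chain_sum.simps)
  finally show ?case .
qed

text \<open>Removing maximal elements one after the other gives a sequence of blocks of size 1 with
  all coefficients equal to 1, and no other sequence contributes a negative amount.\<close>

lemma chain_sum_ones_pos:
  assumes "finite Q" "card Q \<le> 11" and r: "trans r" "antisym r"
  shows "0 < chain_sum r (replicate (card Q) letter1) Q"
  using assms(1,2)
proof (induction "card Q" arbitrary: Q)
  case 0
  then show ?case by simp
next
  case (Suc n)
  then have ne: "Q \<noteq> {}" by auto
  have "\<exists>m\<in>Q. \<forall>x\<in>Q. x \<noteq> m \<longrightarrow> \<not> (\<lambda>a b. (a, b) \<in> r \<and> a \<noteq> b) m x"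
    by (rule Finite_Set.bex_max_element) (use Suc ne r in \<open>auto simp: asymp_on_def transp_on_def dest: transD antisymD\<close>)
  then obtain m where m: "m \<in> Q" "\<And>x. x \<in> Q \<Longrightarrow> x \<noteq> m \<Longrightarrow> (m, x) \<notin> r"
    by auto
  then have f: "{m} \<in> filters r Q"
    by (auto simp: filters_def)
  let ?t = "\<lambda>B. chain_sum r (replicate n letter1) (Q - B) * block_coeff r letter1 B"
  have nn: "0 \<le> ?t B" if "B \<in> filters r Q" for B
  proof -
    have "finite B" "B \<subseteq> Q"
      using filters_subset[OF that] finite_subset[of B Q] Suc by auto
    then show ?thesis
      using card_mono[of Q B] card_mono[of Q "Q - B"] Suc
      by (intro mult_nonneg_nonneg chain_sum_nonneg block_coeff_nonneg) auto
  qed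
  have c: "card (Q - {m}) = n"
    using Suc m by simp
  then have "0 < chain_sum r (replicate n letter1) (Q - {m})"
    using Suc.hyps(1)[of "Q - {m}"] Suc by simp
  then have "0 < ?t {m}"
    by simp
  also have "?t {m} \<le> (\<Sum>B | B \<in> filters r Q \<and> card B = 1. ?t B)"
    by (rule member_le_sum) (use f nn Suc in auto)
  also have "\<dots> = chain_sum r (replicate (card Q) letter1) Q"
    by (simp flip: Suc.hyps(2))
  finally show ?case .
qed

section \<open>Positivity up to dimension 11\<close>

lemma poly_falling: "poly (falling k) (real j - 1) = fact k * real (j choose k)"
proof -
  have "poly (falling k) (real j - 1) = (\<Prod>i = 0..<k. real j - real i)"
    by (simp add: falling_def poly_prod lessThan_atLeast0 add_diff_eq)
  then show ?thesis
    by (simp add: binomial_gbinomial gbinomial_prod_rev)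
qed

lemma lattice_points_order_polytope:
  assumes "0 < t"
  shows "dilate (real t) (order_polytope P r) \<inter> lattice_points =
    (\<lambda>f i. if i \<in> P then real (f i) else 0) ` {f \<in> P \<rightarrow>\<^sub>E {..<Suc t}. \<forall>i\<in>P. \<forall>j\<in>P. (i, j) \<in> r \<longrightarrow> f i \<le> f j}"
    (is "?L = ?h ` ?M")
proof (intro set_eqI iffI)
  fix g assume "g \<in> ?L"
  then obtain f where f: "f \<in> order_polytope P r" and g: "g = (\<lambda>i. real t * f i)" and int: "\<And>i. g i \<in> \<int>"
    by (auto simp: dilate_def lattice_points_def)
  have bounds: "0 \<le> g i" "g i \<le> real t" if "i \<in> P" for i
    using f that by (auto simp: g order_polytope_def mult_left_le)
  have mono: "g i \<le> g j" if "i \<in> P" "j \<in> P" "(i, j) \<in> r" for i j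
    using f that by (auto simp: g order_polytope_def mult_left_mono)
  let ?f = "restrict (\<lambda>i. nat \<lfloor>g i\<rfloor>) P"
  have eq: "real (nat \<lfloor>g i\<rfloor>) = g i" if "i \<in> P" for i
  proof -
    obtain n where "g i = real_of_int n"
      using int[of i] by (elim Ints_cases)
    then show ?thesis
      using bounds(1)[OF that] by simp
  qed
  have "g i = 0" if "i \<notin> P" for i
    using f that by (simp add: g order_polytope_def)
  then have "g = ?h ?f"
    using eq by (simp add: fun_eq_iff)
  moreover have "?f i < Suc t" if "i \<in> P" for i
    using bounds[OF that] eq[OF that] that by simp
  moreover have "?f i \<le> ?f j" if "i \<in> P" "j \<in> P" "(i, j) \<in> r" for i j
    using mono[OF that] that by (simp add: nat_mono floor_mono)
  ultimately show "g \<in> ?h ` ?M"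
    by (intro image_eqI[of _ _ ?f]) (auto simp: PiE_def)
next
  fix g assume "g \<in> ?h ` ?M"
  then obtain f where g: "g = ?h f" and f: "f \<in> P \<rightarrow>\<^sub>E {..<Suc t}"
    and mono: "\<forall>i\<in>P. \<forall>j\<in>P. (i, j) \<in> r \<longrightarrow> f i \<le> f j"
    by auto
  have le: "f i \<le> t" if "i \<in> P" for i
    using f that by (auto simp: PiE_def Pi_def less_Suc_eq_le)
  have "(\<lambda>i. ?h f i / real t) \<in> order_polytope P r"
    using le mono assms by (auto simp: order_polytope_def divide_right_mono)
  moreover have "g = (\<lambda>i. real t * (?h f i / real t))"
    using assms by (auto simp: g)
  ultimately have "g \<in> dilate (real t) (order_polytope P r)"
    unfolding dilate_def by (rule rev_image_eqI[where f = "\<lambda>f i. real t * f i"])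
  then show "g \<in> ?L"
    by (auto simp: g lattice_points_def)
qed

text \<open>The argument is \<open>j - 1\<close> because the dilate by \<open>t\<close> corresponds
  to maps into \<open>t + 1\<close> values.\<close>

lemma ehrhart_poly_order_polytope:
  assumes p: "\<And>j. poly p (real j - 1) = real (mono_count r P j)"
  shows "ehrhart_poly (order_polytope P r) = p"
proof (rule ehrhart_poly_eqI, unfold is_ehrhart_poly_def, intro allI impI)
  fix t :: nat assume t: "0 < t"
  have "inj_on (\<lambda>f i. if i \<in> P then real (f i) else 0)
      {f \<in> P \<rightarrow>\<^sub>E {..<Suc t}. \<forall>i\<in>P. \<forall>j\<in>P. (i, j) \<in> r \<longrightarrow> f i \<le> f j}"
  proof (rule inj_onI)
    fix f g :: "'a \<Rightarrow> nat"
    assume f: "f \<in> {f \<in> P \<rightarrow>\<^sub>E {..<Suc t}. \<forall>i\<in>P. \<forall>j\<in>P. (i, j) \<in> r \<longrightarrow> f i \<le> f j}"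
      and g: "g \<in> {f \<in> P \<rightarrow>\<^sub>E {..<Suc t}. \<forall>i\<in>P. \<forall>j\<in>P. (i, j) \<in> r \<longrightarrow> f i \<le> f j}"
      and eq: "(\<lambda>i. if i \<in> P then real (f i) else 0) = (\<lambda>i. if i \<in> P then real (g i) else 0)"
    show "f = g"
    proof (rule PiE_ext)
      show "f \<in> P \<rightarrow>\<^sub>E {..<Suc t}" "g \<in> P \<rightarrow>\<^sub>E {..<Suc t}"
        using f g by auto
      show "f i = g i" if "i \<in> P" for i
        using fun_cong[OF eq, of i] that by simp
    qed
  qed
  then have "card (dilate (real t) (order_polytope P r) \<inter> lattice_points) = mono_count r P (Suc t)"
    unfolding lattice_points_order_polytope[OF t] mono_count_def by (rule card_image)
  then show "poly p (real t) = real (card (dilate (real t) (order_polytope P r) \<inter> lattice_points))"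
    using p[of "Suc t"] by simp
qed

text \<open>Each coefficient combines those of the word polynomials with nonnegative factors, and
  the word with all blocks of size 1 gives a positive term. A negative term can only come from
  \<open>word3\<close> with \<open>k = 1\<close>, where \<open>word12\<close> and
  \<open>word21\<close> compensate it.\<close>

lemma ehrhart_positive_le_11:
  assumes P: "finite P" "card P \<le> 11" and r: "trans r" "antisym r"
  shows "ehrhart_positive (order_polytope P r)"
proof -
  let ?n = "card P"
  define p where "p = (\<Sum>w\<in>words ?n. smult (chain_sum r w P) (word_poly w))"
  have "poly p (real j - 1) = real (mono_count r P j)" for j
    unfolding mono_count_words[OF P] by (simp add: p_def word_poly_def poly_sum poly_falling mult.commute)
  then have p: "ehrhart_poly (order_polytope P r) = p"
    by (rule ehrhart_poly_order_polytope)
  have coeff: "coeff p k = (\<Sum>w\<in>words ?n. chain_sum r w P * coeff (word_poly w) k)" for k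
    by (simp add: p_def coeff_sum)
  have nonneg: "0 \<le> chain_sum r w P" for w
    by (rule chain_sum_nonneg[OF P])
  have "coeff p k = 0" if "?n < k" for k
    unfolding coeff
  proof (rule sum.neutral, rule ballI)
    fix w assume "w \<in> words ?n"
    then have "length w < k"
      using length_words[of w ?n] that by simp
    then show "chain_sum r w P * coeff (word_poly w) k = 0"
      by (simp add: coeff_word_poly_beyond)
  qed
  then have "degree p \<le> ?n"
    by (intro degree_le) auto
  moreover have "0 < coeff p k" if k: "k \<le> ?n" for k
  proof -
    let ?ones = "replicate ?n letter1"
    let ?f = "\<lambda>w. chain_sum r w P * coeff (word_poly w) k"
    have ones: "?ones \<in> words ?n"
      by (auto simp: words_def sum_list_replicate set_replicate_conv_if)
    have pos: "0 < ?f ?ones"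
      using chain_sum_ones_pos[OF P r] word_poly_ones_pos[OF P(2) k] by simp
    show ?thesis
    proof (cases "word3 \<in> words ?n \<and> k = 1")
      case False
      have "0 \<le> ?f w" if "w \<in> words ?n" for w
        using word_poly_nonneg[OF that P(2), of k] False that nonneg by auto
      then have "?f ?ones \<le> coeff p k"
        unfolding coeff by (intro member_le_sum ones) auto
      then show ?thesis
        using pos by simp
    next
      case True
      then have n: "?n = 11"
        using size_words(1) by (simp add: words_def size_word_def)
      define E where "E = {?ones, word12, word21, word3}"
      have E: "E \<subseteq> words ?n"
        unfolding E_def n by (auto simp: words_def sum_list_replicate set_replicate_conv_if)
      have distinct: "?ones \<noteq> word12" "?ones \<noteq> word21" "?ones \<noteq> word3" "word12 \<noteq> word21" "word12 \<noteq> word3" "word21 \<noteq> word3"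
        unfolding n by (simp_all add: numeral_eq_Suc)
      have "0 \<le> sum ?f (words ?n - E)"
      proof (rule sum_nonneg)
        fix w assume "w \<in> words ?n - E"
        then have "0 \<le> coeff (word_poly w) k"
          using word_poly_nonneg[of w ?n k] P(2) by (auto simp: E_def)
        then show "0 \<le> ?f w"
          using nonneg by simp
      qed
      moreover have "coeff p k = sum ?f (words ?n - E) + sum ?f E"
        unfolding coeff by (rule sum.subset_diff[OF E]) simp
      moreover have "sum ?f E = ?f ?ones + (?f word12 + (?f word21 + ?f word3))"
        unfolding E_def using distinct by simp
      moreover have "0 \<le> ?f word12 + (?f word21 + ?f word3)"
      proof -
        have c: "k = 1"
          using True by simp
        \<comment> \<open>Over the common denominator \<open>11! * 9!\<close> the linear
          coefficients of \<open>word12\<close> and \<open>word21\<close> have numerator 39916800,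
          which exceeds twice 17539200; the factor 2 is the one of
          \<open>chain_sum_word3\<close>.\<close>
        have "(fact 11 :: real) = 11 * (10 * fact 9)" "(fact 10 :: real) = 10 * fact 9"
          by (simp_all add: fact_numeral)
        then have "?f word12 + (?f word21 + ?f word3) =
            (39916800 * (chain_sum r word12 P + chain_sum r word21 P) - 17539200 * chain_sum r word3 P) / (fact 11 * fact 9)"
          unfolding c word_poly_linear by (simp add: field_simps)
        moreover have "17539200 * x \<le> 39916800 * (y + z)" if "x \<le> 2 * (y + z)" "0 \<le> y" "0 \<le> z" for x y z :: real
        proof -
          have "17539200 * x \<le> 17539200 * (2 * (y + z))"
            using that(1) by (rule mult_left_mono) simp
          also have "\<dots> = 35078400 * (y + z)"
            by simp
          also have "\<dots> \<le> 39916800 * (y + z)"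
            using that(2,3) by (intro mult_right_mono) auto
          finally show ?thesis .
        qed
        note this[OF chain_sum_word3[OF P r, of "replicate 4 letter1" "replicate 4 letter1"] nonneg[of word12] nonneg[of word21]]
        ultimately show ?thesis
          by (simp del: fact_numeral)
      qed
      ultimately show ?thesis
        using pos by linarith
    qed
  qed
  ultimately show ?thesis
    by (simp add: ehrhart_positive_def p)
qed

section \<open>Ordinal sums of two antichains\<close>

text \<open>By \<open>mono_count_Suc\<close>, passing from \<open>j\<close> to \<open>j + 1\<close>
  adds the counts for \<open>Q - B\<close> with nonempty \<open>B\<close>; summing these differences
  raises the lower index of each binomial by one. This provides the Ehrhart polynomial in every
  dimension.\<close>

lemma mono_count_newton:
  assumes "finite Q" "card Q \<le> n"
  shows "\<exists>c. \<forall>j. real (mono_count r Q j) = (\<Sum>k\<le>n. c k * real (j choose k))"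
  using assms
proof (induction n arbitrary: Q)
  case 0
  then show ?case
    by (intro exI[of _ "\<lambda>_. 1"]) simp
next
  case (Suc n)
  show ?case
  proof (cases "Q = {}")
    case True
    have "(\<Sum>k\<le>Suc n. of_bool (k = 0) * real (j choose k)) = 1" for j
      by (simp add: sum.atMost_Suc_shift del: sum.atMost_Suc)
    then show ?thesis
      unfolding True by (intro exI[of _ "\<lambda>k. of_bool (k = 0)"]) (simp del: sum.atMost_Suc)
  next
    case False
    let ?F = "filters r Q - {{}}"
    have "\<forall>B\<in>?F. \<exists>c. \<forall>j. real (mono_count r (Q - B) j) = (\<Sum>k\<le>n. c k * real (j choose k))"
    proof
      fix B assume B: "B \<in> ?F"
      then have "Q - B \<subset> Q"
        using filters_subset[of B r Q] by auto
      then have "card (Q - B) < card Q"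
        by (rule psubset_card_mono[OF Suc.prems(1)])
      then show "\<exists>c. \<forall>j. real (mono_count r (Q - B) j) = (\<Sum>k\<le>n. c k * real (j choose k))"
        using Suc.prems by (intro Suc.IH) auto
    qed
    then obtain C where C: "\<And>B j. B \<in> ?F \<Longrightarrow> real (mono_count r (Q - B) j) = (\<Sum>k\<le>n. C B k * real (j choose k))"
      by (auto dest!: bchoice)
    define c where "c k = (case k of 0 \<Rightarrow> 0 | Suc k \<Rightarrow> \<Sum>B\<in>?F. C B k)" for k
    have "real (mono_count r Q j) = (\<Sum>k\<le>Suc n. c k * real (j choose k))" for j
    proof (induction j)
      case 0
      show ?case
        using False by (simp add: mono_count_0 c_def sum.atMost_Suc_shift del: sum.atMost_Suc)
    next
      case (Suc j)
      have "real (mono_count r Q (Suc j)) = real (mono_count r Q j) + (\<Sum>B\<in>?F. real (mono_count r (Q - B) j))"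
        using \<open>finite Q\<close> by (simp add: mono_count_Suc sum.remove[of _ "{}"])
      also have "(\<Sum>B\<in>?F. real (mono_count r (Q - B) j)) = (\<Sum>B\<in>?F. \<Sum>k\<le>n. C B k * real (j choose k))"
        by (rule sum.cong[OF refl]) (rule C)
      also have "\<dots> = (\<Sum>k\<le>n. c (Suc k) * real (j choose k))"
        by (subst sum.swap) (simp add: c_def sum_distrib_right)
      finally show ?case
        unfolding Suc.IH
        by (simp add: sum.atMost_Suc_shift c_def ring_distribs sum.distrib del: sum.atMost_Suc)
    qed
    then show ?thesis by blast
  qed
qed

section \<open>Linear coefficients from iterated differences\<close>

fun differences :: "int \<Rightarrow> int list \<Rightarrow> int list" where
  "differences x [] = []"
| "differences x (y # ys) = (y - x) # differences y ys"

text \<open>The Newton coefficients of a sequence are its iterated differences at 0; here they are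
  paired with the weights as they arise.\<close>

fun newton_sum :: "int list \<Rightarrow> int list \<Rightarrow> int" where
  "newton_sum (w # ws) (x # xs) = w * x + newton_sum ws (differences x xs)"
| "newton_sum _ _ = 0"

lemma differences_eq:
  "differences (f i) (map f [Suc i..<m]) = map (\<lambda>j. f (Suc j) - f j) [i..<m - 1]"
proof (induction "m - i" arbitrary: i)
  case (Suc k)
  show ?case
  proof (cases "Suc i < m")
    case True
    then show ?thesis
      using Suc.hyps(1)[of "Suc i"] Suc.hyps(2) by (simp add: upt_conv_Cons)
  qed simp
qed simp

text \<open>The first value of the sequence is \<open>c 0\<close>, and by Pascal's rule the sequence
  of differences has the shifted coefficients \<open>c (Suc k)\<close>.\<close>

lemma newton_sum_eq:
  assumes "\<And>j. j < m \<Longrightarrow> real_of_int (f j) = (\<Sum>k\<le>n. c k * real (j choose k))" "\<And>k. n < k \<Longrightarrow> c k = 0" "length ws \<le> m"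
  shows "real_of_int (newton_sum ws (map f [0..<m])) = (\<Sum>k<length ws. real_of_int (ws ! k) * c k)"
  using assms
proof (induction ws arbitrary: m f c)
  case (Cons w ws)
  obtain m' where m: "m = Suc m'"
    using Cons.prems(3) by (cases m) auto
  have f0: "real_of_int (f 0) = c 0"
  proof -
    have "(\<Sum>k\<le>n. c k * real (0 choose k)) = (\<Sum>k\<in>{0}. c k * real (0 choose k))"
      by (rule sum.mono_neutral_right) (auto simp: binomial_eq_0_iff)
    then show ?thesis
      using Cons.prems(1)[of 0] m by simp
  qed
  have "map f [0..<m] = f 0 # map f [Suc 0..<m]"
    by (simp add: m upt_conv_Cons del: upt_Suc)
  then have "newton_sum (w # ws) (map f [0..<m]) = w * f 0 + newton_sum ws (map (\<lambda>j. f (Suc j) - f j) [0..<m'])"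
    using differences_eq[of f 0 m] m by simp
  moreover have "real_of_int (newton_sum ws (map (\<lambda>j. f (Suc j) - f j) [0..<m'])) =
      (\<Sum>k<length ws. real_of_int (ws ! k) * c (Suc k))"
  proof (rule Cons.IH)
    fix j assume j: "j < m'"
    have "(\<Sum>k\<le>n. c k * real (Suc j choose k)) = (\<Sum>k\<le>Suc n. c k * real (Suc j choose k))"
      using Cons.prems(2)[of "Suc n"] by simp
    also have "\<dots> = (\<Sum>k\<le>Suc n. c k * real (j choose k)) + (\<Sum>k\<le>n. c (Suc k) * real (j choose k))"
      by (simp add: sum.atMost_Suc_shift ring_distribs sum.distrib del: sum.atMost_Suc)
    also have "(\<Sum>k\<le>Suc n. c k * real (j choose k)) = (\<Sum>k\<le>n. c k * real (j choose k))"
      using Cons.prems(2)[of "Suc n"] by simp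
    finally show "real_of_int (f (Suc j) - f j) = (\<Sum>k\<le>n. c (Suc k) * real (j choose k))"
      using Cons.prems(1)[of j] Cons.prems(1)[of "Suc j"] j m by simp
  qed (use Cons.prems m in auto)
  ultimately show ?case
    using f0 by (simp add: sum.lessThan_Suc_shift del: sum.lessThan_Suc)
qed simp

text \<open>Since \<open>falling (Suc (Suc k))\<close> is
  \<open>(t + 1) * t * (t - 1) * ... * (t - k)\<close>, its linear coefficient is the value at 0 of
  the product of the factors other than \<open>t\<close>.\<close>

lemma coeff_falling_1:
  "coeff (falling 0) 1 = 0" "coeff (falling 1) 1 = 1"
  "coeff (falling (Suc (Suc k))) 1 = (- 1) ^ k * fact k"
proof -
  have Suc: "falling (Suc k) = falling k * [:1 - real k, 1:]" for k
    by (simp add: falling_def)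
  have 0: "coeff (falling (Suc (Suc k))) 0 = 0" for k
    by (induction k) (simp_all add: Suc[of "Suc _"] Suc[of 0] coeff_mult)
  show "coeff (falling 0) 1 = 0" "coeff (falling 1) 1 = 1"
    by (simp_all add: falling_def)
  show "coeff (falling (Suc (Suc k))) 1 = (- 1) ^ k * fact k"
  proof (induction k)
    case 0
    then show ?case
      by (simp add: falling_def numeral_2_eq_2 lessThan_Suc)
  next
    case (Suc k)
    have "coeff (falling (Suc (Suc (Suc k)))) 1 = (1 - real (Suc (Suc k))) * coeff (falling (Suc (Suc k))) 1 + coeff (falling (Suc (Suc k))) 0"
      unfolding \<open>\<And>k. falling (Suc k) = falling k * [:1 - real k, 1:]\<close>[of "Suc (Suc k)"] by (simp add: coeff_mult algebra_simps)
    then show ?case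
      unfolding Suc 0 by (simp add: algebra_simps)
  qed
qed

section \<open>Counterexamples in dimensions 14 to 21\<close>

definition ordinal_sum :: "nat \<Rightarrow> nat \<Rightarrow> (nat \<times> nat) set" where
  "ordinal_sum a b = {(x, y). x < a + b \<and> y < a + b \<and> (x = y \<or> x < a \<and> a \<le> y)}"

lemma partial_order_ordinal_sum: "partial_order_on {..<a + b} (ordinal_sum a b)"
  by (auto simp: partial_order_on_def preorder_on_def refl_on_def trans_def antisym_def ordinal_sum_def)

lemma prod_ordinal_sum: "(\<Prod>i<a + b. if i < a then x else y) = (x :: nat) ^ a * y ^ b"
  by (induction b) (auto simp: ac_simps)

text \<open>The maps are sorted by their largest value \<open>v\<close> on the lower antichain. The
  difference of powers counts the choices there, and each element of the upper antichain takes any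
  value from \<open>v\<close> to \<open>j - 1\<close>.\<close>

lemma mono_count_ordinal_sum:
  assumes "0 < a"
  shows "int (mono_count (ordinal_sum a b) {..<a + b} j) = (\<Sum>v<j. ((int v + 1) ^ a - int v ^ a) * (int j - int v) ^ b)"
proof -
  let ?S = "\<lambda>U v. PiE {..<a + b} (\<lambda>i. if i < a then U else {v..<j})"
  \<comment> \<open>Removing the maps that stay below \<open>v\<close> on the lower antichain leaves
    those whose maximum there is exactly \<open>v\<close>.\<close>
  let ?X = "\<lambda>v. ?S {..v} v - ?S {..<v} v"
  have card: "card (?S U v) = card U ^ a * (j - v) ^ b" for U v
    by (simp add: card_PiE if_distrib[of card] prod_ordinal_sum cong: if_cong)
  have fin: "finite (?S U v)" if "finite U" for U v
    using that by (intro finite_PiE) auto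
  have mem: "f \<in> ?X v \<longleftrightarrow> f \<in> extensional {..<a + b} \<and> (\<forall>i<a. f i \<le> v) \<and> (\<exists>i<a. f i = v) \<and>
      (\<forall>i. a \<le> i \<and> i < a + b \<longrightarrow> v \<le> f i \<and> f i < j)" for f v
  proof -
    have S: "f \<in> ?S U v \<longleftrightarrow> f \<in> extensional {..<a + b} \<and> (\<forall>i<a. f i \<in> U) \<and>
        (\<forall>i. a \<le> i \<and> i < a + b \<longrightarrow> v \<le> f i \<and> f i < j)" for U
    proof -
      have "(\<forall>i<a + b. f i \<in> (if i < a then U else {v..<j})) \<longleftrightarrow>
          (\<forall>i<a. f i \<in> U) \<and> (\<forall>i. a \<le> i \<and> i < a + b \<longrightarrow> f i \<in> {v..<j})"
        by (metis not_less trans_less_add1)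
      then show ?thesis
        unfolding PiE_iff Ball_def lessThan_iff atLeastLessThan_iff by blast
    qed
    have "(\<not> (\<forall>i<a. f i < v)) = (\<exists>i<a. f i = v)" if "\<forall>i<a. f i \<le> v"
      using that by (metis le_neq_implies_less less_irrefl)
    then show ?thesis
      unfolding Diff_iff S atMost_iff lessThan_iff by blast
  qed
  have "{f \<in> {..<a + b} \<rightarrow>\<^sub>E {..<j}. \<forall>i\<in>{..<a + b}. \<forall>k\<in>{..<a + b}. (i, k) \<in> ordinal_sum a b \<longrightarrow> f i \<le> f k} = (\<Union>v<j. ?X v)"
    (is "?M = _")
  proof (intro set_eqI iffI)
    fix f assume f: "f \<in> ?M"
    let ?v = "Max (f ` {..<a})"
    have "?v \<in> f ` {..<a}"
      using assms by (intro Max_in) auto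
    then obtain i where i: "i < a" "f i = ?v" by auto
    have "f k \<le> ?v" if "k < a" for k
      using that by (intro Max_ge) auto
    moreover have "?v \<le> f k" if "a \<le> k" "k < a + b" for k
    proof -
      have "(i, k) \<in> ordinal_sum a b"
        using that i(1) by (simp add: ordinal_sum_def)
      then have "f i \<le> f k"
        using f that i(1) by auto
      then show ?thesis
        by (simp add: i(2))
    qed
    ultimately have "f \<in> ?X ?v"
      unfolding mem using f i by (auto simp: PiE_iff)
    moreover have "f i < j"
      using f i(1) by (auto simp: PiE_iff)
    ultimately show "f \<in> (\<Union>v<j. ?X v)"
      using i(2) by auto
  next
    fix f assume "f \<in> (\<Union>v<j. ?X v)"
    then obtain v where v: "v < j" "f \<in> ?X v" by blast
    then have "f i < j" if "i < a + b" for i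
      using that unfolding mem by (cases "i < a") (auto intro: le_less_trans)
    moreover have "f i \<le> f k" if "(i, k) \<in> ordinal_sum a b" for i k
      using v(2) that unfolding mem ordinal_sum_def by (auto intro: order_trans)
    ultimately show "f \<in> ?M"
      using v(2) unfolding mem by (auto simp: PiE_iff)
  qed
  then have "mono_count (ordinal_sum a b) {..<a + b} j = card (\<Union>v<j. ?X v)"
    by (simp only: mono_count_def)
  also have "\<dots> = (\<Sum>v<j. card (?X v))"
  proof (rule card_UN_disjoint)
    show "\<forall>v\<in>{..<j}. \<forall>w\<in>{..<j}. v \<noteq> w \<longrightarrow> ?X v \<inter> ?X w = {}"
    proof (intro ballI impI)
      fix v w :: nat assume "v \<noteq> w"
      have False if "f \<in> ?X v" "f \<in> ?X w" for f
        using that \<open>v \<noteq> w\<close> unfolding mem by (metis le_antisym)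
      then show "?X v \<inter> ?X w = {}" by blast
    qed
  qed (use fin in auto)
  finally have "mono_count (ordinal_sum a b) {..<a + b} j = (\<Sum>v<j. card (?X v))" .
  moreover have "int (card (?X v)) = ((int v + 1) ^ a - int v ^ a) * (int j - int v) ^ b" if "v < j" for v
  proof -
    have sub: "?S {..<v} v \<subseteq> ?S {..v} v"
      by (rule PiE_mono) auto
    have "card (?X v) = card (?S {..v} v) - card (?S {..<v} v)"
      using fin sub by (intro card_Diff_subset) auto
    moreover have "card (?S {..<v} v) \<le> card (?S {..v} v)"
      using fin sub by (intro card_mono) auto
    ultimately have "int (card (?X v)) = int (card (?S {..v} v)) - int (card (?S {..<v} v))"
      by simp
    then show ?thesis
      unfolding card using that by (simp add: of_nat_diff algebra_simps)
  qed
  ultimately show ?thesis by simp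
qed

text \<open>
  The linear coefficient of the Ehrhart polynomial is a combination of its Newton coefficients with
  weights 1/(k (k - 1)) up to sign; 232792560 is a common denominator of these weights.
\<close>

definition weight :: "nat \<Rightarrow> int" where
  "weight k = (if k = 0 then 0 else if k = 1 then 232792560
     else (if even k then 1 else - 1) * (232792560 div (int k * (int k - 1))))"

definition ordinal_sum_count :: "nat \<Rightarrow> nat \<Rightarrow> nat \<Rightarrow> int" where
  "ordinal_sum_count a b j = (\<Sum>v\<leftarrow>[0..<j]. ((int v + 1) ^ a - int v ^ a) * (int j - int v) ^ b)"

definition linear_coeff :: "nat \<Rightarrow> nat \<Rightarrow> int" where
  "linear_coeff a b = newton_sum (map weight [0..<Suc (a + b)]) (map (ordinal_sum_count a b) [0..<Suc (a + b)])"

text \<open>The dimensions \<open>a + b\<close> are 14 to 21 in this order; the last pair has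
  \<open>b = 1\<close> and starts the induction for larger dimensions.\<close>

lemma linear_coeff_values:
  "linear_coeff 7 7 < 0" "linear_coeff 7 8 < 0" "linear_coeff 8 8 < 0" "linear_coeff 8 9 < 0"
  "linear_coeff 2 16 < 0" "linear_coeff 2 17 < 0" "linear_coeff 3 17 < 0" "linear_coeff 20 1 < 0"
  by code_simp+

lemma newton_ehrhart_poly:
  assumes c: "\<And>j. real (mono_count r P j) = (\<Sum>k\<le>n. c k * real (j choose k))"
  shows "ehrhart_poly (order_polytope P r) = (\<Sum>k\<le>n. smult (c k / fact k) (falling k))"
  by (rule ehrhart_poly_order_polytope) (simp add: c poly_sum poly_falling)

lemma poly_ehrhart_order_polytope:
  assumes "finite P"
  shows "poly (ehrhart_poly (order_polytope P r)) (real j - 1) = real (mono_count r P j)"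
proof -
  obtain c where c: "\<And>j. real (mono_count r P j) = (\<Sum>k\<le>card P. c k * real (j choose k))"
    using mono_count_newton[OF assms order.refl, of r] by blast
  show ?thesis
    unfolding newton_ehrhart_poly[OF c] by (simp add: c poly_sum poly_falling)
qed

text \<open>The number 232792560 is the least common multiple of 1, ..., 21, and consecutive
  integers are coprime. Hence the integer divisions in \<open>weight\<close> are exact.\<close>

lemma weight_denominators: "list_all (\<lambda>i. (int i + 2) * (int i + 1) dvd 232792560) [0..<20]"
  by code_simp

lemma weight_eq:
  assumes "k \<le> 21"
  shows "real_of_int (weight k) = 232792560 * (coeff (falling k) 1 / fact k)"
proof -
  consider "k = 0" | "k = 1" | i where "k = Suc (Suc i)"
    by (cases k; cases "k - 1") auto
  then show ?thesis
  proof cases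
    case (3 i)
    then have "(int i + 2) * (int i + 1) dvd 232792560"
      using weight_denominators assms by (simp add: list_all_iff del: upt_conv_Cons upt_rec_numeral)
    then have "real_of_int (232792560 div ((int i + 2) * (int i + 1))) = 232792560 / ((real i + 2) * (real i + 1))"
      by (simp add: real_of_int_div del: of_int_mult) simp
    moreover have "(fact (Suc (Suc i)) :: real) = (real i + 2) * (real i + 1) * fact i"
      by (simp add: algebra_simps)
    moreover have "weight k = (- 1) ^ i * (232792560 div ((int i + 2) * (int i + 1)))"
      unfolding 3 weight_def by (simp add: add.commute)
    ultimately show ?thesis
      unfolding 3 coeff_falling_1 by simp
  qed (simp_all add: weight_def coeff_falling_1 coeff_falling_1(1,2)[simplified])
qed

lemma linear_coeff_ordinal_sum:
  assumes "0 < a" "a + b \<le> 21"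
  shows "232792560 * coeff (ehrhart_poly (order_polytope {..<a + b} (ordinal_sum a b))) 1 = real_of_int (linear_coeff a b)"
proof -
  let ?n = "a + b"
  obtain c0 where c0: "\<And>j. real (mono_count (ordinal_sum a b) {..<?n} j) = (\<Sum>k\<le>?n. c0 k * real (j choose k))"
    using mono_count_newton[of "{..<?n}" ?n "ordinal_sum a b"] by auto
  \<comment> \<open>The coefficients are continued by 0, as \<open>newton_sum_eq\<close> asks for
    beyond the degree.\<close>
  define c where "c k = (if k \<le> ?n then c0 k else 0)" for k
  have c: "real (mono_count (ordinal_sum a b) {..<?n} j) = (\<Sum>k\<le>?n. c k * real (j choose k))" for j
    unfolding c0 by (intro sum.cong) (auto simp: c_def)
  have count: "ordinal_sum_count a b j = int (mono_count (ordinal_sum a b) {..<?n} j)" for j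
    unfolding mono_count_ordinal_sum[OF assms(1)] ordinal_sum_count_def
    by (simp add: sum_list_distinct_conv_sum_set atLeast0LessThan)
  have "real_of_int (linear_coeff a b) = (\<Sum>k<length (map weight [0..<Suc ?n]). real_of_int (map weight [0..<Suc ?n] ! k) * c k)"
    unfolding linear_coeff_def
    by (rule newton_sum_eq[where n = ?n]) (auto simp: count c c_def simp del: upt_Suc)
  also have "\<dots> = (\<Sum>k\<le>?n. real_of_int (weight k) * c k)"
    by (rule sum.cong) (auto simp: less_Suc_eq_le simp del: upt_Suc)
  also have "\<dots> = (\<Sum>k\<le>?n. 232792560 * (coeff (falling k) 1 / fact k) * c k)"
    using assms(2) by (intro sum.cong refl) (simp add: weight_eq)
  also have "\<dots> = 232792560 * coeff (ehrhart_poly (order_polytope {..<?n} (ordinal_sum a b))) 1"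
    unfolding newton_ehrhart_poly[OF c] by (simp add: coeff_sum sum_distrib_left sum_distrib_right ac_simps)
  finally show ?thesis by simp
qed

section \<open>An antichain with one element on top: all larger dimensions\<close>

lemma poly_eqI_nat:
  fixes p q :: "real poly"
  assumes "\<And>j::nat. poly p (real j - 1) = poly q (real j - 1)"
  shows "p = q"
proof (rule ccontr)
  assume "p \<noteq> q"
  then have "finite {x. poly (p - q) x = 0}"
    by (intro poly_roots_finite) simp
  moreover have "range (\<lambda>j. real j - 1) \<subseteq> {x. poly (p - q) x = 0}"
    using assms by auto
  ultimately have "finite (range (\<lambda>j::nat. real j - 1))"
    by (rule finite_subset[rotated])
  moreover have "inj (\<lambda>j::nat. real j - 1)"
    by (auto simp: inj_def)
  ultimately show False
    using finite_imageD infinite_UNIV_nat by blast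
qed

definition cone_poly :: "nat \<Rightarrow> real poly" where
  "cone_poly k = ehrhart_poly (order_polytope {..<k + 1} (ordinal_sum k 1))"

text \<open>The difference counts the maps that send the top element to the largest value and are
  free on the antichain; in the formula, the sum of \<open>(v + 1)^k - v^k\<close> telescopes. The
  base is \<open>t + 2\<close> because \<open>j + 1\<close> is \<open>t + 2\<close> for
  \<open>t = j - 1\<close>.\<close>

lemma cone_poly_difference:
  assumes "0 < k"
  shows "pcompose (cone_poly k) [:1, 1:] - cone_poly k = [:2, 1:] ^ k"
proof (rule poly_eqI_nat)
  fix j :: nat
  let ?c = "\<lambda>j. mono_count (ordinal_sum k 1) {..<k + 1} j"
  have tel: "(\<Sum>v<j. (int v + 1) ^ k - int v ^ k) = int j ^ k" for j
    using assms by (induction j) (simp_all add: add.commute)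
  have "int (?c (Suc j)) = (\<Sum>v<Suc j. ((int v + 1) ^ k - int v ^ k) * (int j - int v) + ((int v + 1) ^ k - int v ^ k))"
    unfolding mono_count_ordinal_sum[OF assms] by (intro sum.cong) (simp_all add: algebra_simps)
  also have "\<dots> = int (?c j) + int (Suc j) ^ k"
    unfolding mono_count_ordinal_sum[OF assms] sum.distrib tel by simp
  finally have "real (?c (Suc j)) - real (?c j) = (real j + 1) ^ k"
    using of_nat_eq_iff[where 'a = int, of "?c (Suc j)" "?c j + Suc j ^ k"]
    by (simp add: add.commute del: of_nat_eq_iff of_nat_Suc) (metis of_nat_Suc of_nat_add of_nat_power add_diff_cancel_left' add.commute)
  moreover have "poly (cone_poly k) (real j) = real (?c (Suc j))" "poly (cone_poly k) (real j - 1) = real (?c j)"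
    using poly_ehrhart_order_polytope[of "{..<k + 1}" "ordinal_sum k 1" "Suc j"]
      poly_ehrhart_order_polytope[of "{..<k + 1}" "ordinal_sum k 1" j] by (simp_all add: cone_poly_def)
  ultimately show "poly (pcompose (cone_poly k) [:1, 1:] - cone_poly k) (real j - 1) = poly ([:2, 1:] ^ k) (real j - 1)"
    by (simp add: poly_pcompose add.commute)
qed

text \<open>
  The derivative of the sum of (s + 1)^(k + 1) over s \<le> t is k + 1 times the sum of (s + 1)^k
  up to a 1-periodic, hence constant, polynomial.
\<close>

lemma coeff_cone_poly_Suc:
  assumes "0 < k" "0 < i"
  shows "real (Suc i) * coeff (cone_poly (Suc k)) (Suc i) = real (Suc k) * coeff (cone_poly k) i"
proof -
  define D where "D = pderiv (cone_poly (Suc k)) - smult (real (Suc k)) (cone_poly k)"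
  have 1: "pderiv [:1, 1 :: real:] = 1" "pderiv [:2, 1 :: real:] = 1"
    by (simp_all add: pderiv_pCons one_pCons)
  have "pcompose (pderiv (cone_poly (Suc k))) [:1, 1:] - pderiv (cone_poly (Suc k)) =
      pderiv (pcompose (cone_poly (Suc k)) [:1, 1:] - cone_poly (Suc k))"
    by (simp add: pderiv_diff pderiv_pcompose 1)
  also have "\<dots> = smult (real (Suc k)) (pcompose (cone_poly k) [:1, 1:] - cone_poly k)"
    unfolding cone_poly_difference[OF assms(1)] cone_poly_difference[OF zero_less_Suc] pderiv_power_Suc 1 by simp
  finally have "pcompose D [:1, 1:] = D"
    by (simp add: D_def pcompose_diff pcompose_smult smult_diff_right algebra_simps)
  then have shift: "poly D (x + 1) = poly D x" for x
    by (metis (no_types, lifting) poly_pcompose poly_pCons poly_0 mult_zero_right add_0_right mult.right_neutral add.commute)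
  have "D = [:poly D (- 1):]"
  proof (rule poly_eqI_nat)
    fix j :: nat
    show "poly D (real j - 1) = poly [:poly D (- 1):] (real j - 1)"
      using shift[of "real _ - 1"] by (induction j) (auto simp: algebra_simps)
  qed
  then have "coeff D i = 0"
    using assms(2) by (metis coeff_pCons_Suc coeff_0 gr0_conv_Suc)
  then show ?thesis
    by (simp add: D_def coeff_pderiv)
qed

text \<open>A negative coefficient is nonzero, so its index is at most the degree.\<close>

lemma not_ehrhart_positive:
  assumes "coeff (ehrhart_poly S) k < 0"
  shows "\<not> ehrhart_positive S"
proof -
  have "k \<le> degree (ehrhart_poly S)"
    using assms by (intro le_degree) auto
  then show ?thesis
    using assms by (force simp: ehrhart_positive_def)
qed

lemma linear_coeff_neg:
  assumes "0 < a" "a + b \<le> 21" "linear_coeff a b < 0"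
  shows "coeff (ehrhart_poly (order_polytope {..<a + b} (ordinal_sum a b))) 1 < 0"
  using linear_coeff_ordinal_sum[OF assms(1,2)] assms(3) by linarith

text \<open>The start is the linear coefficient in dimension 21; each application of
  \<open>coeff_cone_poly_Suc\<close> raises the dimension and the index by one and keeps the
  sign.\<close>

lemma coeff_cone_poly_neg: "coeff (cone_poly (20 + m)) (Suc m) < 0"
proof (induction m)
  case 0
  show ?case
    using linear_coeff_neg[OF _ _ linear_coeff_values(8)] by (simp add: cone_poly_def)
next
  case (Suc m)
  have "real (Suc (Suc m)) * coeff (cone_poly (Suc (20 + m))) (Suc (Suc m)) = real (Suc (20 + m)) * coeff (cone_poly (20 + m)) (Suc m)"
    by (rule coeff_cone_poly_Suc) auto
  also have "\<dots> < 0"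
    using Suc.IH by (intro mult_pos_neg) auto
  finally show ?case
    by (simp add: mult_less_0_iff)
qed

lemma not_ehrhart_positive_exists:
  assumes "14 \<le> d"
  shows "\<exists>a b. a + b = d \<and> \<not> ehrhart_positive (order_polytope {..<a + b} (ordinal_sum a b))"
proof (cases "d < 21")
  case True
  have small: "\<exists>a b. a + b = d \<and> \<not> ehrhart_positive (order_polytope {..<a + b} (ordinal_sum a b))"
    if "0 < a" "a + b = d" "linear_coeff a b < 0" for a b
    using not_ehrhart_positive[OF linear_coeff_neg[OF that(1) _ that(3)]] that(2) True by auto
  consider "d = 14" | "d = 15" | "d = 16" | "d = 17" | "d = 18" | "d = 19" | "d = 20"
    using assms True by linarith
  then show ?thesis
    by cases (rule small[OF _ _ linear_coeff_values(1)] small[OF _ _ linear_coeff_values(2)]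
      small[OF _ _ linear_coeff_values(3)] small[OF _ _ linear_coeff_values(4)]
      small[OF _ _ linear_coeff_values(5)] small[OF _ _ linear_coeff_values(6)]
      small[OF _ _ linear_coeff_values(7)]; simp; fail)+
next
  case False
  define m where "m = d - 21"
  have "20 + m + 1 = d"
    using False by (simp add: m_def)
  moreover have "\<not> ehrhart_positive (order_polytope {..<20 + m + 1} (ordinal_sum (20 + m) 1))"
    using coeff_cone_poly_neg[of m] unfolding cone_poly_def by (rule not_ehrhart_positive)
  ultimately show ?thesis by blast
qed

theorem theorem1p8:
  shows "(\<forall>d::nat. d \<ge> 14 \<longrightarrow>
            (\<exists>(P::nat set) r. finite P \<and> partial_order_on P r \<and> card P = d \<and>
               \<not> ehrhart_positive (order_polytope P r))) \<and>
         (\<forall>(P::'a set) r. finite P \<and> partial_order_on P r \<and> card P \<le> 11 \<longrightarrow>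
            ehrhart_positive (order_polytope P r))"
proof (intro conjI allI impI)
  fix d :: nat assume "14 \<le> d"
  then obtain a b where ab: "a + b = d" "\<not> ehrhart_positive (order_polytope {..<a + b} (ordinal_sum a b))"
    using not_ehrhart_positive_exists by blast
  show "\<exists>(P::nat set) r. finite P \<and> partial_order_on P r \<and> card P = d \<and> \<not> ehrhart_positive (order_polytope P r)"
    by (rule exI[of _ "{..<a + b}"], rule exI[of _ "ordinal_sum a b"])
      (use ab partial_order_ordinal_sum[of a b] in auto)
next
  fix P :: "'a set" and r assume "finite P \<and> partial_order_on P r \<and> card P \<le> 11"
  then show "ehrhart_positive (order_polytope P r)"
    by (intro ehrhart_positive_le_11) (auto simp: partial_order_on_def preorder_on_def)
qed

end
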